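(* Let $\Bbbk$ be an algebraically closed field of characteristic $0$. Let $P=\Bbbk[x_1,x_2,x_3]$ be the unimodular quadratic Poisson algebra determined by one of the following nine superpotentials $\Omega$, and let $P_\hbar$ be its standard deformation quantization, where $\hbar\in\Bbbk^\times$ is a scalar for which $P_\hbar$ is a quantum polynomial ring. Then, identifying graded (Poisson) automorphisms with their $3\times3$ matrices, $\mathrm{PR}(P)=\mathrm{QR}(P_\hbar)$, and this set consists of the following matrices, where $a,b,c,d$ range over $\Bbbk$ and $\xi$ ranges over roots of unity $\xi\ne1$: Case 1, $\Omega=x_1^3$: $\begin{bmatrix} -1 & 0 & 0 \\ a & 1 & 0 \\ d & 0 & 1 \end{bmatrix}$. Case 2, $\Omega=x_1^2x_2$: $\begin{bmatrix} 1 & 0 & 0 \\ 0 & \xi & 0 \\ 0 & d & 1 \end{bmatrix}$. Case 3, $\Omega=2x_1x_2x_3$: $\begin{bmatrix} 1 & 0 & 0 \\ 0 & 1 & 0 \\ 0 & 0 & \xi \end{bmatrix}$, $\begin{bmatrix} 1 & 0 & 0 \\ 0 & \xi & 0 \\ 0 & 0 & 1 \end{bmatrix}$, $\begin{bmatrix} \xi & 0 & 0 \\ 0 & 1 & 0 \\ 0 & 0 & 1 \end{bmatrix}$. Case 4, $\Omega=x_1^2x_2+x_1x_2^2$: $\begin{bmatrix} 0 & -1 & 0 \\ -1 & 0 & 0 \\ b & b & 1 \end{bmatrix}$, $\begin{bmatrix} -1 & 0 & 0 \\ 1 & 1 & 0 \\ b & 0 & 1 \end{bmatrix}$, $\begin{bmatrix}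 1 & 1 & 0 \\ 0 & -1 & 0 \\ 0 & c & 1 \end{bmatrix}$. Case 5, $\Omega=x_1^3+x_2^2x_3$: none (empty set). Case 6, $\Omega=x_1^3+x_1^2x_3+x_2^2x_3$: none. Case 7, $\Omega=\frac13(x_1^3+x_2^3+x_3^3)+\lambda x_1x_2x_3$ with $\lambda\in\Bbbk$, $\lambda^3\neq-1$: none. Case 8, $\Omega=x_1^3+x_1^2x_2+x_1x_2x_3$: $\begin{bmatrix} -1 & 0 & 0 \\ 0 & 1 & 0 \\ 2 & 0 & 1 \end{bmatrix}$. Case 9, $\Omega=x_1^2x_3+x_1x_2^2$: none.
   Context: The Poisson algebra determined by a homogeneous cubic superpotential $\Omega$ is $P=\Bbbk[x_1,x_2,x_3]$ (standard grading) with $\{x_1,x_2\}=\partial\Omega/\partial x_3$, $\{x_2,x_3\}=\partial\Omega/\partial x_1$, $\{x_3,x_1\}=\partial\Omega/\partial x_2$. Write $\{x_i,x_j\}=\sum_{k,l}c_{i,j}^{k,l}x_kx_l$. For $\hbar\in\Bbbk^\times$ the standard deformation quantization is $$P_\hbar=\Bbbk\langle y_1,y_2,y_3\rangle\Big/\Big([y_i,y_j]=\tfrac{\hbar}{2}\sum_{k,l}c_{i,j}^{k,l}(y_ky_l+y_ly_k)\Big)_{1\le i,j\le 3},$$ graded by $\deg y_i=1$. A $3\times3$ matrix $(a_{ij})$ represents the graded automorphism $x_i\mapsto\sum_ja_{ij}x_j$ of $P$, respectively $y_i\mapsto\sum_ja_{ij}y_j$ of $P_\hbar$. A quantum polynomial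 ring (of global dimension 3) is a Noetherian Artin-Schelter regular domain of global dimension 3 with Hilbert series $1/(1-t)^3$. (Artin-Schelter regular: connected $\mathbb N$-graded, finite Gelfand-Kirillov dimension, finite global dimension $d$, and $\mathrm{Ext}^i_A(\Bbbk,A)=0$ for $i\neq d$, $\mathrm{Ext}^d_A(\Bbbk,A)\cong\Bbbk(l)$ for some $l\in\mathbb Z$.) $\mathrm{PR}(P)$ is the set of Poisson reflections of $P$: finite-order graded Poisson automorphisms $\phi$ such that $\phi|_{P_1}$ has eigenvalues $1,1,\xi$ for some primitive $m$-th root of unity $\xi\ne1$. $\mathrm{QR}(P_\hbar)$ is the set of quasi-reflections of $P_\hbar$: finite-order graded algebra automorphisms $\phi$ whose trace series $\mathrm{Tr}_{P_\hbar}(\phi,t)=\sum_{i\ge0}\mathrm{tr}(\phi|_{(P_\hbar)_i})t^i$ has the form $\frac{1}{(1-t)^2g(t)}$ for some $g$ with $g(1)\neq0$. *)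

theory Defs
  imports
    "HOL-Analysis.Analysis"
    "HOL-Computational_Algebra.Computational_Algebra"
    "HOL-Library.Poly_Mapping"
    "HOL-Algebra.QuotRing"
    "HOL-Algebra.Module"
begin

section \<open>Graded algebras and graded modules\<close>

text \<open>
  One record serves both for \<open>\<int>\<close>-graded algebras over a field \<open>'k\<close> (then \<open>'r = 'k\<close>) and for
  \<open>\<int>\<close>-graded left modules over a ring with elements in \<open>'r\<close> (then \<open>mult\<close> and \<open>one\<close> are irrelevant).
  The locales for modules and algebras in HOL-Algebra require a commutative base ring, and
  those for domains and Noetherian rings are commutative or two-sided, so the noncommutative
  notions are defined here on the HOL-Algebra records.
\<close>

record ('r, 'm) graded = "('r, 'm) module" +
  comp :: "int \<Rightarrow> 'm set"

definition graded_group :: "('r, 'm, 'z) graded_scheme \<Rightarrow> bool" where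
  "graded_group M \<longleftrightarrow> abelian_group M \<and> (\<forall>j. additive_subgroup (comp M j) M) \<and>
     (\<forall>m\<in>carrier M. \<exists>!f. (\<forall>j. f j \<in> comp M j) \<and> finite {j. f j \<noteq> \<zero>\<^bsub>M\<^esub>} \<and>
        m = finsum M f {j. f j \<noteq> \<zero>\<^bsub>M\<^esub>})"

definition field_algebra :: "('k::field, 'a, 'z) module_scheme \<Rightarrow> bool" where
  "field_algebra A \<longleftrightarrow> ring A \<and>
     (\<forall>c. \<forall>a\<in>carrier A. c \<odot>\<^bsub>A\<^esub> a \<in> carrier A) \<and>
     (\<forall>c d. \<forall>a\<in>carrier A. (c + d) \<odot>\<^bsub>A\<^esub> a = (c \<odot>\<^bsub>A\<^esub> a) \<oplus>\<^bsub>A\<^esub> (d \<odot>\<^bsub>A\<^esub> a)) \<and>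
     (\<forall>c. \<forall>a\<in>carrier A. \<forall>b\<in>carrier A. c \<odot>\<^bsub>A\<^esub> (a \<oplus>\<^bsub>A\<^esub> b) = (c \<odot>\<^bsub>A\<^esub> a) \<oplus>\<^bsub>A\<^esub> (c \<odot>\<^bsub>A\<^esub> b)) \<and>
     (\<forall>c d. \<forall>a\<in>carrier A. (c * d) \<odot>\<^bsub>A\<^esub> a = c \<odot>\<^bsub>A\<^esub> (d \<odot>\<^bsub>A\<^esub> a)) \<and>
     (\<forall>a\<in>carrier A. 1 \<odot>\<^bsub>A\<^esub> a = a) \<and>
     (\<forall>c. \<forall>a\<in>carrier A. \<forall>b\<in>carrier A.
        (c \<odot>\<^bsub>A\<^esub> a) \<otimes>\<^bsub>A\<^esub> b = c \<odot>\<^bsub>A\<^esub> (a \<otimes>\<^bsub>A\<^esub> b) \<and> a \<otimes>\<^bsub>A\<^esub> (c \<odot>\<^bsub>A\<^esub> b) = c \<odot>\<^bsub>A\<^esub> (a \<otimes>\<^bsub>A\<^esub> b))"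

definition connected_graded :: "('k::field, 'a, 'z) graded_scheme \<Rightarrow> bool" where
  "connected_graded A \<longleftrightarrow> field_algebra A \<and> graded_group A \<and>
     (\<forall>j c. \<forall>a\<in>comp A j. c \<odot>\<^bsub>A\<^esub> a \<in> comp A j) \<and>
     (\<forall>i j. \<forall>a\<in>comp A i. \<forall>b\<in>comp A j. a \<otimes>\<^bsub>A\<^esub> b \<in> comp A (i + j)) \<and>
     (\<forall>j<0. comp A j = {\<zero>\<^bsub>A\<^esub>}) \<and>
     \<one>\<^bsub>A\<^esub> \<noteq> \<zero>\<^bsub>A\<^esub> \<and> comp A 0 = {c \<odot>\<^bsub>A\<^esub> \<one>\<^bsub>A\<^esub> | c. True}"


subsection \<open>Linear algebra over the ground field\<close>

definition lin_comb :: "('k::field, 'a, 'z) module_scheme \<Rightarrow> 'a set \<Rightarrow> ('a \<Rightarrow> 'k) \<Rightarrow> 'a" where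
  "lin_comb A B c = (\<Oplus>\<^bsub>A\<^esub>b\<in>B. c b \<odot>\<^bsub>A\<^esub> b)"

definition lin_span :: "('k::field, 'a, 'z) module_scheme \<Rightarrow> 'a set \<Rightarrow> 'a set" where
  "lin_span A S = {lin_comb A B c | B c. finite B \<and> B \<subseteq> S}"

definition lin_basis :: "('k::field, 'a, 'z) module_scheme \<Rightarrow> 'a set \<Rightarrow> 'a set \<Rightarrow> bool" where
  "lin_basis A E B \<longleftrightarrow> finite B \<and> B \<subseteq> E \<and> (\<forall>v\<in>E. \<exists>!c. c \<in> B \<rightarrow>\<^sub>E UNIV \<and> v = lin_comb A B c)"

definition lin_dim :: "('k::field, 'a, 'z) module_scheme \<Rightarrow> 'a set \<Rightarrow> nat" where
  "lin_dim A E = card (SOME B. lin_basis A E B)"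

definition lin_trace :: "('k::field, 'a, 'z) module_scheme \<Rightarrow> 'a set \<Rightarrow> ('a \<Rightarrow> 'a) \<Rightarrow> 'k" where
  "lin_trace A E f = (let B = (SOME B. lin_basis A E B) in
     \<Sum>b\<in>B. (THE c. c \<in> B \<rightarrow>\<^sub>E UNIV \<and> f b = lin_comb A B c) b)"


subsection \<open>Noetherian rings, domains, Hilbert series, Gelfand-Kirillov dimension\<close>

definition left_ideal :: "('a, 'z) ring_scheme \<Rightarrow> 'a set \<Rightarrow> bool" where
  "left_ideal A J \<longleftrightarrow> additive_subgroup J A \<and> (\<forall>a\<in>carrier A. \<forall>x\<in>J. a \<otimes>\<^bsub>A\<^esub> x \<in> J)"

definition left_noetherian :: "('a, 'z) ring_scheme \<Rightarrow> bool" where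
  "left_noetherian A \<longleftrightarrow> (\<forall>J. left_ideal A J \<longrightarrow>
     (\<exists>S. finite S \<and> S \<subseteq> carrier A \<and> J = \<Inter>{K. left_ideal A K \<and> S \<subseteq> K}))"

definition noetherian :: "('a, 'z) ring_scheme \<Rightarrow> bool" where
  "noetherian A \<longleftrightarrow> left_noetherian A \<and> left_noetherian (A\<lparr>mult := \<lambda>x y. y \<otimes>\<^bsub>A\<^esub> x\<rparr>)"

definition nc_domain :: "('a, 'z) ring_scheme \<Rightarrow> bool" where
  "nc_domain A \<longleftrightarrow> ring A \<and> \<one>\<^bsub>A\<^esub> \<noteq> \<zero>\<^bsub>A\<^esub> \<and>
     (\<forall>a\<in>carrier A. \<forall>b\<in>carrier A. a \<otimes>\<^bsub>A\<^esub> b = \<zero>\<^bsub>A\<^esub> \<longrightarrow> a = \<zero>\<^bsub>A\<^esub> \<or> b = \<zero>\<^bsub>A\<^esub>)"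

definition has_hilbert_series :: "('k::field, 'a, 'z) graded_scheme \<Rightarrow> rat fps \<Rightarrow> bool" where
  "has_hilbert_series A H \<longleftrightarrow> (\<forall>n::nat. \<exists>B. lin_basis A (comp A (int n)) B) \<and>
     Abs_fps (\<lambda>n. of_nat (lin_dim A (comp A (int n)))) = H"

text \<open>
  A finite-dimensional subspace is given by a finite spanning set \<open>V\<close>; \<open>gk_piece A V n\<close> is
  then the sum of the powers of degree \<open>0, \<dots>, n\<close> of that subspace.
\<close>

definition gk_piece :: "('k::field, 'a, 'z) module_scheme \<Rightarrow> 'a set \<Rightarrow> nat \<Rightarrow> 'a set" where
  "gk_piece A V n =
     lin_span A {foldr (mult A) vs \<one>\<^bsub>A\<^esub> | vs. set vs \<subseteq> V \<and> length vs \<le> n}"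

definition gk_dim :: "('k::field, 'a, 'z) module_scheme \<Rightarrow> ereal" where
  "gk_dim A = (SUP V\<in>{V. finite V \<and> V \<subseteq> carrier A}.
     limsup (\<lambda>n. ereal (log (real n) (real (lin_dim A (gk_piece A V n))))))"


section \<open>Homological algebra\<close>

definition left_module :: "('a, 'z) ring_scheme \<Rightarrow> ('a, 'm, 'y) module_scheme \<Rightarrow> bool" where
  "left_module A M \<longleftrightarrow> ring A \<and> abelian_group M \<and>
     (\<forall>a\<in>carrier A. \<forall>m\<in>carrier M. a \<odot>\<^bsub>M\<^esub> m \<in> carrier M) \<and>
     (\<forall>a\<in>carrier A. \<forall>b\<in>carrier A. \<forall>m\<in>carrier M.
        (a \<oplus>\<^bsub>A\<^esub> b) \<odot>\<^bsub>M\<^esub> m = (a \<odot>\<^bsub>M\<^esub> m) \<oplus>\<^bsub>M\<^esub> (b \<odot>\<^bsub>M\<^esub> m)) \<and>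
     (\<forall>a\<in>carrier A. \<forall>m\<in>carrier M. \<forall>n\<in>carrier M.
        a \<odot>\<^bsub>M\<^esub> (m \<oplus>\<^bsub>M\<^esub> n) = (a \<odot>\<^bsub>M\<^esub> m) \<oplus>\<^bsub>M\<^esub> (a \<odot>\<^bsub>M\<^esub> n)) \<and>
     (\<forall>a\<in>carrier A. \<forall>b\<in>carrier A. \<forall>m\<in>carrier M. (a \<otimes>\<^bsub>A\<^esub> b) \<odot>\<^bsub>M\<^esub> m = a \<odot>\<^bsub>M\<^esub> (b \<odot>\<^bsub>M\<^esub> m)) \<and>
     (\<forall>m\<in>carrier M. \<one>\<^bsub>A\<^esub> \<odot>\<^bsub>M\<^esub> m = m)"

definition module_hom ::
    "('a, 'z) ring_scheme \<Rightarrow> ('a, 'm, 'y) module_scheme \<Rightarrow> ('a, 'n, 'x) module_scheme \<Rightarrow> ('m \<Rightarrow> 'n) set" where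
  "module_hom A M N = {f \<in> carrier M \<rightarrow>\<^sub>E carrier N.
     (\<forall>m\<in>carrier M. \<forall>n\<in>carrier M. f (m \<oplus>\<^bsub>M\<^esub> n) = f m \<oplus>\<^bsub>N\<^esub> f n) \<and>
     (\<forall>a\<in>carrier A. \<forall>m\<in>carrier M. f (a \<odot>\<^bsub>M\<^esub> m) = a \<odot>\<^bsub>N\<^esub> f m)}"

text \<open>
  A definition in HOL cannot quantify over all types, so the modules below range over those whose
  elements lie in a fixed type, which plays the role of a universe. For global dimension and Ext it
  is the type \<open>'a set\<close> of sets of ring elements. When \<open>'a\<close> is infinite, every module of cardinality at
  most that of \<open>'a set\<close> has an isomorphic copy there; in particular so do all finitely generated
  modules, and for each module in the universe the free module on its underlying set.
  Hence the lifting property inside the universe is genuine projectivity, projective dimensions are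
  the usual ones, and by Auslander's theorem so is the global dimension.
\<close>

definition projective :: "('a, 'z) ring_scheme \<Rightarrow> ('a, 'm, 'y) module_scheme \<Rightarrow> bool" where
  "projective A P \<longleftrightarrow> left_module A P \<and>
     (\<forall>(M :: ('a, 'm) module) (N :: ('a, 'm) module) g f.
        left_module A M \<and> left_module A N \<and> g \<in> module_hom A M N \<and> g ` carrier M = carrier N \<and>
        f \<in> module_hom A P N \<longrightarrow> (\<exists>h\<in>module_hom A P M. \<forall>p\<in>carrier P. g (h p) = f p))"

text \<open>The differential \<open>d i\<close> maps from \<open>P (Suc i)\<close> to \<open>P i\<close>, and \<open>e\<close> from \<open>P 0\<close> to \<open>M\<close>.\<close>

definition projective_resolution ::
    "('a, 'z) ring_scheme \<Rightarrow> (nat \<Rightarrow> ('a, 'm, 'y) module_scheme) \<Rightarrow> (nat \<Rightarrow> 'm \<Rightarrow> 'm) \<Rightarrow>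
     ('m \<Rightarrow> 'n) \<Rightarrow> ('a, 'n, 'x) module_scheme \<Rightarrow> bool" where
  "projective_resolution A P d e M \<longleftrightarrow> (\<forall>i. projective A (P i)) \<and> left_module A M \<and>
     e \<in> module_hom A (P 0) M \<and> (\<forall>i. d i \<in> module_hom A (P (Suc i)) (P i)) \<and>
     e ` carrier (P 0) = carrier M \<and>
     d 0 ` carrier (P 1) = {p \<in> carrier (P 0). e p = \<zero>\<^bsub>M\<^esub>} \<and>
     (\<forall>i. d (Suc i) ` carrier (P (Suc (Suc i))) = {p \<in> carrier (P (Suc i)). d i p = \<zero>\<^bsub>P i\<^esub>})"

definition proj_dim :: "('a, 'z) ring_scheme \<Rightarrow> ('a, 'm) module \<Rightarrow> enat" where
  "proj_dim A M = Inf {enat n | n. \<exists>(P :: nat \<Rightarrow> ('a, 'm) module) d e.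
     projective_resolution A P d e M \<and> (\<forall>i>n. carrier (P i) = {\<zero>\<^bsub>P i\<^esub>})}"

definition global_dim :: "('a, 'z) ring_scheme \<Rightarrow> enat" where
  "global_dim A = (SUP M\<in>{M :: ('a, 'a set) module. left_module A M}. proj_dim A M)"


subsection \<open>Graded modules and the graded Ext groups \<open>Ext(k, A)\<close>\<close>

definition graded_left_module ::
    "('k::field, 'a, 'z) graded_scheme \<Rightarrow> ('a, 'm, 'y) graded_scheme \<Rightarrow> bool" where
  "graded_left_module A M \<longleftrightarrow> left_module A M \<and> graded_group M \<and>
     (\<forall>i j. \<forall>a\<in>comp A i. \<forall>m\<in>comp M j. a \<odot>\<^bsub>M\<^esub> m \<in> comp M (i + j))"

definition graded_hom ::
    "('k::field, 'a, 'z) graded_scheme \<Rightarrow> ('a, 'm, 'y) graded_scheme \<Rightarrow> ('a, 'n, 'x) graded_scheme \<Rightarrow>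
     int \<Rightarrow> ('m \<Rightarrow> 'n) set" where
  "graded_hom A M N n = {f \<in> module_hom A M N. \<forall>j. f ` comp M j \<subseteq> comp N (j + n)}"

definition augmentation :: "('k::field, 'a, 'z) graded_scheme \<Rightarrow> 'a \<Rightarrow> 'k" where
  "augmentation A a = (THE c. \<exists>f S. finite S \<and> (\<forall>n\<in>S. n > 0 \<and> f n \<in> comp A n) \<and>
     a = (c \<odot>\<^bsub>A\<^esub> \<one>\<^bsub>A\<^esub>) \<oplus>\<^bsub>A\<^esub> (\<Oplus>\<^bsub>A\<^esub>n\<in>S. f n))"

definition trivial_module :: "('k::field, 'a, 'z) graded_scheme \<Rightarrow> ('a, 'k) graded" where
  "trivial_module A = \<lparr>carrier = UNIV, mult = (*), one = 1, zero = 0, add = (+),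
     smult = (\<lambda>a c. augmentation A a * c), comp = (\<lambda>j. if j = 0 then UNIV else {0})\<rparr>"

definition regular_module :: "('k::field, 'a, 'z) graded_scheme \<Rightarrow> ('a, 'a) graded" where
  "regular_module A = \<lparr>carrier = carrier A, mult = mult A, one = \<one>\<^bsub>A\<^esub>, zero = \<zero>\<^bsub>A\<^esub>, add = add A,
     smult = mult A, comp = comp A\<rparr>"

definition graded_projective_resolution ::
    "('k::field, 'a, 'z) graded_scheme \<Rightarrow> (nat \<Rightarrow> ('a, 'm) graded) \<Rightarrow> (nat \<Rightarrow> 'm \<Rightarrow> 'm) \<Rightarrow>
     ('m \<Rightarrow> 'n) \<Rightarrow> ('a, 'n) graded \<Rightarrow> bool" where
  "graded_projective_resolution A P d e M \<longleftrightarrow> projective_resolution A P d e M \<and>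
     (\<forall>i. graded_left_module A (P i)) \<and> graded_left_module A M \<and>
     e \<in> graded_hom A (P 0) M 0 \<and> (\<forall>i. d i \<in> graded_hom A (P (Suc i)) (P i) 0)"

text \<open>
  For a graded projective resolution \<open>P\<close> of \<open>k\<close>, the following are the degree \<open>n\<close> parts of the
  \<open>i\<close>-cocycles, the \<open>i\<close>-coboundaries and the \<open>i\<close>-th cohomology of the complex \<open>Hom(P, A)\<close>. A graded
  right module is treated as the family of its homogeneous components together with the action
  of homogeneous ring elements; on cohomology \<open>a\<close> sends the class of \<open>f\<close> to that of \<open>p \<mapsto> f(p) a\<close>.
\<close>

definition ext_cocycles ::
    "('k::field, 'a, 'z) graded_scheme \<Rightarrow> (nat \<Rightarrow> ('a, 'm) graded) \<Rightarrow> (nat \<Rightarrow> 'm \<Rightarrow> 'm) \<Rightarrow>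
     nat \<Rightarrow> int \<Rightarrow> ('m \<Rightarrow> 'a) monoid" where
  "ext_cocycles A P d i n =
     \<lparr>carrier = {f \<in> graded_hom A (P i) (regular_module A) n. \<forall>p\<in>carrier (P (Suc i)). f (d i p) = \<zero>\<^bsub>A\<^esub>},
      mult = (\<lambda>f g. \<lambda>p\<in>carrier (P i). f p \<oplus>\<^bsub>A\<^esub> g p),
      one = (\<lambda>p\<in>carrier (P i). \<zero>\<^bsub>A\<^esub>)\<rparr>"

definition ext_coboundaries ::
    "('k::field, 'a, 'z) graded_scheme \<Rightarrow> (nat \<Rightarrow> ('a, 'm) graded) \<Rightarrow> (nat \<Rightarrow> 'm \<Rightarrow> 'm) \<Rightarrow>
     nat \<Rightarrow> int \<Rightarrow> ('m \<Rightarrow> 'a) set" where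
  "ext_coboundaries A P d i n = (case i of
       0 \<Rightarrow> {\<lambda>p\<in>carrier (P 0). \<zero>\<^bsub>A\<^esub>}
     | Suc j \<Rightarrow> {(\<lambda>p\<in>carrier (P (Suc j)). g (d j p)) | g. g \<in> graded_hom A (P j) (regular_module A) n})"

definition ext_group ::
    "('k::field, 'a, 'z) graded_scheme \<Rightarrow> (nat \<Rightarrow> ('a, 'm) graded) \<Rightarrow> (nat \<Rightarrow> 'm \<Rightarrow> 'm) \<Rightarrow>
     nat \<Rightarrow> int \<Rightarrow> ('m \<Rightarrow> 'a) set monoid" where
  "ext_group A P d i n = ext_cocycles A P d i n Mod ext_coboundaries A P d i n"

definition ext_class ::
    "('k::field, 'a, 'z) graded_scheme \<Rightarrow> (nat \<Rightarrow> ('a, 'm) graded) \<Rightarrow> (nat \<Rightarrow> 'm \<Rightarrow> 'm) \<Rightarrow>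
     nat \<Rightarrow> int \<Rightarrow> ('m \<Rightarrow> 'a) \<Rightarrow> ('m \<Rightarrow> 'a) set" where
  "ext_class A P d i n f = ext_coboundaries A P d i n #>\<^bsub>ext_cocycles A P d i n\<^esub> f"

definition ext_vanishes ::
    "('k::field, 'a, 'z) graded_scheme \<Rightarrow> (nat \<Rightarrow> ('a, 'm) graded) \<Rightarrow> (nat \<Rightarrow> 'm \<Rightarrow> 'm) \<Rightarrow> nat \<Rightarrow> bool" where
  "ext_vanishes A P d i \<longleftrightarrow> (\<forall>n. carrier (ext_group A P d i n) = {\<one>\<^bsub>ext_group A P d i n\<^esub>})"

text \<open>
  Isomorphism of graded right modules from \<open>Ext\<^sup>i(k, A)\<close> to the shift \<open>k(l)\<close>, whose component of
  degree \<open>n\<close> is that of \<open>k\<close> of degree \<open>n + l\<close>.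
\<close>

definition ext_is_shifted_field ::
    "('k::field, 'a, 'z) graded_scheme \<Rightarrow> (nat \<Rightarrow> ('a, 'm) graded) \<Rightarrow> (nat \<Rightarrow> 'm \<Rightarrow> 'm) \<Rightarrow>
     nat \<Rightarrow> int \<Rightarrow> bool" where
  "ext_is_shifted_field A P d i l \<longleftrightarrow> (\<exists>\<psi>.
     (\<forall>n. \<psi> n \<in> iso (ext_group A P d i n)
                    \<lparr>carrier = comp (trivial_module A) (n + l), mult = (+), one = 0\<rparr>) \<and>
     (\<forall>m n. \<forall>a\<in>comp A m. \<forall>f\<in>carrier (ext_cocycles A P d i n).
        \<psi> (n + m) (ext_class A P d i (n + m) (\<lambda>p\<in>carrier (P i). f p \<otimes>\<^bsub>A\<^esub> a)) =
        \<psi> n (ext_class A P d i n f) * augmentation A a))"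

definition artin_schelter_regular :: "('k::field, 'a, 'z) graded_scheme \<Rightarrow> nat \<Rightarrow> bool" where
  "artin_schelter_regular A d \<longleftrightarrow> connected_graded A \<and> gk_dim A < \<infinity> \<and> global_dim A = enat d \<and>
     (\<exists>(P :: nat \<Rightarrow> ('a, 'a set) graded) \<delta> e.
        graded_projective_resolution A P \<delta> e (trivial_module A) \<and>
        (\<forall>i. i \<noteq> d \<longrightarrow> ext_vanishes A P \<delta> i) \<and>
        (\<exists>l. ext_is_shifted_field A P \<delta> d l))"

definition quantum_polynomial_ring :: "('k::field, 'a, 'z) graded_scheme \<Rightarrow> bool" where
  "quantum_polynomial_ring A \<longleftrightarrow> artin_schelter_regular A 3 \<and> noetherian A \<and> nc_domain A \<and>
     has_hilbert_series A (inverse ((1 - fps_X) ^ 3))"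


section \<open>Graded automorphisms\<close>

definition graded_automorphisms :: "('k::field, 'a, 'z) graded_scheme \<Rightarrow> ('a \<Rightarrow> 'a) set" where
  "graded_automorphisms A = {\<phi> \<in> ring_iso A A. \<phi> \<in> extensional (carrier A) \<and>
     (\<forall>c. \<forall>a\<in>carrier A. \<phi> (c \<odot>\<^bsub>A\<^esub> a) = c \<odot>\<^bsub>A\<^esub> \<phi> a) \<and> (\<forall>n. \<phi> ` comp A n = comp A n)}"

definition finite_order :: "('k::field, 'a, 'z) graded_scheme \<Rightarrow> ('a \<Rightarrow> 'a) \<Rightarrow> bool" where
  "finite_order A \<phi> \<longleftrightarrow> (\<exists>m>0. \<forall>a\<in>carrier A. (\<phi> ^^ m) a = a)"

definition represents ::
    "('k::field, 'a, 'z) graded_scheme \<Rightarrow> (3 \<Rightarrow> 'a) \<Rightarrow> 'k^3^3 \<Rightarrow> ('a \<Rightarrow> 'a) \<Rightarrow> bool" where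
  "represents A g M \<phi> \<longleftrightarrow> (\<forall>i. \<phi> (g i) = (\<Oplus>\<^bsub>A\<^esub>j\<in>UNIV. (M $ i $ j) \<odot>\<^bsub>A\<^esub> g j))"

definition matrices ::
    "('k::field, 'a, 'z) graded_scheme \<Rightarrow> (3 \<Rightarrow> 'a) \<Rightarrow> ('a \<Rightarrow> 'a) set \<Rightarrow> ('k^3^3) set" where
  "matrices A g \<Phi> = {M. \<exists>\<phi>\<in>\<Phi>. represents A g M \<phi>}"

definition charpoly :: "'k::field^3^3 \<Rightarrow> 'k poly" where
  "charpoly M = det (mat [:0, 1:] - map_matrix (\<lambda>c. [:c:]) M)"

definition primitive_root :: "nat \<Rightarrow> 'k::field \<Rightarrow> bool" where
  "primitive_root m \<xi> \<longleftrightarrow> m > 0 \<and> \<xi> ^ m = 1 \<and> (\<forall>j. 0 < j \<and> j < m \<longrightarrow> \<xi> ^ j \<noteq> 1)"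

definition root_of_unity :: "'k::field \<Rightarrow> bool" where
  "root_of_unity \<xi> \<longleftrightarrow> (\<exists>m>0. \<xi> ^ m = 1)"


section \<open>The Poisson algebra of a superpotential\<close>

text \<open>The polynomial ring in three variables, indexed by the three-element type \<open>3\<close>, where \<open>3 = 0\<close>.\<close>

type_synonym 'k pol3 = "(3 \<Rightarrow>\<^sub>0 nat) \<Rightarrow>\<^sub>0 'k"

definition X :: "3 \<Rightarrow> 'k::field pol3" where
  "X i = Poly_Mapping.single (Poly_Mapping.single i 1) 1"

definition Const :: "'k::field \<Rightarrow> 'i::monoid_add \<Rightarrow>\<^sub>0 'k" where
  "Const c = Poly_Mapping.single 0 c"

definition poly_algebra :: "('k::field, 'k pol3) graded" where
  "poly_algebra = \<lparr>carrier = UNIV, mult = (*), one = 1, zero = 0, add = (+),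
     smult = (\<lambda>c p. Const c * p),
     comp = (\<lambda>n. {p. \<forall>m\<in>Poly_Mapping.keys p. int (\<Sum>i\<in>UNIV. Poly_Mapping.lookup m i) = n})\<rparr>"

definition pdiff :: "3 \<Rightarrow> 'k::field pol3 \<Rightarrow> 'k pol3" where
  "pdiff i p = (\<Sum>m\<in>Poly_Mapping.keys p. Poly_Mapping.single (m - Poly_Mapping.single i 1)
     (of_nat (Poly_Mapping.lookup m i) * Poly_Mapping.lookup p m))"

text \<open>
  The biderivation with \<open>{x\<^sub>1, x\<^sub>2} = \<partial>\<Omega>/\<partial>x\<^sub>3\<close>, \<open>{x\<^sub>2, x\<^sub>3} = \<partial>\<Omega>/\<partial>x\<^sub>1\<close>, \<open>{x\<^sub>3, x\<^sub>1} = \<partial>\<Omega>/\<partial>x\<^sub>2\<close>.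
\<close>

definition pbracket :: "'k::field pol3 \<Rightarrow> 'k pol3 \<Rightarrow> 'k pol3 \<Rightarrow> 'k pol3" where
  "pbracket \<Omega> f g =
     pdiff 3 \<Omega> * (pdiff 1 f * pdiff 2 g - pdiff 2 f * pdiff 1 g) +
     pdiff 1 \<Omega> * (pdiff 2 f * pdiff 3 g - pdiff 3 f * pdiff 2 g) +
     pdiff 2 \<Omega> * (pdiff 3 f * pdiff 1 g - pdiff 1 f * pdiff 3 g)"

definition poisson_reflections :: "'k::field pol3 \<Rightarrow> ('k pol3 \<Rightarrow> 'k pol3) set" where
  "poisson_reflections \<Omega> = {\<phi> \<in> graded_automorphisms poly_algebra.
     (\<forall>f g. \<phi> (pbracket \<Omega> f g) = pbracket \<Omega> (\<phi> f) (\<phi> g)) \<and> finite_order poly_algebra \<phi> \<and>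
     (\<exists>M m \<xi>. represents poly_algebra X M \<phi> \<and> primitive_root m \<xi> \<and> \<xi> \<noteq> 1 \<and>
        charpoly M = [:-1, 1:] * [:-1, 1:] * [:-\<xi>, 1:])}"


section \<open>The standard deformation quantization\<close>

text \<open>Words under concatenation; finitely supported functions on them form the free algebra.\<close>

datatype 'v word = Word (letters: "'v list")

instantiation word :: (type) monoid_add
begin

definition zero_word :: "'v word" where
  "zero_word = Word []"

definition plus_word :: "'v word \<Rightarrow> 'v word \<Rightarrow> 'v word" where
  "plus_word v w = Word (letters v @ letters w)"

instance
  by standard (simp_all add: zero_word_def plus_word_def)

end

type_synonym 'k free3 = "3 word \<Rightarrow>\<^sub>0 'k"

definition Y :: "3 \<Rightarrow> 'k::field free3" where
  "Y i = Poly_Mapping.single (Word [i]) 1"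

definition free_algebra :: "'k::field free3 ring" where
  "free_algebra = \<lparr>carrier = UNIV, mult = (*), one = 1, zero = 0, add = (+)\<rparr>"

text \<open>
  The coefficients \<open>c k l\<close> are not unique since \<open>x\<^sub>k x\<^sub>l = x\<^sub>l x\<^sub>k\<close>, but the symmetrized relation does not
  depend on their choice; all choices are allowed.
\<close>

definition quantization_relations :: "'k::field pol3 \<Rightarrow> 'k \<Rightarrow> 'k free3 set" where
  "quantization_relations \<Omega> h =
     {Y i * Y j - Y j * Y i -
        Const (h / 2) * (\<Sum>k\<in>UNIV. \<Sum>l\<in>UNIV. Const (c k l) * (Y k * Y l + Y l * Y k)) | i j c.
      pbracket \<Omega> (X i) (X j) = (\<Sum>k\<in>UNIV. \<Sum>l\<in>UNIV. Const (c k l) * (X k * X l))}"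

definition quantization_ideal :: "'k::field pol3 \<Rightarrow> 'k \<Rightarrow> 'k free3 set" where
  "quantization_ideal \<Omega> h = Idl\<^bsub>free_algebra\<^esub> (quantization_relations \<Omega> h)"

definition to_quantization :: "'k::field pol3 \<Rightarrow> 'k \<Rightarrow> 'k free3 \<Rightarrow> 'k free3 set" where
  "to_quantization \<Omega> h p = quantization_ideal \<Omega> h +>\<^bsub>free_algebra\<^esub> p"

definition quantization :: "'k::field pol3 \<Rightarrow> 'k \<Rightarrow> ('k, 'k free3 set) graded" where
  "quantization \<Omega> h = (let Q = free_algebra Quot quantization_ideal \<Omega> h in
     \<lparr>carrier = carrier Q, mult = mult Q, one = \<one>\<^bsub>Q\<^esub>, zero = \<zero>\<^bsub>Q\<^esub>, add = add Q,
      smult = (\<lambda>c a. to_quantization \<Omega> h (Const c) \<otimes>\<^bsub>Q\<^esub> a),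
      comp = (\<lambda>n. to_quantization \<Omega> h ` {p. \<forall>w\<in>Poly_Mapping.keys p. int (length (letters w)) = n})\<rparr>)"

definition quantization_gen :: "'k::field pol3 \<Rightarrow> 'k \<Rightarrow> 3 \<Rightarrow> 'k free3 set" where
  "quantization_gen \<Omega> h i = to_quantization \<Omega> h (Y i)"

definition trace_series :: "('k::field, 'a, 'z) graded_scheme \<Rightarrow> ('a \<Rightarrow> 'a) \<Rightarrow> 'k fps" where
  "trace_series A \<phi> = Abs_fps (\<lambda>n. lin_trace A (comp A (int n)) \<phi>)"

text \<open>
  \<open>inverse\<close> rather than division: on power series, division by a multiple of \<open>fps_X\<close> is a truncation,
  whereas \<open>inverse\<close> of such a series is \<open>0\<close> and thus never a trace series of a nonzero algebra.
\<close>

definition quasi_reflections :: "('k::field, 'a, 'z) graded_scheme \<Rightarrow> ('a \<Rightarrow> 'a) set" where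
  "quasi_reflections A = {\<phi> \<in> graded_automorphisms A. finite_order A \<phi> \<and>
     (\<exists>g. poly g 1 \<noteq> 0 \<and> trace_series A \<phi> = inverse ((1 - fps_X) ^ 2 * fps_of_poly g))}"

end

theory Submission
  imports Defs
begin

text \<open>
  Both sets of automorphisms are reduced to one condition on matrices, which is then solved for each
  of the nine cubics. Write \<open>\<Omega> = 1/6 \<Sum> T i j k x\<^sub>i x\<^sub>j x\<^sub>k\<close> with a symmetric tensor \<open>T\<close>, and let \<open>F\<close> be the cubic
  function on vectors defined by \<open>\<Omega>\<close>.

  \<^emph>\<open>Automorphisms.\<close> Since \<open>{x\<^sub>i\<^sub>+\<^sub>1, x\<^sub>i\<^sub>+\<^sub>2} = \<partial>\<^sub>i \<Omega>\<close>, an invertible matrix \<open>M\<close> gives a Poisson automorphism if and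
  only if \<open>(\<partial>\<^sub>i \<Omega>) \<circ> M\<close> is the combination of the partial derivatives with the cofactors of \<open>M\<close> as
  coefficients (\<open>gradient_equivariant\<close>). The relations of the quantization have a skew part, which is
  the commutator of two generators, and a symmetric part, which is a multiple of the symmetrized
  \<open>\<partial>\<^sub>i \<Omega>\<close>. The skew parts are always transformed by the cofactors of \<open>M\<close>; so \<open>M\<close> preserves the space of
  relations if and only if the symmetric parts are transformed in the same way, which is again
  equivariance of the gradient (\<open>rel_transform\<close>, \<open>gradient_equivariant_if_rel\<close>).

  \<^emph>\<open>Trace series.\<close> Let \<open>V\<close> be the span of the generators and \<open>R\<close> the span of the relations \<open>\<rho>\<^sub>i\<close> in the free
  algebra, whose component of degree \<open>n\<close> is \<open>F\<^sub>n\<close>; let \<open>w = \<Sum> y\<^sub>i \<rho>\<^sub>i = \<Sum> \<rho>\<^sub>i y\<^sub>i\<close>, and let \<open>J\<close> be the defining ideal. Then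
  \<open>J\<^sub>n\<^sub>+\<^sub>3 = J\<^sub>n\<^sub>+\<^sub>2 V + F\<^sub>n\<^sub>+\<^sub>1 R\<close>, and these two summands intersect at least in \<open>J\<^sub>n\<^sub>+\<^sub>1 R + F\<^sub>n w\<close>. Absence of zero divisors
  in the quotient gives \<open>J\<^sub>n\<^sub>+\<^sub>1 R \<inter> F\<^sub>n w = J\<^sub>n w\<close>, and a count of dimensions with the Hilbert series
  \<open>1/(1 - t)\<^sup>3\<close> shows that nothing else is in the intersection (\<open>overlap_eq\<close>). An automorphism acts on
  \<open>V\<close>, \<open>R\<close> and \<open>w\<close> with traces \<open>tr M\<close>, \<open>e\<^sub>2(M)\<close> and \<open>det M\<close>. Repeating the count with traces in place of
  dimensions gives the trace series \<open>1 / (1 - tr M t + e\<^sub>2(M) t\<^sup>2 - det M t\<^sup>3)\<close>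
  (\<open>quotient_trace_recurrence\<close>), the same as for the polynomial ring. It has the shape required of a
  quasi-reflection if and only if the characteristic polynomial of \<open>M\<close> is \<open>(x - 1)\<^sup>2 (x - \<xi>)\<close> with
  \<open>\<xi> \<noteq> 1\<close>, which is the condition on Poisson reflections (\<open>matrices_poisson_reflections\<close>,
  \<open>matrices_quasi_reflections\<close>).

  \<^emph>\<open>Classification.\<close> A matrix of finite order with this characteristic polynomial is \<open>1 + \<alpha> u\<^sup>T\<close> for a
  vector \<open>\<alpha>\<close> and a linear form \<open>u\<close> (\<open>finite_order_reflection_rank_one\<close>). Equivariance of the gradient
  amounts to \<open>F(M v) = det M F(v)\<close> (\<open>gradient_equivariant_iff_semi_invariant\<close>). As \<open>M\<close> fixes the plane
  \<open>u = 0\<close> pointwise and \<open>det M \<noteq> 1\<close>, \<open>F\<close> vanishes on this plane, and \<open>u\<close> divides \<open>\<Omega>\<close>. So irreducible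
  cubics have no reflections. For the others \<open>u\<close> is one of at most three linear factors, and some
  values of the equation \<open>F(M v) = det M F(v)\<close> determine the possible \<open>\<alpha>\<close>.
\<close>

section \<open>Traces on finite-dimensional subspaces\<close>

locale finite_dim_traces = vector_space scale for scale :: "'a::field \<Rightarrow> 'b::ab_group_add \<Rightarrow> 'b" (infixr "*\<^sub>k" 75)
begin

definition finite_basis :: "'b set \<Rightarrow> 'b set \<Rightarrow> bool" where
  "finite_basis E B \<longleftrightarrow> finite B \<and> independent B \<and> span B = E"

definition fin_dim :: "'b set \<Rightarrow> bool" where
  "fin_dim E \<longleftrightarrow> (\<exists>B. finite_basis E B)"

definition trace_on :: "'b set \<Rightarrow> ('b \<Rightarrow> 'b) \<Rightarrow> 'a" where
  "trace_on E f = (let B = (SOME B. finite_basis E B) in \<Sum>b\<in>B. representation B (f b) b)"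

lemma finite_basisD:
  assumes "finite_basis E B"
  shows "finite B" "independent B" "span B = E" "subspace E" "B \<subseteq> E"
  using assms span_superset by (auto simp: finite_basis_def)

text \<open>
  Expanding the images in the other basis turns either diagonal sum into the same double sum
  over both bases. Hence the basis picked in \<open>trace_on\<close> is irrelevant for invariant subspaces.
\<close>

lemma trace_via_two_bases:
  assumes B: "finite_basis E B" and C: "finite_basis E C"
    and f: "Vector_Spaces.linear scale scale f" and fE: "f ` E \<subseteq> E"
  shows "(\<Sum>b\<in>B. representation B (f b) b) = (\<Sum>c\<in>C. representation C (f c) c)"
proof -
  interpret f: Vector_Spaces.linear scale scale f by (fact f)
  note b = finite_basisD[OF B] and c = finite_basisD[OF C]
  have expand_B: "(\<Sum>x\<in>B. representation B v x *\<^sub>k x) = v" if "v \<in> E" for v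
    using sum_representation_eq[of B v B] b that by simp
  have expand_C: "(\<Sum>x\<in>C. representation C v x *\<^sub>k x) = v" if "v \<in> E" for v
    using sum_representation_eq[of C v C] c that by simp
  have "(\<Sum>b\<in>B. representation B (f b) b) =
      (\<Sum>b\<in>B. \<Sum>c\<in>C. representation C (f b) c * representation B c b)"
  proof (rule sum.cong[OF refl])
    fix x assume x: "x \<in> B"
    have "f x \<in> E" using x b fE by auto
    then have "representation B (f x) x = representation B (\<Sum>c\<in>C. representation C (f x) c *\<^sub>k c) x"
      by (simp add: expand_C)
    also have "\<dots> = (\<Sum>c\<in>C. representation B (representation C (f x) c *\<^sub>k c) x)"
      using c b by (subst representation_sum) (auto intro!: subspace_scale)
    also have "\<dots> = (\<Sum>c\<in>C. representation C (f x) c * representation B c x)"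
      by (rule sum.cong[OF refl], subst representation_scale) (use c b in auto)
    finally show "representation B (f x) x = \<dots>" .
  qed
  also have "\<dots> = (\<Sum>c\<in>C. \<Sum>b\<in>B. representation B c b * representation C (f b) c)"
    by (subst sum.swap) (simp add: mult.commute)
  also have "\<dots> = (\<Sum>c\<in>C. representation C (f c) c)"
  proof (rule sum.cong[OF refl])
    fix y assume y: "y \<in> C"
    have fB: "f i \<in> E" if "i \<in> B" for i using that b fE by auto
    have "y \<in> E" using y c by auto
    then have "representation C (f y) y = representation C (f (\<Sum>b\<in>B. representation B y b *\<^sub>k b)) y"
      by (simp add: expand_B)
    also have "\<dots> = representation C (\<Sum>b\<in>B. representation B y b *\<^sub>k f b) y"
      by (simp add: f.sum f.scale)
    also have "\<dots> = (\<Sum>b\<in>B. representation C (representation B y b *\<^sub>k f b) y)"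
      using c fB by (subst representation_sum) (auto intro!: subspace_scale)
    also have "\<dots> = (\<Sum>b\<in>B. representation B y b * representation C (f b) y)"
      by (rule sum.cong[OF refl], subst representation_scale) (use c fB in auto)
    finally show "(\<Sum>b\<in>B. representation B y b * representation C (f b) y) = representation C (f y) y" ..
  qed
  finally show ?thesis .
qed

lemma trace_on_basis:
  assumes "finite_basis E B" "Vector_Spaces.linear scale scale f" "f ` E \<subseteq> E"
  shows "trace_on E f = (\<Sum>b\<in>B. representation B (f b) b)"
  unfolding trace_on_def Let_def
  by (rule trace_via_two_bases) (use assms someI[of "finite_basis E" B] in auto)

text \<open>
  The bases met later are naturally indexed by pairs (products \<open>b z\<^sub>i\<close>) or by a disjoint union
  (a lifted basis of a quotient together with one of the kernel), hence the indexed form.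
\<close>

lemma trace_on_family:
  assumes I: "finite I" "inj_on v I" "finite_basis E (v ` I)"
    and f: "Vector_Spaces.linear scale scale f"
    and fv: "\<And>i. i \<in> I \<Longrightarrow> f (v i) = (\<Sum>j\<in>I. C i j *\<^sub>k v j)"
  shows "trace_on E f = (\<Sum>i\<in>I. C i i)"
proof -
  interpret f: Vector_Spaces.linear scale scale f by (fact f)
  note b = finite_basisD[OF I(3)]
  have fE: "f ` E \<subseteq> E"
  proof -
    have "f ` span (v ` I) = span (f ` v ` I)" by (rule f.span_image[symmetric])
    also have "\<dots> \<subseteq> E"
    proof (rule span_minimal[OF _ b(4)], clarsimp)
      fix i assume "i \<in> I"
      then show "f (v i) \<in> E" using fv b(4,5) by (auto intro!: subspace_sum subspace_scale)
    qed
    finally show ?thesis using b by simp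
  qed
  have rep: "representation (v ` I) (v j) (v i) = (if i = j then 1 else 0)" if "i \<in> I" "j \<in> I" for i j
    using that b I(2) by (subst representation_basis) (auto dest: inj_onD)
  have "trace_on E f = (\<Sum>i\<in>I. representation (v ` I) (f (v i)) (v i))"
    using trace_on_basis[OF I(3) f fE] by (simp add: sum.reindex[OF I(2)])
  also have "\<dots> = (\<Sum>i\<in>I. C i i)"
  proof (rule sum.cong[OF refl])
    fix i assume i: "i \<in> I"
    have "representation (v ` I) (f (v i)) (v i) =
        (\<Sum>j\<in>I. representation (v ` I) (C i j *\<^sub>k v j) (v i))"
      using i b by (subst fv, simp, subst representation_sum) (auto intro!: subspace_scale)
    also have "\<dots> = (\<Sum>j\<in>I. C i j * representation (v ` I) (v j) (v i))"
      by (rule sum.cong[OF refl], subst representation_scale) (use b in auto)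
    also have "\<dots> = (\<Sum>j\<in>I. if i = j then C i j else 0)"
      by (rule sum.cong) (auto simp: rep i)
    finally show "representation (v ` I) (f (v i)) (v i) = C i i" using i I(1) by simp
  qed
  finally show ?thesis .
qed

lemma finite_basis_family:
  assumes "finite I"
    and indep: "\<And>a. (\<Sum>i\<in>I. a i *\<^sub>k v i) = 0 \<Longrightarrow> \<forall>i\<in>I. a i = 0"
    and E: "subspace E" "v ` I \<subseteq> E" "\<And>x. x \<in> E \<Longrightarrow> \<exists>a. x = (\<Sum>i\<in>I. a i *\<^sub>k v i)"
  shows "inj_on v I" "finite_basis E (v ` I)"
proof -
  show inj: "inj_on v I"
  proof (rule inj_onI, rule ccontr)
    fix i j assume ij: "i \<in> I" "j \<in> I" "v i = v j" "i \<noteq> j"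
    define a where "a k = (if k = i then 1 else if k = j then -1 else (0::'a))" for k
    have "(\<Sum>k\<in>I. a k *\<^sub>k v k) = (\<Sum>k\<in>{i,j}. a k *\<^sub>k v k)"
      by (rule sum.mono_neutral_right) (use assms(1) ij in \<open>auto simp: a_def\<close>)
    also have "\<dots> = 0" using ij by (simp add: a_def)
    finally show False using indep[of a] ij by (auto simp: a_def)
  qed
  have "independent (v ` I)"
  proof (rule independent_if_scalars_zero)
    show "finite (v ` I)" using assms(1) by simp
    fix g x assume g: "(\<Sum>x\<in>v ` I. g x *\<^sub>k x) = 0" and x: "x \<in> v ` I"
    then have "(\<Sum>i\<in>I. g (v i) *\<^sub>k v i) = 0" by (simp add: sum.reindex[OF inj])
    from indep[OF this] x show "g x = 0" by auto
  qed
  moreover have "span (v ` I) = E"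
  proof
    show "span (v ` I) \<subseteq> E" using E by (intro span_minimal)
    show "E \<subseteq> span (v ` I)"
      using E(3) by (force intro!: span_sum span_scale intro: span_base)
  qed
  ultimately show "finite_basis E (v ` I)" using assms(1) by (simp add: finite_basis_def)
qed

lemma extend_to_finite_basis:
  assumes E: "fin_dim E" and K: "subspace K" "K \<subseteq> E" and A: "A \<subseteq> K" "independent A"
  shows "\<exists>B. finite_basis K B \<and> A \<subseteq> B"
proof -
  obtain B where B: "A \<subseteq> B" "B \<subseteq> K" "independent B" "K \<subseteq> span B"
    using maximal_independent_subset_extend[OF A] by blast
  obtain C where C: "finite_basis E C" using E by (auto simp: fin_dim_def)
  have "finite B"
    using independent_span_bound[of C B] finite_basisD[OF C] B K by auto
  moreover have "span B = K"
    using B K span_minimal[of B K] by auto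
  ultimately show ?thesis using B by (auto simp: finite_basis_def)
qed

lemma fin_dim_subspace: "fin_dim E \<Longrightarrow> subspace K \<Longrightarrow> K \<subseteq> E \<Longrightarrow> fin_dim K"
  using extend_to_finite_basis[of E K "{}"] by (auto simp: fin_dim_def independent_empty)

text \<open>
  A basis of \<open>U \<inter> W\<close> extends to bases of \<open>U\<close> and \<open>W\<close> whose union is a basis of \<open>U + W\<close>, and the
  diagonal entries are counted by inclusion and exclusion. This is how a decomposition of the
  defining ideal becomes an equation between trace series.
\<close>

lemma trace_on_sum:
  assumes E: "fin_dim E" and U: "subspace U" "U \<subseteq> E" and W: "subspace W" "W \<subseteq> E"
    and f: "Vector_Spaces.linear scale scale f" and fU: "f ` U \<subseteq> U" and fW: "f ` W \<subseteq> W"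
  shows "trace_on {x + y | x y. x \<in> U \<and> y \<in> W} f + trace_on (U \<inter> W) f = trace_on U f + trace_on W f"
proof -
  interpret f: Vector_Spaces.linear scale scale f by (fact f)
  let ?S = "{x + y | x y. x \<in> U \<and> y \<in> W}"
  obtain B where B: "finite_basis (U \<inter> W) B"
    using extend_to_finite_basis[OF E, of "U \<inter> W" "{}"] U W
    by (auto simp: subspace_inter independent_empty)
  note b = finite_basisD[OF B]
  obtain B1 where B1: "finite_basis U B1" "B \<subseteq> B1"
    using extend_to_finite_basis[OF E U, of B] b by auto
  obtain B2 where B2: "finite_basis W B2" "B \<subseteq> B2"
    using extend_to_finite_basis[OF E W, of B] b by auto
  note b1 = finite_basisD[OF B1(1)] and b2 = finite_basisD[OF B2(1)]
  \<comment> \<open>A vector of \<open>U\<close> and a combination of \<open>B2 - B\<close> cancel only if both vanish: up to sign they are one vector of \<open>U \<inter> W\<close>, the span of \<open>B\<close>.\<close>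
  have key: "x = 0" "y = 0"
    if x: "x = (\<Sum>c\<in>B1. a c *\<^sub>k c)" and y: "y = (\<Sum>c\<in>B2 - B. d c *\<^sub>k c)" and xy: "x + y = 0"
    for x y a d
  proof -
    have xU: "x \<in> U" unfolding x using b1 by (auto intro!: subspace_sum subspace_scale)
    have yW: "y \<in> W" unfolding y using b2 by (auto intro!: subspace_sum subspace_scale)
    have "y = - x" using xy by (simp add: eq_neg_iff_add_eq_0 add.commute)
    then have "y \<in> U \<inter> W" using xU yW U subspace_neg by auto
    then have "y = (\<Sum>c\<in>B. representation B y c *\<^sub>k c)"
      using sum_representation_eq[of B y B] b by simp
    moreover have "(\<Sum>c\<in>B2. (if c \<in> B then - representation B y c else d c) *\<^sub>k c) =
        (\<Sum>c\<in>B2 - B. d c *\<^sub>k c) - (\<Sum>c\<in>B. representation B y c *\<^sub>k c)"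
      by (subst sum.subset_diff[OF B2(2) b2(1)]) (simp add: scale_minus_left sum_negf)
    ultimately have "(\<Sum>c\<in>B2. (if c \<in> B then - representation B y c else d c) *\<^sub>k c) = 0"
      using y by simp
    then have "c \<in> B2 \<Longrightarrow> (if c \<in> B then - representation B y c else d c) = 0" for c
      by (rule independentD[OF b2(2) b2(1) subset_refl])
    then have "\<forall>c\<in>B2 - B. d c = 0" by (metis DiffD1 DiffD2)
    then show "y = 0" unfolding y by simp
    then show "x = 0" using xy by simp
  qed
  have disj: "B1 \<inter> (B2 - B) = {}"
  proof (rule ccontr)
    assume "B1 \<inter> (B2 - B) \<noteq> {}"
    then obtain z where z: "z \<in> B1" "z \<in> B2" "z \<notin> B" by auto
    have e: "(\<Sum>c\<in>A. (if c = z then 1 else 0) *\<^sub>k c) = z" if "finite A" "z \<in> A" for A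
    proof -
      have "(\<Sum>c\<in>A. (if c = z then 1 else 0) *\<^sub>k c) = (\<Sum>c\<in>A. if c = z then c else 0)"
        by (rule sum.cong) auto
      then show ?thesis using that by simp
    qed
    have "z = (\<Sum>c\<in>B1. (if c = z then 1 else 0) *\<^sub>k c)" using e[of B1] z b1 by simp
    moreover have "- z = (\<Sum>c\<in>B2 - B. (if c = z then - 1 else 0) *\<^sub>k c)"
    proof -
      have "- z = - (\<Sum>c\<in>B2 - B. (if c = z then 1 else 0) *\<^sub>k c)" using e[of "B2 - B"] z b2 by simp
      also have "\<dots> = (\<Sum>c\<in>B2 - B. (if c = z then - 1 else 0) *\<^sub>k c)"
        unfolding sum_negf[symmetric] by (rule sum.cong) (auto simp: scale_minus_left)
      finally show ?thesis .
    qed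
    ultimately have "z = 0" using key(1)[of z _ "- z"] by (metis add.right_inverse)
    then show False using z b1 dependent_zero by auto
  qed
  have un: "B1 \<union> B2 = B1 \<union> (B2 - B)" using B1 B2 by auto
  have int: "B1 \<inter> B2 = B" using disj B1 B2 by auto
  have ind: "independent (B1 \<union> B2)"
  proof (rule independent_if_scalars_zero)
    show "finite (B1 \<union> B2)" using b1 b2 by simp
    fix g x assume g: "(\<Sum>x\<in>B1 \<union> B2. g x *\<^sub>k x) = 0" and x: "x \<in> B1 \<union> B2"
    have s: "(\<Sum>x\<in>B1. g x *\<^sub>k x) + (\<Sum>x\<in>B2 - B. g x *\<^sub>k x) = 0"
      using g unfolding un by (subst (asm) sum.union_disjoint) (use b1 b2 disj in auto)
    have "(\<Sum>x\<in>B1. g x *\<^sub>k x) = 0" "(\<Sum>x\<in>B2 - B. g x *\<^sub>k x) = 0"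
      using key[OF refl refl s] by auto
    then have "x \<in> B1 \<Longrightarrow> g x = 0" "x \<in> B2 - B \<Longrightarrow> g x = 0"
      using independentD[OF b1(2) b1(1) subset_refl] independentD[OF b2(2), of "B2 - B"] b2(1) by auto
    then show "g x = 0" using x un by auto
  qed
  have sp: "span (B1 \<union> B2) = ?S" unfolding span_Un b1(3) b2(3) by simp
  have S: "finite_basis ?S (B1 \<union> B2)" using ind sp b1 b2 by (simp add: finite_basis_def)
  have fS: "f ` ?S \<subseteq> ?S"
    using fU fW by (auto simp: f.add) (blast | metis image_subset_iff)+
  have r1: "representation (B1 \<union> B2) v = representation B1 v" if "v \<in> U" for v
    by (rule representation_extend) (use ind b1 that in auto)
  have r2: "representation (B1 \<union> B2) v = representation B2 v" if "v \<in> W" for v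
    by (rule representation_extend) (use ind b2 that in auto)
  have r0: "representation (B1 \<union> B2) v = representation B v" if "v \<in> U \<inter> W" for v
    by (rule representation_extend) (use ind b that B1 in auto)
  have "trace_on ?S f + trace_on (U \<inter> W) f =
      (\<Sum>x\<in>B1 \<union> B2. representation (B1 \<union> B2) (f x) x) + (\<Sum>x\<in>B. representation B (f x) x)"
    using trace_on_basis[OF S f fS] trace_on_basis[OF B f] fU fW by auto
  also have "(\<Sum>x\<in>B. representation B (f x) x) = (\<Sum>x\<in>B1 \<inter> B2. representation (B1 \<union> B2) (f x) x)"
    unfolding int by (rule sum.cong[OF refl], subst r0) (use b(5) fU fW in blast)+
  also have "(\<Sum>x\<in>B1 \<union> B2. representation (B1 \<union> B2) (f x) x) + \<dots> =
      (\<Sum>x\<in>B1. representation (B1 \<union> B2) (f x) x) + (\<Sum>x\<in>B2. representation (B1 \<union> B2) (f x) x)"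
    by (rule sum.union_inter) (use b1 b2 in auto)
  also have "(\<Sum>x\<in>B1. representation (B1 \<union> B2) (f x) x) = trace_on U f"
    unfolding trace_on_basis[OF B1(1) f fU]
    by (rule sum.cong[OF refl], subst r1) (use b1(5) fU in blast)+
  also have "(\<Sum>x\<in>B2. representation (B1 \<union> B2) (f x) x) = trace_on W f"
    unfolding trace_on_basis[OF B2(1) f fW]
    by (rule sum.cong[OF refl], subst r2) (use b2(5) fW in blast)+
  finally show ?thesis .
qed

text \<open>
  With the identity map every identity between traces becomes one between dimensions; in
  characteristic 0 it determines them.
\<close>

lemma trace_on_id:
  assumes "finite_basis E B"
  shows "trace_on E (\<lambda>x. x) = of_nat (card B)"
proof -
  have "trace_on E (\<lambda>x. x) = (\<Sum>b\<in>B. representation B b b)"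
    by (rule trace_on_basis[OF assms]) (auto simp: linear_ident)
  also have "\<dots> = (\<Sum>b\<in>B. 1)"
    by (rule sum.cong[OF refl], subst representation_basis) (use finite_basisD[OF assms] in auto)
  finally show ?thesis by simp
qed

lemma subspace_eq_if_card_eq:
  assumes L: "finite_basis L A" and K: "finite_basis K B" and "L \<subseteq> K" and card: "card A = card B"
  shows "L = K"
proof -
  obtain C where C: "finite_basis K C" "A \<subseteq> C"
    using extend_to_finite_basis[of K K A] finite_basisD[OF L] K assms(3)
    by (auto simp: fin_dim_def dest: finite_basisD)
  have "card C = card B"
    using dim_span_eq_card_independent[of C] dim_span_eq_card_independent[of B]
      finite_basisD[OF C(1)] finite_basisD[OF K] by simp
  then have "A = C" using card C finite_basisD[OF C(1)] by (intro card_subset_eq) auto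
  then show ?thesis using finite_basisD[OF L] finite_basisD[OF C(1)] by simp
qed

end

no_notation fps_nth (infixl "$" 75)

section \<open>Algebra endomorphisms of monoid algebras\<close>

lemma Const_simps [simp]: "Const 0 = 0" "Const 1 = 1" "Const (- a) = - Const a"
  by (simp_all add: Const_def single_uminus)

lemma Const_add: "Const (a + b) = Const a + Const b"
  by (simp add: Const_def single_add)

lemma Const_diff: "Const (a - b) = Const a - Const b"
  by (simp add: Const_def single_diff)

lemma Const_mult: "Const (a * b) = Const a * Const b"
  by (simp add: Const_def mult_single)

lemma Const_sum: "Const (sum f A) = (\<Sum>x\<in>A. Const (f x))"
  by (induction A rule: infinite_finite_induct) (auto simp: Const_add)

lemma Const_numeral [simp]: "Const (numeral n) = numeral n"
  by (simp add: Const_def)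

lemma Const_mult_single [simp]: "Const c * Poly_Mapping.single m a = Poly_Mapping.single m (c * a)"
  by (simp add: Const_def mult_single)

lemma single_mult_Const [simp]: "Poly_Mapping.single m a * Const c = Poly_Mapping.single m (a * c)"
  by (simp add: Const_def mult_single)

lemma poly_mapping_single_sum:
  "p = (\<Sum>m\<in>Poly_Mapping.keys p. Poly_Mapping.single m (Poly_Mapping.lookup p m))"
  by (rule poly_mapping_eqI)
    (auto simp: lookup_sum lookup_single when_def in_keys_iff)

lemma poly_mapping_single_induct [case_names single add]:
  fixes p :: "'i \<Rightarrow>\<^sub>0 'b::comm_monoid_add"
  assumes "\<And>m c. P (Poly_Mapping.single m c)" "\<And>p q. P p \<Longrightarrow> P q \<Longrightarrow> P (p + q)"
  shows "P p"
proof -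
  have "P 0" using assms(1)[of undefined 0] by simp
  have *: "P (\<Sum>m\<in>A. Poly_Mapping.single m (Poly_Mapping.lookup p m))" if "finite A" for A
    using that by (induction A rule: finite_induct) (auto intro: assms \<open>P 0\<close>)
  from *[OF finite_keys, of p] show ?thesis using poly_mapping_single_sum[of p] by simp
qed

lemma Const_commute: "p * Const c = Const c * (p :: 'i::monoid_add \<Rightarrow>\<^sub>0 'k::field)"
  by (induction p rule: poly_mapping_single_induct) (simp_all add: algebra_simps)

lemma Const_left_commute: "p * (Const c * q) = Const c * (p * q)"
  for p :: "'i::monoid_add \<Rightarrow>\<^sub>0 'k::field"
  by (metis Const_commute mult.assoc)

lemma Const_mult_mult: "(Const a * p) * (Const b * q) = Const (a * b) * (p * q)"
  for p :: "'i::monoid_add \<Rightarrow>\<^sub>0 'k::field"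
  unfolding Const_mult by (metis Const_left_commute mult.assoc)

lemma lookup_Const_mult [simp]: "Poly_Mapping.lookup (Const c * p) m = c * Poly_Mapping.lookup p m"
  by (induction p rule: poly_mapping_single_induct)
    (simp_all add: lookup_add lookup_single when_def algebra_simps)

lemma Const_eq_iff [simp]: "Const a = Const b \<longleftrightarrow> a = b"
  unfolding Const_def by (metis lookup_single_eq)

lemma Const_inverse_cancel: "c \<noteq> 0 \<Longrightarrow> Const c * p = Const c * q \<Longrightarrow> p = q"
  for p :: "'i::monoid_add \<Rightarrow>\<^sub>0 'k::field"
  by (rule poly_mapping_eqI) (metis lookup_Const_mult mult_left_cancel)

definition alg_endo :: "(('i::monoid_add \<Rightarrow>\<^sub>0 'k::field) \<Rightarrow> ('i \<Rightarrow>\<^sub>0 'k)) \<Rightarrow> bool" where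
  "alg_endo f \<longleftrightarrow> (\<forall>p q. f (p + q) = f p + f q) \<and> (\<forall>p q. f (p * q) = f p * f q) \<and>
     (\<forall>c. f (Const c) = Const c)"

lemma alg_endoD:
  assumes "alg_endo f"
  shows "f (p + q) = f p + f q" "f (p * q) = f p * f q" "f (Const c) = Const c"
    "f 0 = 0" "f 1 = 1" "f (- p) = - f p" "f (p - q) = f p - f q" "f (sum g A) = (\<Sum>x\<in>A. f (g x))"
proof -
  show *: "f (p + q) = f p + f q" "f (p * q) = f p * f q" "f (Const c) = Const c" for p q c
    using assms by (auto simp: alg_endo_def)
  show 0: "f 0 = 0" and "f 1 = 1"
    using *(3)[of 0] *(3)[of 1] by simp_all
  show m: "f (- p) = - f p" for p using *(1)[of p "- p"] 0 by (simp add: eq_neg_iff_add_eq_0 add.commute)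
  show "f (p - q) = f p - f q" using *(1)[of p "- q"] m by simp
  show "f (sum g A) = (\<Sum>x\<in>A. f (g x))"
    by (induction A rule: infinite_finite_induct) (auto simp: 0 *)
qed

lemma alg_endo_comp: "alg_endo f \<Longrightarrow> alg_endo g \<Longrightarrow> alg_endo (\<lambda>p. f (g p))"
  by (simp add: alg_endo_def)

lemma alg_endo_id: "alg_endo (\<lambda>p. p)"
  by (simp add: alg_endo_def)

text \<open>
  A monoid algebra is used both for polynomials (exponent vectors under addition) and for
  noncommutative polynomials (words under concatenation), so one construction serves for
  substitution in either.
\<close>

definition monoid_lift :: "('i \<Rightarrow> ('i::monoid_add \<Rightarrow>\<^sub>0 'k::field)) \<Rightarrow> ('i \<Rightarrow>\<^sub>0 'k) \<Rightarrow> ('i \<Rightarrow>\<^sub>0 'k)" where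
  "monoid_lift \<mu> p = (\<Sum>m\<in>Poly_Mapping.keys p. Const (Poly_Mapping.lookup p m) * \<mu> m)"

lemma monoid_lift_superset:
  assumes "finite A" "Poly_Mapping.keys p \<subseteq> A"
  shows "monoid_lift \<mu> p = (\<Sum>m\<in>A. Const (Poly_Mapping.lookup p m) * \<mu> m)"
  unfolding monoid_lift_def
  by (rule sum.mono_neutral_left) (use assms in \<open>auto simp: in_keys_iff\<close>)

lemma monoid_lift_single: "monoid_lift \<mu> (Poly_Mapping.single m c) = Const c * \<mu> m"
  by (subst monoid_lift_superset[of "{m}"]) auto

lemma monoid_lift_add: "monoid_lift \<mu> (p + q) = monoid_lift \<mu> p + monoid_lift \<mu> q"
proof -
  let ?A = "Poly_Mapping.keys p \<union> Poly_Mapping.keys q"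
  have "Poly_Mapping.keys (p + q) \<subseteq> ?A" by (rule keys_add)
  then show ?thesis
    by (simp add: monoid_lift_superset[of ?A] lookup_add Const_add distrib_right sum.distrib)
qed

lemma alg_endo_monoid_lift:
  assumes "\<mu> 0 = 1" "\<And>m n. \<mu> (m + n) = \<mu> m * \<mu> n"
  shows "alg_endo (monoid_lift \<mu>)"
proof -
  have "monoid_lift \<mu> (p * q) = monoid_lift \<mu> p * monoid_lift \<mu> q" for p q
  proof (induction p rule: poly_mapping_single_induct)
    case (single m c)
    show ?case
    proof (induction q rule: poly_mapping_single_induct)
      case (single n d)
      then show ?case
        by (simp add: mult_single monoid_lift_single assms Const_mult_mult)
    qed (simp add: distrib_left monoid_lift_add)
  qed (simp add: distrib_right monoid_lift_add)
  then show ?thesis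
    by (simp add: alg_endo_def monoid_lift_add) (simp add: Const_def monoid_lift_single assms)
qed

lemma alg_endo_eqI:
  assumes f: "alg_endo f" and g: "alg_endo g"
    and gen: "\<And>m. f (Poly_Mapping.single m 1) = g (Poly_Mapping.single m 1)"
  shows "f = g"
proof
  fix p show "f p = g p"
  proof (induction p rule: poly_mapping_single_induct)
    case (single m c)
    have "Poly_Mapping.single m c = Const c * Poly_Mapping.single m 1" by simp
    then show ?case using gen[of m] alg_endoD(2,3)[OF f] alg_endoD(2,3)[OF g] by metis
  qed (simp add: alg_endoD[OF f] alg_endoD[OF g])
qed

text \<open>
  The row \<open>i\<close> of a matrix lists the coefficients of the image of the generator \<open>i\<close>; therefore the
  substitution applied last contributes the right factor of the product.
\<close>

lemma alg_endo_linear_forms: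
  assumes f: "alg_endo f" and fz: "\<And>i. f (z i) = (\<Sum>j\<in>UNIV. Const (N $ i $ j) * z j)"
  shows "f (\<Sum>j\<in>UNIV. Const (M $ i $ j) * z j) = (\<Sum>k\<in>UNIV. Const ((M ** N) $ i $ k) * z k)"
proof -
  have "f (\<Sum>j\<in>UNIV. Const (M $ i $ j) * z j) =
      (\<Sum>j\<in>UNIV. \<Sum>k\<in>UNIV. Const (M $ i $ j * N $ j $ k) * z k)"
    unfolding alg_endoD(8)[OF f] alg_endoD(2)[OF f] alg_endoD(3)[OF f] fz
    by (simp only: sum_distrib_left Const_mult mult.assoc)
  also have "\<dots> = (\<Sum>k\<in>UNIV. \<Sum>j\<in>UNIV. Const (M $ i $ j * N $ j $ k) * z k)"
    by (rule sum.swap)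
  finally show ?thesis
    by (simp add: matrix_matrix_mult_def Const_sum sum_distrib_right)
qed

lemma vector_space_Const: "vector_space (\<lambda>c (p :: 'i::monoid_add \<Rightarrow>\<^sub>0 'k::field). Const c * p)"
  by standard (simp_all add: algebra_simps Const_add Const_mult)

interpretation fa: finite_dim_traces "\<lambda>(c::'k::field) (p::'k free3). Const c * p"
  by (simp add: finite_dim_traces_def vector_space_Const)

lemma linear_alg_endo:
  fixes f :: "'k::field free3 \<Rightarrow> 'k free3"
  assumes "alg_endo f"
  shows "Vector_Spaces.linear (\<lambda>c p. Const c * p) (\<lambda>c p. Const c * p) f"
  unfolding Vector_Spaces.linear_iff by (simp add: vector_space_Const alg_endoD[OF assms])

section \<open>The free algebra as a graded vector space\<close>

lemma letters_zero [simp]: "letters 0 = []"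
  by (simp add: zero_word_def)

lemma letters_plus [simp]: "letters (v + w) = letters v @ letters w"
  by (simp add: plus_word_def)

definition free_subst :: "(3 \<Rightarrow> 'k::field free3) \<Rightarrow> 'k free3 \<Rightarrow> 'k free3" where
  "free_subst g = monoid_lift (\<lambda>w. prod_list (map g (letters w)))"

lemma alg_endo_free_subst: "alg_endo (free_subst g)"
  unfolding free_subst_def by (rule alg_endo_monoid_lift) simp_all

lemma free_subst_Y [simp]: "free_subst g (Y i) = g i"
  by (simp add: free_subst_def Y_def monoid_lift_single)

lemma single_Cons: "Poly_Mapping.single (Word (i # v)) c = Y i * Poly_Mapping.single (Word v) c"
  by (simp add: Y_def mult_single plus_word_def)

lemma single_snoc: "Poly_Mapping.single (Word (v @ [i])) c = Poly_Mapping.single (Word v) c * Y i"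
  by (simp add: Y_def mult_single plus_word_def)

lemma single_Nil: "Poly_Mapping.single (Word []) c = Const c"
  by (simp add: Const_def zero_word_def)

lemma free_alg_endo_eqI:
  fixes f g :: "'k::field free3 \<Rightarrow> 'k free3"
  assumes f: "alg_endo f" and g: "alg_endo g" and gen: "\<And>i. f (Y i) = g (Y i)"
  shows "f = g"
proof (rule alg_endo_eqI[OF f g])
  fix w :: "3 word"
  show "f (Poly_Mapping.single w 1) = g (Poly_Mapping.single w 1)"
  proof (cases w)
    case (Word v)
    have "f (Poly_Mapping.single (Word v) 1) = g (Poly_Mapping.single (Word v) 1)"
      by (induction v)
        (simp_all add: single_Cons single_Nil alg_endoD[OF f] alg_endoD[OF g] gen)
    then show ?thesis using Word by simp
  qed
qed

definition free_comp :: "nat \<Rightarrow> 'k::field free3 set" where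
  "free_comp n = {p. \<forall>w\<in>Poly_Mapping.keys p. length (letters w) = n}"

lemma free_compD: "p \<in> free_comp n \<Longrightarrow> length (letters w) \<noteq> n \<Longrightarrow> Poly_Mapping.lookup p w = 0"
  by (auto simp: free_comp_def in_keys_iff)

lemma free_compI: "(\<And>w. length (letters w) \<noteq> n \<Longrightarrow> Poly_Mapping.lookup p w = 0) \<Longrightarrow> p \<in> free_comp n"
  by (auto simp: free_comp_def in_keys_iff)

lemma subspace_free_comp: "fa.subspace (free_comp n)"
  by (rule fa.subspaceI) (auto intro!: free_compI simp: lookup_add free_compD)

lemma single_in_free_comp: "length (letters w) = n \<Longrightarrow> Poly_Mapping.single w c \<in> free_comp n"
  by (auto simp: free_comp_def split: if_splits)

definition free_part :: "nat \<Rightarrow> 'k::field free3 \<Rightarrow> 'k free3" where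
  "free_part n p = (\<Sum>w\<in>{w\<in>Poly_Mapping.keys p. length (letters w) = n}.
     Poly_Mapping.single w (Poly_Mapping.lookup p w))"

lemma lookup_free_part:
  "Poly_Mapping.lookup (free_part n p) w = (if length (letters w) = n then Poly_Mapping.lookup p w else 0)"
  by (auto simp: free_part_def lookup_sum lookup_single when_def in_keys_iff sum.delta)

lemma free_part_simps [simp]:
  "free_part n 0 = 0"
  "free_part n (p + q) = free_part n p + free_part n q"
  "free_part n (- p) = - free_part n p"
  "free_part n (p - q) = free_part n p - free_part n q"
  "free_part n (Const c * p) = Const c * free_part n p"
  by (auto intro!: poly_mapping_eqI simp: lookup_free_part lookup_add lookup_minus)

lemma free_part_in [simp]: "free_part n p \<in> free_comp n"
  by (rule free_compI) (simp add: lookup_free_part)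

lemma free_part_free_comp: "p \<in> free_comp m \<Longrightarrow> free_part n p = (if m = n then p else 0)"
  by (auto intro!: poly_mapping_eqI simp: lookup_free_part free_compD)

lemma sum_free_parts:
  "\<exists>N. p = (\<Sum>n<N. free_part n p)"
proof -
  let ?N = "Suc (Max (insert 0 ((\<lambda>w. length (letters w)) ` Poly_Mapping.keys p)))"
  define N where "N = ?N"
  have "length (letters w) < N" if "Poly_Mapping.lookup p w \<noteq> 0" for w
    using that by (auto simp: N_def less_Suc_eq_le in_keys_iff intro!: Max_ge)
  then have "p = (\<Sum>n<N. free_part n p)"
    by (intro poly_mapping_eqI) (auto simp: lookup_sum lookup_free_part)
  then show ?thesis ..
qed

lemma mult_in_free_comp:
  assumes "p \<in> free_comp m" "q \<in> free_comp n"
  shows "p * q \<in> free_comp (m + n)"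
  unfolding free_comp_def
proof (intro CollectI ballI)
  fix w assume "w \<in> Poly_Mapping.keys (p * q)"
  then obtain u v where "w = u + v" "u \<in> Poly_Mapping.keys p" "v \<in> Poly_Mapping.keys q"
    using keys_mult[of p q] by blast
  then show "length (letters w) = m + n" using assms by (auto simp: free_comp_def)
qed

lemma Y_in [simp]: "Y i \<in> free_comp 1"
  by (simp add: Y_def single_in_free_comp)

lemma Const_in [simp]: "Const c \<in> free_comp 0"
  by (simp add: Const_def single_in_free_comp)

lemma free_comp_0: "free_comp 0 = range (Const :: 'k::field \<Rightarrow> 'k free3)"
proof -
  have "p = Const (Poly_Mapping.lookup p 0)" if "p \<in> free_comp 0" for p :: "'k free3"
  proof (rule poly_mapping_eqI)
    fix w :: "3 word"
    show "Poly_Mapping.lookup p w = Poly_Mapping.lookup (Const (Poly_Mapping.lookup p 0)) w"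
      using free_compD[OF that, of w] word.collapse[of w]
      by (cases "letters w = []") (auto simp: Const_def lookup_single zero_word_def when_def)
  qed
  then show ?thesis by auto
qed

lemma free_part_Y_mult:
  "free_part 0 (Y i * p) = 0" "free_part (Suc n) (Y i * p) = Y i * free_part n p"
proof -
  have "free_part 0 (Y i * p) = 0 \<and> free_part (Suc n) (Y i * p) = Y i * free_part n p"
  proof (induction p rule: poly_mapping_single_induct)
    case (single w c)
    have "Poly_Mapping.single w c \<in> free_comp (length (letters w))"
      by (simp add: single_in_free_comp)
    with mult_in_free_comp[OF Y_in this, of i]
    show ?case by (auto simp: free_part_free_comp[of _ "length (letters w)"] free_part_free_comp[of _ "Suc (length (letters w))"])
  qed (simp add: distrib_left)
  then show "free_part 0 (Y i * p) = 0" "free_part (Suc n) (Y i * p) = Y i * free_part n p" by auto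
qed

lemma free_part_mult_Y:
  "free_part 0 (p * Y i) = 0" "free_part (Suc n) (p * Y i) = free_part n p * Y i"
proof -
  have "free_part 0 (p * Y i) = 0 \<and> free_part (Suc n) (p * Y i) = free_part n p * Y i"
  proof (induction p rule: poly_mapping_single_induct)
    case (single w c)
    have "Poly_Mapping.single w c \<in> free_comp (length (letters w))"
      by (simp add: single_in_free_comp)
    with mult_in_free_comp[OF this Y_in, of i]
    show ?case by (auto simp: free_part_free_comp[of _ "length (letters w)"] free_part_free_comp[of _ "Suc (length (letters w))"])
  qed (simp add: distrib_right)
  then show "free_part 0 (p * Y i) = 0" "free_part (Suc n) (p * Y i) = free_part n p * Y i" by auto
qed

text \<open>
  The free algebra \<open>F\<close> is a domain over which the letters, the relations and the superpotential
  below each generate free left modules. For left independent \<open>z\<close> with span \<open>Z\<close>, the space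
  \<open>right_span U z\<close> is \<open>U Z\<close> and is isomorphic to \<open>U \<otimes> Z\<close>.
\<close>

definition left_independent :: "('i::finite \<Rightarrow> 'k::field free3) \<Rightarrow> bool" where
  "left_independent z \<longleftrightarrow> (\<forall>u. (\<Sum>i\<in>UNIV. u i * z i) = 0 \<longrightarrow> (\<forall>i. u i = 0))"

definition right_span :: "'k::field free3 set \<Rightarrow> ('i::finite \<Rightarrow> 'k free3) \<Rightarrow> 'k free3 set" where
  "right_span U z = {\<Sum>i\<in>UNIV. u i * z i | u. \<forall>i. u i \<in> U}"

lemma left_independentD: "left_independent z \<Longrightarrow> (\<Sum>i\<in>UNIV. u i * z i) = 0 \<Longrightarrow> u i = 0"
  by (simp add: left_independent_def)

lemma left_independent_eq:
  assumes "left_independent z" "(\<Sum>i\<in>UNIV. u i * z i) = (\<Sum>i\<in>UNIV. v i * z i)"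
  shows "u = v"
proof -
  have "(\<Sum>i\<in>UNIV. (u i - v i) * z i) = 0" using assms(2) by (simp add: left_diff_distrib sum_subtractf)
  then have "\<forall>i. u i - v i = 0" using left_independentD[OF assms(1), of "\<lambda>i. u i - v i"] by simp
  then show ?thesis by auto
qed

lemma right_spanI: "(\<And>i. u i \<in> U) \<Longrightarrow> (\<Sum>i\<in>UNIV. u i * z i) \<in> right_span U z"
  by (auto simp: right_span_def)

lemma right_spanE:
  assumes "x \<in> right_span U z"
  obtains u where "\<And>i. u i \<in> U" "x = (\<Sum>i\<in>UNIV. u i * z i)"
  using assms by (auto simp: right_span_def)

lemma right_span_mono: "U \<subseteq> U' \<Longrightarrow> right_span U z \<subseteq> right_span U' z"
  by (auto simp: right_span_def)

lemma subspace_right_span: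
  assumes "fa.subspace U"
  shows "fa.subspace (right_span U z)"
proof (rule fa.subspaceI)
  show "0 \<in> right_span U z" using right_spanI[of "\<lambda>_. 0" U z] fa.subspace_0[OF assms] by simp
next
  fix x y assume x: "x \<in> right_span U z" and y: "y \<in> right_span U z"
  obtain u where "\<And>i. u i \<in> U" "x = (\<Sum>i\<in>UNIV. u i * z i)" using right_spanE[OF x] by blast
  moreover obtain v where "\<And>i. v i \<in> U" "y = (\<Sum>i\<in>UNIV. v i * z i)" using right_spanE[OF y] by blast
  ultimately show "x + y \<in> right_span U z"
    using right_spanI[of "\<lambda>i. u i + v i" U z] fa.subspace_add[OF assms]
    by (simp add: distrib_right sum.distrib)
next
  fix c x assume x: "x \<in> right_span U z"
  obtain u where "\<And>i. u i \<in> U" "x = (\<Sum>i\<in>UNIV. u i * z i)" using right_spanE[OF x] by blast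
  then show "Const c * x \<in> right_span U z"
    using right_spanI[of "\<lambda>i. Const c * u i" U z] fa.subspace_scale[OF assms]
    by (simp add: sum_distrib_left mult.assoc)
qed

lemma right_span_zero: "right_span {0} z = {0}"
  by (auto simp: right_span_def intro!: exI[of _ "\<lambda>_. 0"])

lemma mult_in_right_span:
  assumes "fa.subspace U" "p \<in> U"
  shows "p * z i \<in> right_span U z"
proof -
  have "(\<Sum>j\<in>UNIV. (if j = i then p else 0) * z j) \<in> right_span U z"
    by (rule right_spanI) (use assms in \<open>auto intro: fa.subspace_0\<close>)
  moreover have "(\<Sum>j\<in>UNIV. (if j = i then p else 0) * z j) = p * z i"
    by (simp add: if_distrib if_distribR cong: if_cong)
  ultimately show ?thesis by simp
qed

lemma image_right_span:
  assumes f: "alg_endo f" and U: "fa.subspace U" "f ` U \<subseteq> U"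
    and fz: "\<And>i. f (z i) = (\<Sum>j\<in>UNIV. Const (C i j) * z j)"
  shows "f ` right_span U z \<subseteq> right_span U z"
proof
  fix y assume "y \<in> f ` right_span U z"
  then obtain u where u: "\<And>i. u i \<in> U" "y = f (\<Sum>i\<in>UNIV. u i * z i)"
    by (auto elim: right_spanE)
  have fu: "f (u i) \<in> U" for i using u U by auto
  have "y = (\<Sum>i\<in>UNIV. \<Sum>j\<in>UNIV. Const (C i j) * (f (u i) * z j))"
    by (simp add: u alg_endoD[OF f] fz sum_distrib_left Const_left_commute)
  also have "\<dots> \<in> right_span U z"
    by (intro fa.subspace_sum fa.subspace_scale subspace_right_span mult_in_right_span U fu)
  finally show "y \<in> right_span U z" .
qed

lemma finite_basis_right_span:
  fixes z :: "'i::finite \<Rightarrow> 'k::field free3"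
  assumes z: "left_independent z" and B: "fa.finite_basis U B"
  defines "v \<equiv> \<lambda>(b, i). b * z i"
  shows "inj_on v (B \<times> UNIV)" "fa.finite_basis (right_span U z) (v ` (B \<times> UNIV))"
proof -
  note b = fa.finite_basisD[OF B]
  have swap: "(\<Sum>x\<in>B \<times> UNIV. Const (a x) * v x) = (\<Sum>i\<in>UNIV. (\<Sum>c\<in>B. Const (a (c, i)) * c) * z i)" for a
    unfolding sum.cartesian_product'[of _ B UNIV] v_def
    by (subst sum.swap) (simp add: sum_distrib_right mult.assoc)
  have ind: "\<forall>x\<in>B \<times> UNIV. a x = 0" if "(\<Sum>x\<in>B \<times> UNIV. Const (a x) * v x) = 0" for a
  proof -
    have "(\<Sum>c\<in>B. Const (a (c, i)) * c) = 0" for i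
      using z that unfolding swap left_independent_def by auto
    then have "a (c, i) = 0" if "c \<in> B" for c i
      using fa.independentD[OF b(2) b(1) subset_refl _ that, of "\<lambda>c. a (c, i)"] by simp
    then show ?thesis by auto
  qed
  have sp: "\<exists>a. x = (\<Sum>x\<in>B \<times> UNIV. Const (a x) * v x)" if x: "x \<in> right_span U z" for x
  proof -
    obtain u where u: "\<And>i. u i \<in> U" "x = (\<Sum>i\<in>UNIV. u i * z i)" using right_spanE[OF x] by blast
    have "u i = (\<Sum>c\<in>B. Const (fa.representation B (u i) c) * c)" for i
      using fa.sum_representation_eq[of B "u i" B] b u by simp
    then have "x = (\<Sum>i\<in>UNIV. (\<Sum>c\<in>B. Const (fa.representation B (u i) c) * c) * z i)"
      using u by simp
    also have "\<dots> = (\<Sum>x\<in>B \<times> UNIV. Const ((\<lambda>(c, i). fa.representation B (u i) c) x) * v x)"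
      unfolding swap by simp
    finally show ?thesis by blast
  qed
  show "inj_on v (B \<times> UNIV)" "fa.finite_basis (right_span U z) (v ` (B \<times> UNIV))"
    by (rule fa.finite_basis_family[of "B \<times> UNIV" v "right_span U z"];
        use b ind sp in \<open>auto intro!: subspace_right_span mult_in_right_span simp: v_def\<close>)+
qed

lemma fin_dim_right_span:
  assumes "left_independent z" "fa.fin_dim U"
  shows "fa.fin_dim (right_span U z)"
  using assms finite_basis_right_span(2)[of z U] by (auto simp: fa.fin_dim_def)

text \<open>
  On \<open>U Z \<cong> U \<otimes> Z\<close> an algebra endomorphism acts as a tensor product of its restrictions, and traces
  are multiplicative.
\<close>

lemma trace_right_span:
  fixes z :: "'i::finite \<Rightarrow> 'k::field free3"
  assumes z: "left_independent z" and U: "fa.fin_dim U" and f: "alg_endo f" and fU: "f ` U \<subseteq> U"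
    and fz: "\<And>i. f (z i) = (\<Sum>j\<in>UNIV. Const (C i j) * z j)"
  shows "fa.trace_on (right_span U z) f = fa.trace_on U f * (\<Sum>i\<in>UNIV. C i i)"
proof -
  obtain B where B: "fa.finite_basis U B" using U by (auto simp: fa.fin_dim_def)
  note b = fa.finite_basisD[OF B] and v = finite_basis_right_span[OF z B]
  let ?r = "fa.representation B"
  have expand: "(\<Sum>c\<in>B. Const (?r p c) * c) = p" if "p \<in> U" for p
    using fa.sum_representation_eq[of B p B] b that by simp
  have "fa.trace_on (right_span U z) f =
      (\<Sum>x\<in>B \<times> UNIV. ?r (f (fst x)) (fst x) * C (snd x) (snd x))"
  proof (rule fa.trace_on_family[OF _ v linear_alg_endo[OF f],
        where C = "\<lambda>x y. ?r (f (fst x)) (fst y) * C (snd x) (snd y)"])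
    show "finite (B \<times> (UNIV :: 'i set))" using b by simp
    fix x :: "'k free3 \<times> 'i" assume x: "x \<in> B \<times> UNIV"
    obtain c i where ci: "x = (c, i)" by (cases x)
    have fc: "f c \<in> U" using x ci b(5) fU by auto
    have "f (c * z i) = (\<Sum>d\<in>B. Const (?r (f c) d) * d) * (\<Sum>j\<in>UNIV. Const (C i j) * z j)"
      by (simp add: alg_endoD[OF f] fz expand fc)
    also have "\<dots> = (\<Sum>d\<in>B. \<Sum>j\<in>UNIV. Const (?r (f c) d * C i j) * (d * z j))"
      by (simp add: sum_product Const_mult_mult)
    also have "\<dots> = (\<Sum>y\<in>B \<times> UNIV. Const (?r (f c) (fst y) * C i (snd y)) * (fst y * z (snd y)))"
      by (simp add: sum.cartesian_product')
    finally show "f (case x of (c, i) \<Rightarrow> c * z i) = (\<Sum>y\<in>B \<times> UNIV.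
        Const (?r (f (fst x)) (fst y) * C (snd x) (snd y)) * (case y of (c, i) \<Rightarrow> c * z i))"
      by (simp add: ci case_prod_beta)
  qed
  also have "\<dots> = (\<Sum>c\<in>B. ?r (f c) c) * (\<Sum>i\<in>UNIV. C i i)"
    by (simp add: sum.cartesian_product' sum_product)
  also have "(\<Sum>c\<in>B. ?r (f c) c) = fa.trace_on U f"
    by (rule fa.trace_on_basis[OF B linear_alg_endo[OF f] fU, symmetric])
  finally show ?thesis .
qed

lemma lookup_mult_Y:
  "Poly_Mapping.lookup (p * Y i) (Word (v @ [j])) = (if i = j then Poly_Mapping.lookup p (Word v) else 0)"
proof (induction p rule: poly_mapping_single_induct)
  case (single w c)
  show ?case by (cases w) (auto simp: Y_def mult_single plus_word_def lookup_single when_def)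
qed (simp add: distrib_right lookup_add)

text \<open>
  The words occurring in \<open>p * Y i\<close> end with \<open>i\<close>, so that the three summands cannot cancel.
\<close>

lemma left_independent_Y: "left_independent (Y :: 3 \<Rightarrow> 'k::field free3)"
  unfolding left_independent_def
proof (intro allI impI poly_mapping_eqI)
  fix u :: "3 \<Rightarrow> 'k free3" and j w
  assume 0: "(\<Sum>i\<in>UNIV. u i * Y i) = 0"
  have "Poly_Mapping.lookup (\<Sum>i\<in>UNIV. u i * Y i) (Word (letters w @ [j])) = Poly_Mapping.lookup (u j) w"
    by (simp add: lookup_sum lookup_mult_Y)
  then show "Poly_Mapping.lookup (u j) w = Poly_Mapping.lookup 0 w" unfolding 0 by simp
qed

lemma free_comp_Suc: "free_comp (Suc n) = right_span (free_comp n) Y"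
proof
  show "free_comp (Suc n) \<subseteq> right_span (free_comp n) (Y :: 3 \<Rightarrow> 'k::field free3)"
  proof
    fix p :: "'k free3" assume p: "p \<in> free_comp (Suc n)"
    have "Poly_Mapping.single w (Poly_Mapping.lookup p w) \<in> right_span (free_comp n) Y"
      if "w \<in> Poly_Mapping.keys p" for w
    proof -
      have l: "length (letters w) = Suc n" using p that by (auto simp: free_comp_def)
      then obtain v j where vj: "letters w = v @ [j]" by (metis length_Suc_conv_rev)
      then have "w = Word (v @ [j])" using word.collapse[of w] by simp
      then show ?thesis using l vj
        by (auto simp: single_snoc intro!: mult_in_right_span subspace_free_comp single_in_free_comp)
    qed
    then show "p \<in> right_span (free_comp n) Y"
      by (subst poly_mapping_single_sum)
        (intro fa.subspace_sum subspace_right_span subspace_free_comp)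
  qed
  show "right_span (free_comp n) (Y :: 3 \<Rightarrow> 'k::field free3) \<subseteq> free_comp (Suc n)"
    using mult_in_free_comp[OF _ Y_in, of _ n]
    by (auto elim!: right_spanE intro!: fa.subspace_sum subspace_free_comp)
qed

lemma finite_basis_free_comp_0: "fa.finite_basis (free_comp 0) {1 :: 'k::field free3}"
  by (auto simp: fa.finite_basis_def fa.span_singleton free_comp_0)

lemma fin_dim_free_comp: "fa.fin_dim (free_comp n :: 'k::field free3 set)"
proof (induction n)
  case 0
  then show ?case using finite_basis_free_comp_0 by (auto simp: fa.fin_dim_def)
qed (simp add: free_comp_Suc fin_dim_right_span left_independent_Y)

definition free_matrix_subst :: "'k::field^3^3 \<Rightarrow> 'k free3 \<Rightarrow> 'k free3" where
  "free_matrix_subst M = free_subst (\<lambda>i. \<Sum>j\<in>UNIV. Const (M $ i $ j) * Y j)"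

lemma alg_endo_free_matrix_subst: "alg_endo (free_matrix_subst M)"
  by (simp add: free_matrix_subst_def alg_endo_free_subst)

lemma free_matrix_subst_Y: "free_matrix_subst M (Y i) = (\<Sum>j\<in>UNIV. Const (M $ i $ j) * Y j)"
  by (simp add: free_matrix_subst_def)

lemma free_matrix_subst_mult: "free_matrix_subst N (free_matrix_subst M p) = free_matrix_subst (M ** N) p"
proof -
  have "(\<lambda>p. free_matrix_subst N (free_matrix_subst M p)) = free_matrix_subst (M ** N)"
  proof (rule free_alg_endo_eqI)
    show "free_matrix_subst N (free_matrix_subst M (Y i)) = free_matrix_subst (M ** N) (Y i)" for i
      unfolding free_matrix_subst_Y[of M] free_matrix_subst_Y[of "M ** N"]
      by (rule alg_endo_linear_forms[OF alg_endo_free_matrix_subst free_matrix_subst_Y])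
  qed (rule alg_endo_comp[OF alg_endo_free_matrix_subst alg_endo_free_matrix_subst],
      rule alg_endo_free_matrix_subst)
  then show ?thesis by metis
qed

lemma free_matrix_subst_1: "free_matrix_subst (mat 1) p = p"
proof -
  have "free_matrix_subst (mat 1) = (\<lambda>p. p)"
    by (rule free_alg_endo_eqI)
      (simp_all add: alg_endo_free_matrix_subst alg_endo_id free_matrix_subst_Y mat_def
        if_distrib if_distribR sum.delta cong: if_cong)
  then show ?thesis by metis
qed

lemma image_free_comp: "free_matrix_subst M ` free_comp n \<subseteq> free_comp n"
proof (induction n)
  case 0
  then show ?case by (auto simp: free_comp_0 alg_endoD[OF alg_endo_free_matrix_subst])
next
  case (Suc n)
  then show ?case unfolding free_comp_Suc
    by (rule image_right_span[OF alg_endo_free_matrix_subst subspace_free_comp _ free_matrix_subst_Y])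
qed

section \<open>Matrices of size three and quadratic forms\<close>

lemma three_plus [simp]:
  "(1::3) + 1 = 2" "(2::3) + 1 = 3" "(3::3) + 1 = 1" "(1::3) + 2 = 3" "(2::3) + 2 = 1" "(3::3) + 2 = 2"
  "(4::3) = 1" "(5::3) = 2"
  by simp_all

text \<open>
  Indices are elements of the ring \<open>3\<close>, in which \<open>i + 1\<close> and \<open>i + 2\<close> are the two other indices in
  cyclic order. Cofactors, cross products and the Poisson bracket need no signs in this form.
\<close>

definition cofactor :: "'k::comm_ring_1^3^3 \<Rightarrow> 3 \<Rightarrow> 3 \<Rightarrow> 'k" where
  "cofactor M i j = M $ (i + 1) $ (j + 1) * M $ (i + 2) $ (j + 2) -
     M $ (i + 1) $ (j + 2) * M $ (i + 2) $ (j + 1)"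

lemma cofactor_expand_columns:
  "(\<Sum>i\<in>UNIV. M $ i $ a * cofactor M i b) = (if a = b then det M else 0)"
  using exhaust_3[of a] exhaust_3[of b]
  by (auto simp: cofactor_def sum_3 det_3 algebra_simps)

lemma cofactor_expand_rows:
  "(\<Sum>a\<in>UNIV. cofactor M i a * M $ j $ a) = (if i = j then det M else 0)"
  using exhaust_3[of i] exhaust_3[of j]
  by (auto simp: cofactor_def sum_3 det_3 algebra_simps)

lemma cofactor_1: "cofactor (mat 1 :: 'k::comm_ring_1^3^3) i j = (if i = j then 1 else 0)"
  using exhaust_3[of i] exhaust_3[of j]
  by (auto simp: cofactor_def mat_def)

definition quad_form :: "(3 \<Rightarrow> ('i::monoid_add \<Rightarrow>\<^sub>0 'k::field)) \<Rightarrow> (3 \<Rightarrow> 3 \<Rightarrow> 'k) \<Rightarrow> ('i \<Rightarrow>\<^sub>0 'k)" where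
  "quad_form z B = (\<Sum>a\<in>UNIV. \<Sum>b\<in>UNIV. Const (B a b) * (z a * z b))"

lemma quad_form_eq_right: "quad_form z B = (\<Sum>b\<in>UNIV. (\<Sum>a\<in>UNIV. Const (B a b) * z a) * z b)"
  unfolding quad_form_def by (subst sum.swap) (simp add: sum_distrib_right mult.assoc)

text \<open>
  In the free algebra a quadratic form determines all its coefficients, since the words of length
  two are independent; in commuting variables it only determines their symmetrization.
\<close>

lemma quad_form_Y_inj: "quad_form Y B = quad_form Y B' \<Longrightarrow> B = B'"
proof (intro ext)
  fix a b assume "quad_form Y B = quad_form Y B'"
  from left_independent_eq[OF left_independent_Y this[unfolded quad_form_eq_right]]
  have eq: "(\<Sum>a\<in>UNIV. Const (B a b) * Y a) = (\<Sum>a\<in>UNIV. Const (B' a b) * Y a)"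
    by (rule fun_cong)
  from fun_cong[OF left_independent_eq[OF left_independent_Y eq], of a]
  show "B a b = B' a b" by simp
qed

lemma quad_form_Y_eq_iff: "quad_form Y B = quad_form Y B' \<longleftrightarrow> B = B'"
  using quad_form_Y_inj by blast

lemma quad_form_sum: "(\<Sum>j\<in>UNIV. Const (c j) * quad_form z (B j)) = quad_form z (\<lambda>a b. \<Sum>j\<in>UNIV. c j * B j a b)"
proof -
  have "(\<Sum>j\<in>UNIV. Const (c j) * quad_form z (B j)) =
      (\<Sum>j\<in>UNIV. \<Sum>a\<in>UNIV. \<Sum>b\<in>UNIV. Const (c j * B j a b) * (z a * z b))"
    by (simp only: quad_form_def sum_distrib_left Const_mult mult.assoc)
  also have "\<dots> = (\<Sum>a\<in>UNIV. \<Sum>b\<in>UNIV. \<Sum>j\<in>UNIV. Const (c j * B j a b) * (z a * z b))"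
    by (subst sum.swap, rule sum.cong[OF refl], rule sum.swap)
  also have "\<dots> = quad_form z (\<lambda>a b. \<Sum>j\<in>UNIV. c j * B j a b)"
    unfolding quad_form_def Const_sum sum_distrib_right ..
  finally show ?thesis .
qed

lemma alg_endo_quad_form:
  assumes f: "alg_endo f" and fz: "\<And>i. f (z i) = (\<Sum>j\<in>UNIV. Const (M $ i $ j) * z j)"
  shows "f (quad_form z B) = quad_form z (\<lambda>a b. \<Sum>k\<in>UNIV. \<Sum>l\<in>UNIV. B k l * M $ k $ a * M $ l $ b)"
proof -
  have "f (quad_form z B) =
      (\<Sum>k\<in>UNIV. \<Sum>l\<in>UNIV. Const (B k l) * ((\<Sum>a\<in>UNIV. Const (M $ k $ a) * z a) * (\<Sum>b\<in>UNIV. Const (M $ l $ b) * z b)))"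
    unfolding quad_form_def by (simp add: alg_endoD(2,3,8)[OF f] fz)
  also have "\<dots> = (\<Sum>k\<in>UNIV. \<Sum>l\<in>UNIV. \<Sum>a\<in>UNIV. \<Sum>b\<in>UNIV. Const (B k l * M $ k $ a * M $ l $ b) * (z a * z b))"
    unfolding sum_product Const_mult_mult by (simp only: sum_distrib_left Const_mult mult.assoc)
  also have "\<dots> = (\<Sum>k\<in>UNIV. \<Sum>a\<in>UNIV. \<Sum>b\<in>UNIV. \<Sum>l\<in>UNIV. Const (B k l * M $ k $ a * M $ l $ b) * (z a * z b))"
    by (rule sum.cong[OF refl], subst sum.swap, rule sum.cong[OF refl], rule sum.swap)
  also have "\<dots> = (\<Sum>a\<in>UNIV. \<Sum>b\<in>UNIV. \<Sum>k\<in>UNIV. \<Sum>l\<in>UNIV. Const (B k l * M $ k $ a * M $ l $ b) * (z a * z b))"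
    by (subst sum.swap, rule sum.cong[OF refl], rule sum.swap)
  also have "\<dots> = quad_form z (\<lambda>a b. \<Sum>k\<in>UNIV. \<Sum>l\<in>UNIV. B k l * M $ k $ a * M $ l $ b)"
    unfolding quad_form_def Const_sum sum_distrib_right ..
  finally show ?thesis .
qed

lemmas free_matrix_subst_quad_form =
  alg_endo_quad_form[OF alg_endo_free_matrix_subst free_matrix_subst_Y]

text \<open>
  The Levi-Civita symbol: \<open>quad_form z (skew i)\<close> is the commutator of \<open>z (i + 1)\<close> and \<open>z (i + 2)\<close>.
\<close>

definition skew :: "3 \<Rightarrow> 3 \<Rightarrow> 3 \<Rightarrow> 'k::field" where
  "skew i a b = (if a = i + 1 \<and> b = i + 2 then 1 else 0) - (if a = i + 2 \<and> b = i + 1 then 1 else 0)"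

lemma skew_antisym: "skew i b a = - skew i a b"
  by (simp add: skew_def)

text \<open>
  Skew forms span the second exterior power, on which \<open>M\<close> acts through its cofactors.
\<close>

lemma skew_transform:
  "(\<Sum>k\<in>UNIV. \<Sum>l\<in>UNIV. skew i k l * M $ k $ a * M $ l $ b) =
     (\<Sum>j\<in>UNIV. cofactor M i j * skew j a b)"
  using exhaust_3[of i] exhaust_3[of a] exhaust_3[of b]
  by (auto simp: cofactor_def skew_def sum_3 algebra_simps)

lemma sum_skew: "(\<Sum>j\<in>UNIV. c j * skew j (i + 1) (i + 2)) = c i"
  using exhaust_3[of i] by (auto simp: skew_def sum_3)

text \<open>
  The trace of \<open>M\<close> on the second exterior power, that is, the second elementary symmetric function
  of its eigenvalues.
\<close>

definition second_trace :: "'k::comm_ring_1^3^3 \<Rightarrow> 'k" where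
  "second_trace M = (\<Sum>i\<in>UNIV. cofactor M i i)"

primrec mat_power :: "'k::comm_ring_1^3^3 \<Rightarrow> nat \<Rightarrow> 'k^3^3" where
  "mat_power M 0 = mat 1"
| "mat_power M (Suc n) = mat_power M n ** M"

lemma mat_power_commute: "M ** mat_power M n = mat_power M n ** M"
  by (induction n) (simp_all add: matrix_mul_assoc)

lemma mat_power_eq_1_inverse:
  assumes "m > 0" "mat_power M m = mat 1"
  obtains N where "N ** M = mat 1" "M ** N = mat 1"
  using assms mat_power_commute[of M "m - 1"] by (intro that[of "mat_power M (m - 1)"]; cases m; simp)

lemma det_mat_power: "det (mat_power M n) = det M ^ n"
  by (induction n) (simp_all add: det_mul det_I)

section \<open>Relations and superpotential of a quantized cubic\<close>

locale symmetric_tensor =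
  fixes T :: "3 \<Rightarrow> 3 \<Rightarrow> 3 \<Rightarrow> 'k::field_char_0"
  assumes T_sym: "T i j k = T j i k" "T i j k = T i k j"
begin

text \<open>
  With \<open>\<Omega> = 1/6 \<Sum> T i j k x\<^sub>i x\<^sub>j x\<^sub>k\<close>, these are the coefficients of the equations
  \<open>(\<partial>\<^sub>i \<Omega>) \<circ> M = \<Sum>\<^sub>j cofactor M i j \<partial>\<^sub>j \<Omega>\<close>. The left side is the image under \<open>M\<close> of the
  bracket \<open>{x\<^sub>i\<^sub>+\<^sub>1, x\<^sub>i\<^sub>+\<^sub>2}\<close>, and the right side is the bracket of the images of these generators.
\<close>

definition gradient_equivariant :: "'k^3^3 \<Rightarrow> bool" where
  "gradient_equivariant M \<longleftrightarrow> (\<forall>i a b.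
     (\<Sum>k\<in>UNIV. \<Sum>l\<in>UNIV. T i k l * M $ k $ a * M $ l $ b) = (\<Sum>j\<in>UNIV. cofactor M i j * T j a b))"

lemma gradient_equivariant_1: "gradient_equivariant (mat 1)"
  unfolding gradient_equivariant_def
proof (intro allI)
  fix i a b
  show "(\<Sum>k\<in>UNIV. \<Sum>l\<in>UNIV. T i k l * mat 1 $ k $ a * mat 1 $ l $ b) =
      (\<Sum>j\<in>UNIV. cofactor (mat 1) i j * T j a b)"
    unfolding cofactor_1
    using exhaust_3[of i] exhaust_3[of a] exhaust_3[of b] by (auto simp: sum_3 mat_def)
qed

end

locale quantized_cubic = symmetric_tensor T for T :: "3 \<Rightarrow> 3 \<Rightarrow> 3 \<Rightarrow> 'k::field_char_0" +
  fixes h :: 'k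
begin

text \<open>
  The relation for \<open>[y\<^sub>i\<^sub>+\<^sub>1, y\<^sub>i\<^sub>+\<^sub>2]\<close>, whose right hand side is \<open>h\<close> times the symmetrized \<open>\<partial>\<^sub>i \<Omega>\<close>. Its
  skew part does not depend on \<open>\<Omega>\<close>, and its symmetric part is \<open>- h/2 T i\<close>.
\<close>

definition rel :: "3 \<Rightarrow> 'k free3" where
  "rel i = quad_form Y (\<lambda>a b. skew i a b - h / 2 * T i a b)"

text \<open>
  In \<open>\<Sum> u\<^sub>i rel i = 0\<close> the last two letters can be stripped off, which leaves a linear relation
  between the \<open>u\<^sub>i\<close> for each pair of letters. The difference of those for \<open>(i + 1, i + 2)\<close> and
  \<open>(i + 2, i + 1)\<close> does not involve \<open>T\<close> and is \<open>2 u\<^sub>i = 0\<close>.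
\<close>

lemma left_independent_rel: "left_independent rel"
  unfolding left_independent_def
proof (intro allI impI)
  fix u i assume 0: "(\<Sum>i\<in>UNIV. u i * rel i) = 0"
  define \<rho> where "\<rho> i a b = skew i a b - h / 2 * T i a b" for i a b
  have rel: "rel i = (\<Sum>b\<in>UNIV. (\<Sum>a\<in>UNIV. Const (\<rho> i a b) * Y a) * Y b)" for i
    by (simp add: rel_def quad_form_eq_right \<rho>_def)
  have "(\<Sum>i\<in>UNIV. u i * rel i) = (\<Sum>b\<in>UNIV. (\<Sum>a\<in>UNIV. (\<Sum>i\<in>UNIV. Const (\<rho> i a b) * u i) * Y a) * Y b)"
    unfolding rel sum_3 by (simp add: algebra_simps Const_left_commute)
  with 0 have "(\<Sum>b\<in>UNIV. (\<Sum>a\<in>UNIV. (\<Sum>i\<in>UNIV. Const (\<rho> i a b) * u i) * Y a) * Y b) = 0"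
    by simp
  then have "(\<Sum>i\<in>UNIV. Const (\<rho> i a b) * u i) = 0" for a b
    by (intro left_independentD[OF left_independent_Y, of "\<lambda>a. \<Sum>i\<in>UNIV. Const (\<rho> i a b) * u i" for b]
        left_independentD[OF left_independent_Y,
          of "\<lambda>b. \<Sum>a\<in>UNIV. (\<Sum>i\<in>UNIV. Const (\<rho> i a b) * u i) * Y a"])
  from this[of "i + 1" "i + 2"] this[of "i + 2" "i + 1"]
  have "(\<Sum>j\<in>UNIV. Const (\<rho> j (i + 1) (i + 2) - \<rho> j (i + 2) (i + 1)) * u j) = 0"
    by (simp add: Const_diff left_diff_distrib sum_subtractf)
  moreover have "\<rho> j (i + 1) (i + 2) - \<rho> j (i + 2) (i + 1) = 2 * skew j (i + 1) (i + 2)" for j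
    using T_sym(2)[of j "i + 1" "i + 2"] by (simp add: \<rho>_def skew_antisym[of j "i + 2"])
  moreover have "(\<Sum>j\<in>UNIV. Const (2 * skew j (i + 1) (i + 2)) * u j) = Const 2 * u i"
    using exhaust_3[of i] by (auto simp: skew_def sum_3)
  ultimately have "Const 2 * u i = Const 2 * 0" by simp
  then show "u i = 0" by (rule Const_inverse_cancel[rotated]) simp
qed

lemma rel_transform_iff:
  "free_matrix_subst M (rel i) = (\<Sum>j\<in>UNIV. Const (C j) * rel j) \<longleftrightarrow>
    (\<forall>a b. (\<Sum>k\<in>UNIV. \<Sum>l\<in>UNIV. (skew i k l - h / 2 * T i k l) * M $ k $ a * M $ l $ b) =
      (\<Sum>j\<in>UNIV. C j * (skew j a b - h / 2 * T j a b)))"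
  unfolding rel_def free_matrix_subst_quad_form quad_form_sum quad_form_Y_eq_iff fun_eq_iff ..

lemma transform_split:
  "(\<Sum>k\<in>UNIV. \<Sum>l\<in>UNIV. (skew i k l - h / 2 * T i k l) * M $ k $ a * M $ l $ b) =
   (\<Sum>j\<in>UNIV. cofactor M i j * skew j a b) -
   h / 2 * (\<Sum>k\<in>UNIV. \<Sum>l\<in>UNIV. T i k l * M $ k $ a * M $ l $ b)"
  unfolding skew_transform[symmetric]
  by (simp only: left_diff_distrib sum_subtractf sum_distrib_left mult.assoc)

lemma rel_transform:
  assumes "gradient_equivariant M"
  shows "free_matrix_subst M (rel i) = (\<Sum>j\<in>UNIV. Const (cofactor M i j) * rel j)"
  unfolding rel_transform_iff transform_split
  using assms unfolding gradient_equivariant_def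
  by (simp only: right_diff_distrib sum_subtractf sum_distrib_left mult.left_commute) simp

text \<open>
  The skew part of the transformed relation forces the coefficients \<open>C\<close> to be the cofactors,
  because the skew parts of the three relations are independent. The symmetric part is then
  \<open>h/2\<close> times the condition on the gradient.
\<close>

lemma gradient_equivariant_if_rel:
  assumes "h \<noteq> 0" and inv: "\<And>i. \<exists>C. free_matrix_subst M (rel i) = (\<Sum>j\<in>UNIV. Const (C j) * rel j)"
  shows "gradient_equivariant M"
  unfolding gradient_equivariant_def
proof (intro allI)
  fix i a b
  let ?S = "\<lambda>a b. \<Sum>k\<in>UNIV. \<Sum>l\<in>UNIV. T i k l * M $ k $ a * M $ l $ b"
  obtain C where "free_matrix_subst M (rel i) = (\<Sum>j\<in>UNIV. Const (C j) * rel j)" using inv by blast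
  then have C: "(\<Sum>j\<in>UNIV. cofactor M i j * skew j a b) - h / 2 * ?S a b =
      (\<Sum>j\<in>UNIV. C j * skew j a b) - h / 2 * (\<Sum>j\<in>UNIV. C j * T j a b)" for a b
    unfolding rel_transform_iff transform_split
    by (simp add: right_diff_distrib sum_subtractf sum_distrib_left mult.left_commute)
  have S: "?S a b = ?S b a" for a b
    by (subst sum.swap) (simp add: T_sym(2)[of i] mult_ac)
  have "cofactor M i j = C j" for j
  proof -
    have "(\<Sum>l\<in>UNIV. c l * skew l (j + 2) (j + 1)) = - c j" for c :: "3 \<Rightarrow> 'k"
      using sum_skew[of c j] by (simp add: skew_antisym[of _ "j + 2"] sum_negf)
    then have "- cofactor M i j - h / 2 * ?S (j + 1) (j + 2) =
        - C j - h / 2 * (\<Sum>l\<in>UNIV. C l * T l (j + 1) (j + 2))"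
      using C[of "j + 2" "j + 1"] S[of "j + 2" "j + 1"] T_sym(2)[of _ "j + 2" "j + 1"] by simp
    moreover have "cofactor M i j - h / 2 * ?S (j + 1) (j + 2) =
        C j - h / 2 * (\<Sum>l\<in>UNIV. C l * T l (j + 1) (j + 2))"
      using C[of "j + 1" "j + 2"] by (simp only: sum_skew)
    moreover have "x = y" if "- x - s = - y - t" "x - s = y - t" for x y s t :: 'k
    proof -
      have "(x - s) - (- x - s) = (y - t) - (- y - t)" using that by simp
      then show ?thesis by simp
    qed
    ultimately show ?thesis by blast
  qed
  then show "?S a b = (\<Sum>j\<in>UNIV. cofactor M i j * T j a b)"
    using C[of a b] \<open>h \<noteq> 0\<close> by simp
qed

text \<open>
  The coefficients \<open>skew i a b - h/2 T i a b\<close> are invariant under cyclic permutations, so that the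
  relations are both the left and the right derivatives of one cubic element.
  The two expressions of it give a syzygy between the relations.
\<close>

definition superpotential :: "'k free3" where
  "superpotential = (\<Sum>i\<in>UNIV. Y i * rel i)"

lemma superpotential_right: "superpotential = (\<Sum>i\<in>UNIV. rel i * Y i)"
proof -
  have T: "T i a b = T b i a" for i a b by (metis T_sym)
  have "superpotential = (\<Sum>i\<in>UNIV. \<Sum>a\<in>UNIV. \<Sum>b\<in>UNIV. Const (skew i a b - h / 2 * T i a b) * (Y i * (Y a * Y b)))"
    by (simp add: superpotential_def rel_def quad_form_def sum_distrib_left Const_left_commute)
  also have "\<dots> = (\<Sum>i\<in>UNIV. \<Sum>a\<in>UNIV. \<Sum>b\<in>UNIV. Const (skew b i a - h / 2 * T b i a) * (Y i * (Y a * Y b)))"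
  proof -
    have "skew i a b = (skew b i a :: 'k)" for i a b
      using exhaust_3[of i] exhaust_3[of a] exhaust_3[of b] by (auto simp: skew_def)
    then show ?thesis using T by simp
  qed
  also have "\<dots> = (\<Sum>b\<in>UNIV. \<Sum>i\<in>UNIV. \<Sum>a\<in>UNIV. Const (skew b i a - h / 2 * T b i a) * (Y i * (Y a * Y b)))"
    by (subst (2) sum.swap, subst sum.swap) rule
  also have "\<dots> = (\<Sum>i\<in>UNIV. rel i * Y i)"
    by (simp add: rel_def quad_form_def sum_distrib_right mult.assoc)
  finally show ?thesis .
qed

text \<open>
  The letters are transformed by \<open>M\<close> and the relations by the cofactors of \<open>M\<close>; expansion of the
  determinant along a column leaves the factor \<open>det M\<close>.
\<close>

lemma superpotential_transform:
  assumes "gradient_equivariant M"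
  shows "free_matrix_subst M superpotential = Const (det M) * superpotential"
proof -
  note f = alg_endo_free_matrix_subst[of M]
  have "free_matrix_subst M superpotential =
      (\<Sum>i\<in>UNIV. (\<Sum>a\<in>UNIV. Const (M $ i $ a) * Y a) * (\<Sum>b\<in>UNIV. Const (cofactor M i b) * rel b))"
    unfolding superpotential_def
    by (simp add: alg_endoD(2,3,8)[OF f] free_matrix_subst_Y rel_transform[OF assms])
  also have "\<dots> = (\<Sum>i\<in>UNIV. \<Sum>a\<in>UNIV. \<Sum>b\<in>UNIV. Const (M $ i $ a * cofactor M i b) * (Y a * rel b))"
    unfolding sum_product Const_mult_mult ..
  also have "\<dots> = (\<Sum>a\<in>UNIV. \<Sum>b\<in>UNIV. \<Sum>i\<in>UNIV. Const (M $ i $ a * cofactor M i b) * (Y a * rel b))"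
    by (subst sum.swap, rule sum.cong[OF refl], rule sum.swap)
  also have "\<dots> = (\<Sum>a\<in>UNIV. \<Sum>b\<in>UNIV. Const (if a = b then det M else 0) * (Y a * rel b))"
    unfolding sum_distrib_right[symmetric] Const_sum[symmetric] cofactor_expand_columns ..
  also have "\<dots> = Const (det M) * superpotential"
    by (simp add: superpotential_def sum_distrib_left if_distrib if_distribR cong: if_cong)
  finally show ?thesis .
qed

lemma left_independent_superpotential: "left_independent (\<lambda>_::unit. superpotential)"
  unfolding left_independent_def
proof (intro allI impI)
  fix u :: "unit \<Rightarrow> 'k free3" and x
  assume "(\<Sum>i\<in>UNIV. u i * superpotential) = 0"
  then have "(\<Sum>i\<in>UNIV. (u () * Y i) * rel i) = 0"
    by (simp add: UNIV_unit superpotential_def sum_distrib_left mult.assoc)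
  then have "u () * Y i = 0" for i
    by (rule left_independentD[OF left_independent_rel])
  then show "u x = 0"
    using left_independentD[OF left_independent_Y, of "\<lambda>_. u ()"] by (cases x) simp
qed

end

section \<open>Exactness of the Koszul complex and trace series\<close>

abbreviation free_trace :: "'k::field^3^3 \<Rightarrow> nat \<Rightarrow> 'k" where
  "free_trace M n \<equiv> fa.trace_on (free_comp n) (free_matrix_subst M)"

lemma free_trace_Suc: "free_trace M (Suc n) = free_trace M n * trace M"
  unfolding free_comp_Suc trace_def
  by (rule trace_right_span[OF left_independent_Y fin_dim_free_comp alg_endo_free_matrix_subst
        image_free_comp free_matrix_subst_Y])

lemma free_trace_0: "free_trace M 0 = 1"
proof -
  have "fa.trace_on (free_comp 0) (free_matrix_subst M) = (\<Sum>i\<in>{()}. (\<lambda>_ _. 1) i i)"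
    by (rule fa.trace_on_family[where v = "\<lambda>_. 1"])
      (use finite_basis_free_comp_0 in \<open>simp_all add: alg_endoD[OF alg_endo_free_matrix_subst]
        linear_alg_endo[OF alg_endo_free_matrix_subst]\<close>)
  then show ?thesis by simp
qed

lemma trace_on_free_matrix_subst_1: "fa.trace_on E (free_matrix_subst (mat 1)) = fa.trace_on E (\<lambda>p. p)"
  using free_matrix_subst_1 by (metis ext)

lemma free_trace_1: "free_trace (mat 1 :: 'k::field^3^3) n = 3 ^ n"
  by (induction n) (simp_all add: free_trace_0 free_trace_Suc trace_def mat_def)

context quantized_cubic
begin

text \<open>
  The component \<open>J\<^sub>n\<close> of the two-sided ideal \<open>J\<close> generated by the relations. The recursion
  \<open>J\<^sub>n\<^sub>+\<^sub>2 = J\<^sub>n\<^sub>+\<^sub>1 V + F\<^sub>n R\<close>, with \<open>V\<close> the span of the letters and \<open>R\<close> that of the relations, holds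
  since a product \<open>p \<rho> q\<close> with a relation \<open>\<rho>\<close> and a word \<open>q\<close> either ends with \<open>\<rho>\<close> or ends with a
  letter. It expresses \<open>J\<^sub>n\<^sub>+\<^sub>2\<close> by spaces of which the traces are known.
\<close>

fun ideal_comp :: "nat \<Rightarrow> 'k free3 set" where
  "ideal_comp 0 = {0}"
| "ideal_comp (Suc 0) = {0}"
| "ideal_comp (Suc (Suc n)) =
     {x + y | x y. x \<in> right_span (ideal_comp (Suc n)) Y \<and> y \<in> right_span (free_comp n) rel}"

lemma subspace_ideal_comp: "fa.subspace (ideal_comp n)"
proof (induction n rule: ideal_comp.induct)
  case (3 n)
  then show ?case unfolding ideal_comp.simps
    by (intro fa.subspace_sums subspace_right_span subspace_free_comp)
qed (simp_all add: fa.subspace_single_0)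

lemma rel_in_free_comp: "rel i \<in> free_comp (Suc (Suc 0))"
proof -
  have "Y a * Y b \<in> free_comp (Suc (Suc 0))" for a b
    using mult_in_free_comp[OF Y_in Y_in, of a b] by (simp add: numeral_2_eq_2)
  then show ?thesis
    unfolding rel_def quad_form_def
    by (intro fa.subspace_sum[OF subspace_free_comp] fa.subspace_scale[OF subspace_free_comp])
qed

lemma ideal_comp_subset: "ideal_comp n \<subseteq> free_comp n"
proof (induction n rule: ideal_comp.induct)
  case (3 n)
  have "right_span (ideal_comp (Suc n)) Y \<subseteq> free_comp (Suc (Suc n))"
    using 3 right_span_mono free_comp_Suc by blast
  moreover have "right_span (free_comp n) rel \<subseteq> free_comp (Suc (Suc n))"
    using mult_in_free_comp[OF _ rel_in_free_comp, of _ n]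
    by (auto elim!: right_spanE intro!: fa.subspace_sum subspace_free_comp)
  ultimately show ?case
    by (auto intro!: fa.subspace_add[OF subspace_free_comp])
qed (auto intro: fa.subspace_0[OF subspace_free_comp])

lemma ideal_comp_right_Y: "p \<in> ideal_comp n \<Longrightarrow> p * Y i \<in> ideal_comp (Suc n)"
proof (cases n)
  case (Suc m)
  assume "p \<in> ideal_comp n"
  then have "p * Y i + 0 \<in> ideal_comp (Suc (Suc m))"
    unfolding ideal_comp.simps Suc
    using mult_in_right_span[OF subspace_ideal_comp, of p "Suc m" Y i]
      fa.subspace_0[OF subspace_right_span[OF subspace_free_comp, of m rel]] by blast
  then show ?thesis using Suc by simp
qed simp

lemma right_span_rel_subset: "right_span (free_comp n) rel \<subseteq> ideal_comp (Suc (Suc n))"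
proof
  fix y assume "y \<in> right_span (free_comp n) rel"
  moreover have "0 \<in> right_span (ideal_comp (Suc n)) Y"
    by (intro fa.subspace_0 subspace_right_span subspace_ideal_comp)
  ultimately have "0 + y \<in> ideal_comp (Suc (Suc n))" unfolding ideal_comp.simps by blast
  then show "y \<in> ideal_comp (Suc (Suc n))" by simp
qed

lemma right_span_Y_subset: "right_span (ideal_comp n) Y \<subseteq> ideal_comp (Suc n)"
proof
  fix x assume x: "x \<in> right_span (ideal_comp n) Y"
  obtain u where u: "\<And>k. u k \<in> ideal_comp n" "x = (\<Sum>k\<in>UNIV. u k * Y k)"
    using right_spanE[OF x] by blast
  show "x \<in> ideal_comp (Suc n)" unfolding u(2)
    by (intro fa.subspace_sum subspace_ideal_comp ideal_comp_right_Y u(1))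
qed

lemma ideal_comp_left_Y: "p \<in> ideal_comp n \<Longrightarrow> Y i * p \<in> ideal_comp (Suc n)"
proof (induction n arbitrary: p rule: ideal_comp.induct)
  case (3 n)
  then obtain x y where p: "p = x + y" and x: "x \<in> right_span (ideal_comp (Suc n)) Y"
    and y: "y \<in> right_span (free_comp n) rel" by auto
  obtain u where u: "\<And>k. u k \<in> ideal_comp (Suc n)" "x = (\<Sum>k\<in>UNIV. u k * Y k)"
    using right_spanE[OF x] by blast
  obtain v where v: "\<And>k. v k \<in> free_comp n" "y = (\<Sum>k\<in>UNIV. v k * rel k)"
    using right_spanE[OF y] by blast
  have "Y i * x = (\<Sum>k\<in>UNIV. (Y i * u k) * Y k)" by (simp add: u sum_distrib_left mult.assoc)
  moreover have "Y i * y = (\<Sum>k\<in>UNIV. (Y i * v k) * rel k)" by (simp add: v sum_distrib_left mult.assoc)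
  moreover have "(\<Sum>k\<in>UNIV. (Y i * u k) * Y k) \<in> right_span (ideal_comp (Suc (Suc n))) Y"
    by (rule right_spanI) (rule 3(1)[OF u(1)])
  moreover have "(\<Sum>k\<in>UNIV. (Y i * v k) * rel k) \<in> right_span (free_comp (Suc n)) rel"
    using mult_in_free_comp[OF Y_in v(1)] by (intro right_spanI) simp
  ultimately show ?case unfolding ideal_comp.simps p by (auto simp: distrib_left)
qed (auto simp del: ideal_comp.simps(3) intro: fa.subspace_0[OF subspace_ideal_comp])

lemma ideal_comp_right_comp1: "p \<in> ideal_comp n \<Longrightarrow> q \<in> free_comp 1 \<Longrightarrow> p * q \<in> ideal_comp (Suc n)"
proof -
  assume p: "p \<in> ideal_comp n" and "q \<in> free_comp 1"
  then have q: "q \<in> right_span (free_comp 0) Y" by (simp add: free_comp_Suc)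
  obtain u where u: "\<And>k. u k \<in> free_comp 0" "q = (\<Sum>k\<in>UNIV. u k * Y k)"
    using right_spanE[OF q] by blast
  then have "\<forall>k. \<exists>c. u k = Const c" by (auto simp: free_comp_0)
  then obtain c where c: "\<And>k. u k = Const (c k)" by metis
  have "p * q = (\<Sum>k\<in>UNIV. Const (c k) * (p * Y k))" by (simp add: u c sum_distrib_left Const_left_commute)
  also have "\<dots> \<in> ideal_comp (Suc n)"
    by (intro fa.subspace_sum fa.subspace_scale subspace_ideal_comp ideal_comp_right_Y p)
  finally show ?thesis .
qed

lemma image_ideal_comp:
  assumes M: "gradient_equivariant M"
  shows "free_matrix_subst M ` ideal_comp n \<subseteq> ideal_comp n"
proof (induction n rule: ideal_comp.induct)
  case (3 n)
  note f = alg_endo_free_matrix_subst[of M]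
  have "free_matrix_subst M ` right_span (ideal_comp (Suc n)) Y \<subseteq> right_span (ideal_comp (Suc n)) Y"
    by (rule image_right_span[OF f subspace_ideal_comp 3 free_matrix_subst_Y])
  moreover have "free_matrix_subst M ` right_span (free_comp n) rel \<subseteq> right_span (free_comp n) rel"
    by (rule image_right_span[OF f subspace_free_comp image_free_comp rel_transform[OF M]])
  ultimately show ?case unfolding ideal_comp.simps
    by (auto simp: alg_endoD(1)[OF f]) blast
qed (simp_all add: alg_endoD(4)[OF alg_endo_free_matrix_subst])

lemma fin_dim_ideal_comp: "fa.fin_dim (ideal_comp n)"
  by (rule fa.fin_dim_subspace[OF fin_dim_free_comp subspace_ideal_comp ideal_comp_subset])

text \<open>
  The overlap is the intersection \<open>J\<^sub>n\<^sub>+\<^sub>2 V \<inter> F\<^sub>n\<^sub>+\<^sub>1 R\<close> of the two summands of \<open>J\<^sub>n\<^sub>+\<^sub>3\<close>. It contains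
  \<open>J\<^sub>n\<^sub>+\<^sub>1 R\<close>, as relations end with letters, and \<open>F\<^sub>n w\<close> for the superpotential \<open>w\<close>, by its two
  expressions. That these exhaust it is the exactness of the complex
  \<open>A(-3) \<rightarrow> A(-2)\<^sup>3 \<rightarrow> A(-1)\<^sup>3 \<rightarrow> A\<close> of left modules over \<open>A = F/J\<close> at the term \<open>A(-2)\<^sup>3\<close>.
\<close>

definition overlap :: "nat \<Rightarrow> 'k free3 set" where
  "overlap n = right_span (ideal_comp (Suc (Suc n))) Y \<inter> right_span (free_comp (Suc n)) rel"

definition generated_overlap :: "nat \<Rightarrow> 'k free3 set" where
  "generated_overlap n = {x + y | x y. x \<in> right_span (ideal_comp (Suc n)) rel \<and>
     y \<in> right_span (free_comp n) (\<lambda>_::unit. superpotential)}"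

lemma subspace_overlap: "fa.subspace (overlap n)"
  unfolding overlap_def
  by (intro fa.subspace_inter subspace_right_span subspace_ideal_comp subspace_free_comp)

lemma subspace_generated_overlap: "fa.subspace (generated_overlap n)"
  unfolding generated_overlap_def
  by (intro fa.subspace_sums subspace_right_span subspace_ideal_comp subspace_free_comp)

lemma overlap_subset_free_comp: "overlap n \<subseteq> free_comp (Suc (Suc (Suc n)))"
  unfolding overlap_def
  using right_span_rel_subset[of "Suc n"] ideal_comp_subset[of "Suc (Suc (Suc n))"] by blast

lemma superpotential_span:
  assumes "u \<in> right_span U (\<lambda>_::unit. superpotential)"
  obtains p where "p \<in> U" "u = p * superpotential"
  using assms by (auto elim!: right_spanE simp: UNIV_unit)

lemma generated_overlap_subset: "generated_overlap n \<subseteq> overlap n"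
proof -
  have 1: "x \<in> overlap n" if x: "x \<in> right_span (ideal_comp (Suc n)) rel" for x
  proof -
    obtain u where u: "\<And>k. u k \<in> ideal_comp (Suc n)" "x = (\<Sum>k\<in>UNIV. u k * rel k)"
      using right_spanE[OF x] by blast
    have "x \<in> right_span (free_comp (Suc n)) rel"
      using x right_span_mono[OF ideal_comp_subset] by blast
    moreover have "x \<in> right_span (ideal_comp (Suc (Suc n))) Y"
    proof -
      \<comment> \<open>Split off the last letter of each relation.\<close>
      define s where "s k b = (\<Sum>a\<in>UNIV. Const (skew k a b - h / 2 * T k a b) * Y a)" for k b
      have s: "s k b \<in> free_comp 1" for k b
        unfolding s_def by (intro fa.subspace_sum fa.subspace_scale subspace_free_comp Y_in)
      have "rel k = (\<Sum>b\<in>UNIV. s k b * Y b)" for k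
        by (simp add: rel_def quad_form_eq_right s_def)
      then have "u k * rel k = (\<Sum>b\<in>UNIV. (u k * s k b) * Y b)" for k
        by (simp only: sum_distrib_left mult.assoc)
      moreover have "(\<Sum>b\<in>UNIV. (u k * s k b) * Y b) \<in> right_span (ideal_comp (Suc (Suc n))) Y" for k
        by (intro right_spanI ideal_comp_right_comp1 u s)
      ultimately show ?thesis unfolding u(2)
        by (intro fa.subspace_sum subspace_right_span subspace_ideal_comp) simp
    qed
    ultimately show ?thesis by (simp add: overlap_def)
  qed
  have 2: "y \<in> overlap n" if y: "y \<in> right_span (free_comp n) (\<lambda>_::unit. superpotential)" for y
  proof -
    obtain p where p: "p \<in> free_comp n" "y = p * superpotential" using superpotential_span[OF y] by blast
    have "y = (\<Sum>i\<in>UNIV. (p * rel i) * Y i)"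
      by (simp add: p superpotential_right sum_distrib_left mult.assoc)
    moreover have "p * rel i \<in> ideal_comp (Suc (Suc n))" for i
      using right_span_rel_subset mult_in_right_span[OF subspace_free_comp p(1), of rel i] by blast
    ultimately have "y \<in> right_span (ideal_comp (Suc (Suc n))) Y"
      using right_spanI[of "\<lambda>i. p * rel i" "ideal_comp (Suc (Suc n))" Y] by metis
    moreover have "y \<in> right_span (free_comp (Suc n)) rel"
    proof -
      have "y = (\<Sum>i\<in>UNIV. (p * Y i) * rel i)"
        by (simp add: p superpotential_def sum_distrib_left mult.assoc)
      moreover have "p * Y i \<in> free_comp (Suc n)" for i
        using mult_in_free_comp[OF p(1) Y_in] by simp
      ultimately show ?thesis
        using right_spanI[of "\<lambda>i. p * Y i" "free_comp (Suc n)" rel] by metis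
    qed
    ultimately show ?thesis by (simp add: overlap_def)
  qed
  show ?thesis unfolding generated_overlap_def
    using 1 2 fa.subspace_add[OF subspace_overlap] by blast
qed

end

text \<open>
  In degree \<open>n\<close>, the Hilbert series \<open>1/(1 - t)\<^sup>3\<close> gives the quotient the dimension \<open>n + 2 choose 2\<close>,
  while \<open>F\<^sub>n\<close> has dimension \<open>3\<^sup>n\<close>.
\<close>

locale quantized_cubic_domain = quantized_cubic T h
  for T :: "3 \<Rightarrow> 3 \<Rightarrow> 3 \<Rightarrow> 'k::field_char_0" and h :: 'k +
  assumes hilbert: "\<exists>B. fa.finite_basis (ideal_comp n) B \<and> card B + (n + 2 choose 2) = 3 ^ n"
    and Y_regular: "p \<in> free_comp n \<Longrightarrow> p * Y i \<in> ideal_comp (Suc n) \<Longrightarrow> p \<in> ideal_comp n"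
begin

text \<open>
  As the relations are left independent, \<open>p w = \<Sum> (p y\<^sub>k) rel k\<close> belongs to \<open>J\<^sub>n\<^sub>+\<^sub>1 R\<close> if and only if
  every \<open>p y\<^sub>k\<close> belongs to \<open>J\<^sub>n\<^sub>+\<^sub>1\<close>, which by regularity of a letter means \<open>p \<in> J\<^sub>n\<close>.
\<close>

lemma overlap_rel_superpotential:
  "right_span (ideal_comp (Suc n)) rel \<inter> right_span (free_comp n) (\<lambda>_::unit. superpotential) =
     right_span (ideal_comp n) (\<lambda>_::unit. superpotential)" (is "?A \<inter> ?B = ?C")
proof
  show "?A \<inter> ?B \<subseteq> ?C"
  proof
    fix x assume "x \<in> ?A \<inter> ?B"
    then have xA: "x \<in> ?A" and xB: "x \<in> ?B" by auto
    obtain p where p: "p \<in> free_comp n" "x = p * superpotential" using superpotential_span[OF xB] by blast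
    obtain u where u: "\<And>k. u k \<in> ideal_comp (Suc n)" "x = (\<Sum>k\<in>UNIV. u k * rel k)"
      using right_spanE[OF xA] by blast
    have "(\<Sum>k\<in>UNIV. u k * rel k) = (\<Sum>k\<in>UNIV. (p * Y k) * rel k)"
      unfolding u(2)[symmetric] p(2) by (simp add: superpotential_def sum_distrib_left mult.assoc)
    from fun_cong[OF left_independent_eq[OF left_independent_rel this], of 1]
    have "p * Y 1 \<in> ideal_comp (Suc n)" using u(1)[of 1] by simp
    then have "p \<in> ideal_comp n" by (rule Y_regular[OF p(1)])
    then show "x \<in> ?C"
      using mult_in_right_span[OF subspace_ideal_comp, of p n "\<lambda>_::unit. superpotential" "()"] p by simp
  qed
  show "?C \<subseteq> ?A \<inter> ?B"
  proof
    fix x assume x: "x \<in> ?C"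
    obtain p where p: "p \<in> ideal_comp n" "x = p * superpotential" using superpotential_span[OF x] by blast
    have "x = (\<Sum>k\<in>UNIV. (p * Y k) * rel k)"
      by (simp add: p superpotential_def sum_distrib_left mult.assoc)
    then have "x \<in> ?A"
      using right_spanI[of "\<lambda>k. p * Y k" "ideal_comp (Suc n)" rel] ideal_comp_right_Y[OF p(1)] by simp
    moreover have "x \<in> ?B" using x right_span_mono[OF ideal_comp_subset] by blast
    ultimately show "x \<in> ?A \<inter> ?B" by simp
  qed
qed

abbreviation ideal_trace :: "'k^3^3 \<Rightarrow> nat \<Rightarrow> 'k" where
  "ideal_trace M n \<equiv> fa.trace_on (ideal_comp n) (free_matrix_subst M)"

context
  fixes M :: "'k^3^3"
  assumes M: "gradient_equivariant M"
begin

lemma trace_ideal_Y: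
  "fa.trace_on (right_span (ideal_comp n) Y) (free_matrix_subst M) = ideal_trace M n * trace M"
  unfolding trace_def
  by (rule trace_right_span[OF left_independent_Y fin_dim_ideal_comp alg_endo_free_matrix_subst
        image_ideal_comp[OF M] free_matrix_subst_Y])

lemma trace_free_rel:
  "fa.trace_on (right_span (free_comp n) rel) (free_matrix_subst M) = free_trace M n * second_trace M"
  unfolding second_trace_def
  by (rule trace_right_span[OF left_independent_rel fin_dim_free_comp alg_endo_free_matrix_subst
        image_free_comp rel_transform[OF M]])

lemma trace_ideal_rel:
  "fa.trace_on (right_span (ideal_comp n) rel) (free_matrix_subst M) = ideal_trace M n * second_trace M"
  unfolding second_trace_def
  by (rule trace_right_span[OF left_independent_rel fin_dim_ideal_comp alg_endo_free_matrix_subst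
        image_ideal_comp[OF M] rel_transform[OF M]])

lemma superpotential_transform_unit:
  "free_matrix_subst M ((\<lambda>_::unit. superpotential) i) =
     (\<Sum>j\<in>UNIV. Const ((\<lambda>_ _. det M) i j) * (\<lambda>_::unit. superpotential) j)"
  by (simp add: superpotential_transform[OF M] UNIV_unit)

lemma trace_free_superpotential:
  "fa.trace_on (right_span (free_comp n) (\<lambda>_::unit. superpotential)) (free_matrix_subst M) =
     free_trace M n * det M"
  using trace_right_span[OF left_independent_superpotential fin_dim_free_comp alg_endo_free_matrix_subst
        image_free_comp superpotential_transform_unit] by (simp add: UNIV_unit)

lemma trace_ideal_superpotential:
  "fa.trace_on (right_span (ideal_comp n) (\<lambda>_::unit. superpotential)) (free_matrix_subst M) =
     ideal_trace M n * det M"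
  using trace_right_span[OF left_independent_superpotential fin_dim_ideal_comp alg_endo_free_matrix_subst
        image_ideal_comp[OF M] superpotential_transform_unit] by (simp add: UNIV_unit)

lemma ideal_trace_overlap:
  "ideal_trace M (Suc (Suc (Suc n))) + fa.trace_on (overlap n) (free_matrix_subst M) =
     ideal_trace M (Suc (Suc n)) * trace M + free_trace M (Suc n) * second_trace M"
proof -
  have sub: "right_span (ideal_comp (Suc (Suc n))) Y \<subseteq> free_comp (Suc (Suc (Suc n)))"
    "right_span (free_comp (Suc n)) rel \<subseteq> free_comp (Suc (Suc (Suc n)))"
    using right_span_rel_subset[of "Suc n"] right_span_Y_subset[of "Suc (Suc n)"]
      ideal_comp_subset[of "Suc (Suc (Suc n))"] by blast+
  show ?thesis
    unfolding trace_ideal_Y[symmetric] trace_free_rel[symmetric] overlap_def ideal_comp.simps(3)[of "Suc n"]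
    by (rule fa.trace_on_sum[OF fin_dim_free_comp[of "Suc (Suc (Suc n))"] _ sub(1) _ sub(2)
        linear_alg_endo[OF alg_endo_free_matrix_subst]
        image_right_span[OF alg_endo_free_matrix_subst subspace_ideal_comp image_ideal_comp[OF M] free_matrix_subst_Y]
        image_right_span[OF alg_endo_free_matrix_subst subspace_free_comp image_free_comp rel_transform[OF M]]])
      (intro subspace_right_span subspace_ideal_comp subspace_free_comp)+
qed

lemma trace_generated_overlap:
  "fa.trace_on (generated_overlap n) (free_matrix_subst M) + ideal_trace M n * det M =
     ideal_trace M (Suc n) * second_trace M + free_trace M n * det M"
proof -
  have sub: "right_span (ideal_comp (Suc n)) rel \<subseteq> free_comp (Suc (Suc (Suc n)))"
    "right_span (free_comp n) (\<lambda>_::unit. superpotential) \<subseteq> free_comp (Suc (Suc (Suc n)))"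
  proof -
    have "x \<in> generated_overlap n" if "x \<in> right_span (ideal_comp (Suc n)) rel" for x
    proof -
      have "0 \<in> right_span (free_comp n) (\<lambda>_::unit. superpotential)"
        by (intro fa.subspace_0 subspace_right_span subspace_free_comp)
      then have "x + 0 \<in> generated_overlap n" using that unfolding generated_overlap_def by blast
      then show ?thesis by simp
    qed
    moreover have "x \<in> generated_overlap n" if "x \<in> right_span (free_comp n) (\<lambda>_::unit. superpotential)" for x
    proof -
      have "0 \<in> right_span (ideal_comp (Suc n)) rel"
        by (intro fa.subspace_0 subspace_right_span subspace_ideal_comp)
      then have "0 + x \<in> generated_overlap n" using that unfolding generated_overlap_def by blast
      then show ?thesis by simp
    qed
    ultimately show "right_span (ideal_comp (Suc n)) rel \<subseteq> free_comp (Suc (Suc (Suc n)))"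
      "right_span (free_comp n) (\<lambda>_::unit. superpotential) \<subseteq> free_comp (Suc (Suc (Suc n)))"
      using generated_overlap_subset[of n] overlap_subset_free_comp[of n] by blast+
  qed
  show ?thesis
    unfolding trace_ideal_superpotential[symmetric] trace_free_superpotential[symmetric]
      trace_ideal_rel[symmetric] generated_overlap_def overlap_rel_superpotential[symmetric]
    by (rule fa.trace_on_sum[OF fin_dim_free_comp[of "Suc (Suc (Suc n))"] _ sub(1) _ sub(2)
        linear_alg_endo[OF alg_endo_free_matrix_subst]
        image_right_span[OF alg_endo_free_matrix_subst subspace_ideal_comp image_ideal_comp[OF M] rel_transform[OF M]]
        image_right_span[OF alg_endo_free_matrix_subst subspace_free_comp image_free_comp superpotential_transform_unit]])
      (intro subspace_right_span subspace_ideal_comp subspace_free_comp)+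
qed

end

text \<open>
  One inclusion holds, so it suffices to compare dimensions. The two trace identities for \<open>M = 1\<close>
  express both by the dimensions of the \<open>J\<^sub>n\<close>; their difference is a third difference of
  \<open>n + 2 choose 2\<close>, which vanishes as this is quadratic in \<open>n\<close>.
\<close>

lemma overlap_eq: "overlap n = generated_overlap n"
proof -
  obtain B where B: "fa.finite_basis (overlap n) B"
    using fa.fin_dim_subspace[OF fin_dim_free_comp subspace_overlap overlap_subset_free_comp]
    by (auto simp: fa.fin_dim_def)
  obtain A where A: "fa.finite_basis (generated_overlap n) A"
    using fa.fin_dim_subspace[OF fin_dim_free_comp subspace_generated_overlap
        order_trans[OF generated_overlap_subset overlap_subset_free_comp]]
    by (auto simp: fa.fin_dim_def)
  have tr1: "trace (mat 1 :: 'k^3^3) = 3" "second_trace (mat 1) = 3"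
    unfolding second_trace_def cofactor_1 by (simp_all add: trace_def mat_def)
  define c where "c m = (of_nat (m + 2 choose 2) :: 'k)" for m
  have ideal: "ideal_trace (mat 1) m = 3 ^ m - c m" for m
  proof -
    obtain C where C: "fa.finite_basis (ideal_comp m) C" "card C + (m + 2 choose 2) = 3 ^ m"
      using hilbert by blast
    have "of_nat (card C) + c m = 3 ^ m"
      unfolding c_def of_nat_add[symmetric] C(2) by simp
    then show ?thesis
      using fa.trace_on_id[OF C(1)] by (simp add: trace_on_free_matrix_subst_1 eq_diff_eq)
  qed
  have binom: "2 * c m = (of_nat m + 2) * (of_nat m + 1)" for m
  proof -
    have "2 * (m + 2 choose 2) = (m + 2) * (m + 1)" by (simp add: choose_two)
    then have "of_nat (2 * (m + 2 choose 2)) = (of_nat ((m + 2) * (m + 1)) :: 'k)" by (simp only:)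
    then show ?thesis by (simp only: of_nat_mult of_nat_add of_nat_numeral of_nat_1 c_def)
  qed
  have "2 * c (Suc (Suc (Suc n))) - 3 * (2 * c (Suc (Suc n))) = 2 * c n - 3 * (2 * c (Suc n))"
    unfolding binom by (simp add: algebra_simps)
  then have "2 * (c (Suc (Suc (Suc n))) - 3 * c (Suc (Suc n))) = 2 * (c n - 3 * c (Suc n))"
    by (simp only: right_diff_distrib mult.left_commute)
  \<comment> \<open>The third difference of \<open>c\<close> vanishes.\<close>
  then have third_difference: "c (Suc (Suc (Suc n))) - 3 * c (Suc (Suc n)) = c n - 3 * c (Suc n)"
    by (rule mult_left_cancel[THEN iffD1, OF zero_neq_numeral[symmetric]])
  have "of_nat (card B) = 3 ^ n * 9 + (c (Suc (Suc (Suc n))) - 3 * c (Suc (Suc n)))"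
    using ideal_trace_overlap[OF gradient_equivariant_1, of n]
    unfolding trace_on_free_matrix_subst_1[of "overlap n"] fa.trace_on_id[OF B] tr1 free_trace_1 ideal
    by (simp add: algebra_simps)
  moreover have "of_nat (card A) = 3 ^ n * 9 + (c n - 3 * c (Suc n))"
    using trace_generated_overlap[OF gradient_equivariant_1, of n]
    unfolding trace_on_free_matrix_subst_1[of "generated_overlap n"] fa.trace_on_id[OF A] tr1 free_trace_1 ideal
    by (simp add: algebra_simps)
  ultimately have "of_nat (card B) = (of_nat (card A) :: 'k)" using third_difference by simp
  then have "card A = card B" by simp
  then show ?thesis using fa.subspace_eq_if_card_eq[OF A B generated_overlap_subset] by simp
qed

definition quotient_trace :: "'k^3^3 \<Rightarrow> nat \<Rightarrow> 'k" where
  "quotient_trace M n = free_trace M n - ideal_trace M n"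

text \<open>
  Equating the traces on the overlap in \<open>ideal_trace_overlap\<close> and \<open>trace_generated_overlap\<close> gives
  the recurrence. Equivalently, the Koszul complex gives the trace series
  \<open>1 / (1 - tr M t + e\<^sub>2 t\<^sup>2 - det M t\<^sup>3)\<close> with \<open>e\<^sub>2 = second_trace M\<close>.
\<close>

theorem quotient_trace_recurrence:
  assumes M: "gradient_equivariant M"
  shows "quotient_trace M 0 = 1" "quotient_trace M 1 = trace M"
    "quotient_trace M 2 = trace M * quotient_trace M 1 - second_trace M"
    "quotient_trace M (n + 3) =
       trace M * quotient_trace M (n + 2) - second_trace M * quotient_trace M (n + 1) + det M * quotient_trace M n"
proof -
  have zero: "fa.trace_on {0} (free_matrix_subst M) = 0"
  proof -
    have "fa.finite_basis {0} {}" by (simp add: fa.finite_basis_def fa.independent_empty)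
    from fa.trace_on_basis[OF this linear_alg_endo[OF alg_endo_free_matrix_subst]]
    show ?thesis by (simp add: alg_endoD[OF alg_endo_free_matrix_subst])
  qed
  have "{x + y | x y. x \<in> right_span {0} Y \<and> y \<in> right_span (free_comp 0) rel} = right_span (free_comp 0) rel"
    by (simp add: right_span_zero)
  then have two: "ideal_trace M 2 = second_trace M"
    using trace_free_rel[OF M, of 0] by (simp add: numeral_2_eq_2 free_trace_0)
  show "quotient_trace M 0 = 1" "quotient_trace M 1 = trace M"
    by (simp_all add: quotient_trace_def zero free_trace_0 free_trace_Suc)
  then show "quotient_trace M 2 = trace M * quotient_trace M 1 - second_trace M"
    using two by (simp add: quotient_trace_def free_trace_0 free_trace_Suc numeral_2_eq_2)
  show "quotient_trace M (n + 3) =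
       trace M * quotient_trace M (n + 2) - second_trace M * quotient_trace M (n + 1) + det M * quotient_trace M n"
  proof -
    let ?K = "fa.trace_on (generated_overlap n) (free_matrix_subst M)"
    have "?K = ideal_trace M (Suc n) * second_trace M + free_trace M n * det M - ideal_trace M n * det M"
      using trace_generated_overlap[OF M, of n] by (simp only: eq_diff_eq)
    moreover have "ideal_trace M (Suc (Suc (Suc n))) =
        ideal_trace M (Suc (Suc n)) * trace M + free_trace M (Suc n) * second_trace M - ?K"
      using ideal_trace_overlap[OF M, of n] unfolding overlap_eq by (simp only: eq_diff_eq)
    ultimately show ?thesis
      unfolding quotient_trace_def numeral_2_eq_2 numeral_3_eq_3 One_nat_def add_Suc_right add_0_right
      by (simp only: free_trace_Suc) (simp add: algebra_simps del: ideal_comp.simps)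
  qed
qed

end

section \<open>Substitutions, derivatives and brackets of polynomials\<close>

lemma X_power: "X i ^ k = Poly_Mapping.single (Poly_Mapping.single i k) 1"
  by (induction k) (simp_all add: X_def mult_single single_add[symmetric])

lemma prod_single: "finite A \<Longrightarrow>
    (\<Prod>i\<in>A. Poly_Mapping.single (e i) (1::'k::field)) = Poly_Mapping.single (\<Sum>i\<in>A. e i) 1"
  for e :: "'j \<Rightarrow> 3 \<Rightarrow>\<^sub>0 nat"
  by (induction A rule: finite_induct) (simp_all add: mult_single)

lemma monomial_eq_prod: "Poly_Mapping.single m c = Const c * (\<Prod>i\<in>UNIV. X i ^ Poly_Mapping.lookup m i)"
  for m :: "3 \<Rightarrow>\<^sub>0 nat"
proof -
  have "(\<Sum>i\<in>UNIV. Poly_Mapping.single i (Poly_Mapping.lookup m i)) = m"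
    by (rule poly_mapping_eqI) (simp add: lookup_sum lookup_single when_def)
  then show ?thesis unfolding X_power by (simp add: prod_single)
qed

lemma pol3_induct [case_names Const X add mult]:
  assumes C: "\<And>c. P (Const c)" and X: "\<And>i. P (X i)"
    and add: "\<And>p q. P p \<Longrightarrow> P q \<Longrightarrow> P (p + q)" and mult: "\<And>p q. P p \<Longrightarrow> P q \<Longrightarrow> P (p * q)"
  shows "P (p :: 'k::field pol3)"
proof (induction p rule: poly_mapping_single_induct)
  case (single m c)
  have pow: "P (X i ^ k)" for i k
    by (induction k) (use C[of 1] X mult in auto)
  have "P (\<Prod>i\<in>A. X i ^ Poly_Mapping.lookup m i)" if "finite A" for A
    using that by (induction A rule: finite_induct) (use C[of 1] mult pow in auto)
  then show ?case unfolding monomial_eq_prod by (intro mult C) simp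
qed (rule add)

lemma pol3_alg_endo_eqI:
  fixes f g :: "'k::field pol3 \<Rightarrow> 'k pol3"
  assumes f: "alg_endo f" and g: "alg_endo g" and gen: "\<And>i. f (X i) = g (X i)"
  shows "f = g"
proof
  fix p show "f p = g p"
    by (induction p rule: pol3_induct) (simp_all add: gen alg_endoD[OF f] alg_endoD[OF g])
qed

definition poly_matrix_subst :: "'k::field^3^3 \<Rightarrow> 'k pol3 \<Rightarrow> 'k pol3" where
  "poly_matrix_subst M =
     monoid_lift (\<lambda>m. \<Prod>i\<in>UNIV. (\<Sum>j\<in>UNIV. Const (M $ i $ j) * X j) ^ Poly_Mapping.lookup m i)"

lemma alg_endo_poly_matrix_subst: "alg_endo (poly_matrix_subst M)"
  unfolding poly_matrix_subst_def
  by (rule alg_endo_monoid_lift) (simp_all add: lookup_add power_add prod.distrib)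

lemma poly_matrix_subst_X: "poly_matrix_subst M (X i) = (\<Sum>j\<in>UNIV. Const (M $ i $ j) * X j)"
proof -
  let ?g = "\<lambda>i. \<Sum>j\<in>UNIV. Const (M $ i $ j) * X j"
  have "(\<Prod>j\<in>UNIV. ?g j ^ Poly_Mapping.lookup (Poly_Mapping.single i 1) j) = (\<Prod>j\<in>UNIV. if j = i then ?g j else 1)"
    by (rule prod.cong) (auto simp: lookup_single when_def)
  then show ?thesis unfolding poly_matrix_subst_def X_def[of i] monoid_lift_single by simp
qed

lemma poly_matrix_subst_mult: "poly_matrix_subst N (poly_matrix_subst M p) = poly_matrix_subst (M ** N) p"
proof -
  have "(\<lambda>p. poly_matrix_subst N (poly_matrix_subst M p)) = poly_matrix_subst (M ** N)"
  proof (rule pol3_alg_endo_eqI)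
    show "poly_matrix_subst N (poly_matrix_subst M (X i)) = poly_matrix_subst (M ** N) (X i)" for i
      unfolding poly_matrix_subst_X[of M] poly_matrix_subst_X[of "M ** N"]
      by (rule alg_endo_linear_forms[OF alg_endo_poly_matrix_subst poly_matrix_subst_X])
  qed (rule alg_endo_comp[OF alg_endo_poly_matrix_subst alg_endo_poly_matrix_subst],
      rule alg_endo_poly_matrix_subst)
  then show ?thesis by metis
qed

lemma poly_matrix_subst_1: "poly_matrix_subst (mat 1) p = p"
proof -
  have "poly_matrix_subst (mat 1) = (\<lambda>p. p)"
    by (rule pol3_alg_endo_eqI)
      (simp_all add: alg_endo_poly_matrix_subst alg_endo_id poly_matrix_subst_X mat_def
        if_distrib if_distribR sum.delta cong: if_cong)
  then show ?thesis by metis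
qed

lemma poly_matrix_subst_funpow: "(poly_matrix_subst M ^^ n) p = poly_matrix_subst (mat_power M n) p"
  by (induction n) (simp_all add: poly_matrix_subst_1 poly_matrix_subst_mult)

lemma lookup_X: "Poly_Mapping.lookup (X i) (Poly_Mapping.single j (Suc 0)) = (if i = j then 1 else 0)"
proof -
  have "Poly_Mapping.keys (Poly_Mapping.single i (Suc 0)) = {i}" for i :: 3 by simp
  then have "Poly_Mapping.single i (Suc 0) = Poly_Mapping.single j (Suc 0) \<longleftrightarrow> i = j"
    by (metis singleton_inject)
  then show ?thesis by (simp add: X_def lookup_single when_def)
qed

lemma linear_form_X_inj:
  assumes "(\<Sum>j\<in>UNIV. Const (c j) * X j) = (\<Sum>j\<in>UNIV. Const (d j) * X j)"
  shows "c = d"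
proof
  fix k
  from arg_cong[OF assms, of "\<lambda>p. Poly_Mapping.lookup p (Poly_Mapping.single k (Suc 0))"]
  show "c k = d k" by (simp add: lookup_sum lookup_X if_distrib cong: if_cong)
qed

lemma pdiff_superset:
  assumes "finite A" "Poly_Mapping.keys p \<subseteq> A"
  shows "pdiff i p = (\<Sum>m\<in>A. Poly_Mapping.single (m - Poly_Mapping.single i 1)
     (of_nat (Poly_Mapping.lookup m i) * Poly_Mapping.lookup p m))"
  unfolding pdiff_def by (rule sum.mono_neutral_left) (use assms in \<open>auto simp: in_keys_iff\<close>)

lemma pdiff_single: "pdiff i (Poly_Mapping.single m c) =
    Poly_Mapping.single (m - Poly_Mapping.single i 1) (of_nat (Poly_Mapping.lookup m i) * c)"
  by (subst pdiff_superset[of "{m}"]) auto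

lemma pdiff_add: "pdiff i (p + q) = pdiff i p + pdiff i q"
proof -
  let ?A = "Poly_Mapping.keys p \<union> Poly_Mapping.keys q"
  have "Poly_Mapping.keys (p + q) \<subseteq> ?A" by (rule keys_add)
  then show ?thesis
    by (simp add: pdiff_superset[of ?A] lookup_add distrib_left single_add sum.distrib)
qed

lemma pdiff_Const [simp]: "pdiff i (Const c) = 0"
  by (simp add: Const_def pdiff_single)

lemma pdiff_numeral [simp]: "pdiff i 0 = 0" "pdiff i 1 = 0" "pdiff i (numeral n) = 0"
  using pdiff_Const[of i 0] pdiff_Const[of i 1] pdiff_Const[of i "numeral n"] by simp_all

lemma pdiff_X [simp]: "pdiff i (X j) = (if i = j then 1 else 0)"
  by (auto simp: X_def pdiff_single lookup_single when_def)

lemma pdiff_mult: "pdiff i (p * q) = pdiff i p * q + p * pdiff i q"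
proof (induction p rule: poly_mapping_single_induct)
  case (single m c)
  show ?case
  proof (induction q rule: poly_mapping_single_induct)
    case (single n d)
    let ?e = "Poly_Mapping.single i (1::nat)"
    have minus: "m - ?e + n = m + n - ?e" if "Poly_Mapping.lookup m i \<noteq> 0" for m n :: "3 \<Rightarrow>\<^sub>0 nat"
      using that by (intro poly_mapping_eqI) (auto simp: lookup_add lookup_minus lookup_single when_def)
    have 1: "Poly_Mapping.single (m - ?e + n) (of_nat (Poly_Mapping.lookup m i) * c * d) =
        Poly_Mapping.single (m + n - ?e) (of_nat (Poly_Mapping.lookup m i) * c * d)"
    proof (cases "Poly_Mapping.lookup m i = 0")
      case False
      show ?thesis by (simp only: minus[OF False])
    qed simp
    have 2: "Poly_Mapping.single (m + (n - ?e)) (c * (of_nat (Poly_Mapping.lookup n i) * d)) =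
        Poly_Mapping.single (m + n - ?e) (c * (of_nat (Poly_Mapping.lookup n i) * d))"
    proof (cases "Poly_Mapping.lookup n i = 0")
      case False
      show ?thesis by (simp only: minus[OF False, of m] add.commute[of m])
    qed simp
    show ?case
      by (simp only: pdiff_single mult_single lookup_add 1 2 single_add[symmetric])
        (simp add: algebra_simps)
  qed (simp add: distrib_left pdiff_add add_ac)
qed (simp add: distrib_right pdiff_add add_ac)

lemma pdiff_sum: "pdiff i (sum f A) = (\<Sum>x\<in>A. pdiff i (f x))"
  by (induction A rule: infinite_finite_induct) (simp_all add: pdiff_add pdiff_def[of i 0])

lemma pdiff_Const_mult [simp]: "pdiff i (Const c * p) = Const c * pdiff i p"
  by (simp add: pdiff_mult)

lemma pdiff_poly_matrix_subst:
  "pdiff a (poly_matrix_subst M p) = (\<Sum>i\<in>UNIV. Const (M $ i $ a) * poly_matrix_subst M (pdiff i p))"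
proof (induction p rule: pol3_induct)
  case (X i)
  have "pdiff a (poly_matrix_subst M (X i)) = Const (M $ i $ a)"
    by (simp add: poly_matrix_subst_X pdiff_sum if_distrib cong: if_cong)
  moreover have "(\<Sum>j\<in>UNIV. Const (M $ j $ a) * poly_matrix_subst M (pdiff j (X i))) =
      (\<Sum>j\<in>UNIV. if j = i then Const (M $ j $ a) else 0)"
    by (rule sum.cong) (simp_all add: alg_endoD[OF alg_endo_poly_matrix_subst])
  ultimately show ?case by simp
qed (simp_all add: alg_endoD[OF alg_endo_poly_matrix_subst] pdiff_add pdiff_mult sum.distrib
    algebra_simps sum_distrib_left)

lemma pbracket_cyclic:
  "pbracket \<Omega> p q = (\<Sum>k\<in>UNIV. pdiff k \<Omega> * (pdiff (k + 1) p * pdiff (k + 2) q - pdiff (k + 2) p * pdiff (k + 1) q))"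
  by (simp add: pbracket_def sum_3)

lemma pbracket_X: "pbracket \<Omega> (X a) (X b) = (\<Sum>k\<in>UNIV. Const (skew k a b) * pdiff k \<Omega>)"
  using exhaust_3[of a] exhaust_3[of b]
  by (auto simp: pbracket_cyclic sum_3 skew_def)

text \<open>
  The cross product of two vectors transformed by \<open>m\<close> is their cross product transformed by the
  cofactors of \<open>m\<close>; here it is paired with a third vector \<open>D\<close>.
\<close>

lemma cross_product_transform:
  fixes m :: "3 \<Rightarrow> 3 \<Rightarrow> 'r::comm_ring_1"
  shows "(\<Sum>c\<in>UNIV. D c * ((\<Sum>i\<in>UNIV. m i (c + 1) * P i) * (\<Sum>i\<in>UNIV. m i (c + 2) * Q i) -
      (\<Sum>i\<in>UNIV. m i (c + 2) * P i) * (\<Sum>i\<in>UNIV. m i (c + 1) * Q i))) =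
    (\<Sum>k\<in>UNIV. (\<Sum>c\<in>UNIV. (m (k + 1) (c + 1) * m (k + 2) (c + 2) - m (k + 1) (c + 2) * m (k + 2) (c + 1)) * D c) *
      (P (k + 1) * Q (k + 2) - P (k + 2) * Q (k + 1)))"
  by (simp add: sum_3 algebra_simps)

text \<open>
  The bracket pairs the gradient of \<open>\<Omega>\<close> with the cross product of the gradients of the arguments.
  By the chain rule and \<open>cross_product_transform\<close> the substitution multiplies that cross product by
  cofactors, which the assumption moves to the gradient of \<open>\<Omega>\<close>.
\<close>

lemma pbracket_poly_matrix_subst:
  assumes "\<And>i. poly_matrix_subst M (pdiff i \<Omega>) = (\<Sum>a\<in>UNIV. Const (cofactor M i a) * pdiff a \<Omega>)"
  shows "poly_matrix_subst M (pbracket \<Omega> p q) = pbracket \<Omega> (poly_matrix_subst M p) (poly_matrix_subst M q)"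
proof -
  note f = alg_endo_poly_matrix_subst[of M]
  have "pbracket \<Omega> (poly_matrix_subst M p) (poly_matrix_subst M q) =
    (\<Sum>k\<in>UNIV. (\<Sum>c\<in>UNIV. Const (cofactor M k c) * pdiff c \<Omega>) *
      (poly_matrix_subst M (pdiff (k + 1) p) * poly_matrix_subst M (pdiff (k + 2) q) -
       poly_matrix_subst M (pdiff (k + 2) p) * poly_matrix_subst M (pdiff (k + 1) q)))"
    unfolding pbracket_cyclic pdiff_poly_matrix_subst
    by (subst cross_product_transform) (simp only: cofactor_def Const_diff Const_mult)
  also have "\<dots> = poly_matrix_subst M (pbracket \<Omega> p q)"
    unfolding pbracket_cyclic assms[symmetric] by (simp only: alg_endoD[OF f])
  finally show ?thesis ..
qed

text \<open>
  Second partial derivatives recover the symmetrized coefficients.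
\<close>

lemma quad_form_X_eq:
  assumes "quad_form X B = quad_form X B'"
  shows "B a b + B b a = B' a b + B' b a"
proof -
  have "pdiff b (pdiff a (quad_form X B)) = Const (B a b + B b a)" for B :: "3 \<Rightarrow> 3 \<Rightarrow> 'a"
  proof -
    have "pdiff b (pdiff a (X k * X l)) = (if k = a \<and> l = b then 1 else 0) + (if k = b \<and> l = a then 1 else (0 :: 'a pol3))" for k l
      by (cases "k = a"; cases "l = a"; cases "k = b"; cases "l = b") (auto simp: pdiff_mult pdiff_add)
    then have "pdiff b (pdiff a (quad_form X B)) =
        (\<Sum>k\<in>UNIV. \<Sum>l\<in>UNIV. Const (B k l) * ((if k = a \<and> l = b then 1 else 0) + (if k = b \<and> l = a then 1 else 0)))"
      by (simp add: quad_form_def pdiff_sum)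
    also have "\<dots> = (\<Sum>k\<in>UNIV. \<Sum>l\<in>UNIV. Const (B k l) * (if k = a \<and> l = b then 1 else 0)) +
        (\<Sum>k\<in>UNIV. \<Sum>l\<in>UNIV. Const (B k l) * (if k = b \<and> l = a then 1 else 0))"
      by (simp only: distrib_left sum.distrib)
    also have "\<dots> = Const (B a b + B b a)"
    proof -
      have "(\<Sum>k\<in>UNIV. \<Sum>l\<in>UNIV. Const (B k l) * (if k = c \<and> l = d then 1 else 0)) = (Const (B c d) :: 'a pol3)" for c d
        using exhaust_3[of c] exhaust_3[of d] by (auto simp: sum_3)
      then show ?thesis by (simp only: Const_add)
    qed
    finally show ?thesis .
  qed
  from this[of B] this[of B'] assms show ?thesis by simp
qed

lemma quad_form_X_symmetric:
  fixes B :: "3 \<Rightarrow> 3 \<Rightarrow> 'k::field_char_0"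
  assumes "quad_form X B = quad_form X B'" "\<And>a b. B a b = B b a" "\<And>a b. B' a b = B' b a"
  shows "B = B'"
proof (intro ext)
  fix a b
  have "B a b + B a b = B' a b + B' a b"
    using quad_form_X_eq[OF assms(1), of a b] assms(2)[of a b] assms(3)[of a b] by simp
  then show "B a b = B' a b" by (simp add: mult_2[symmetric] del: mult_2)
qed

section \<open>Reflections and graded automorphisms of the polynomial ring\<close>

lemma charpoly_eq:
  fixes M :: "'k::field^3^3"
  shows "charpoly M = [:- det M, second_trace M, - trace M, 1:]"
  unfolding charpoly_def det_3[of "mat [:0, 1:] - map_matrix (\<lambda>c. [:c:]) M"]
  by (simp add: mat_def, simp add: det_3 second_trace_def cofactor_def trace_def sum_3,
      simp add: algebra_simps)

lemma charpoly_reflection_iff: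
  "charpoly M = [:-1, 1:] * [:-1, 1:] * [:-\<xi>, 1:] \<longleftrightarrow>
     det M = \<xi> \<and> trace M = 2 + \<xi> \<and> second_trace M = 1 + 2 * \<xi>"
  by (auto simp: charpoly_eq algebra_simps)

lemma ex_primitive_root_order:
  assumes "\<xi> ^ n = 1" "n > 0"
  shows "\<exists>m. primitive_root m \<xi>"
proof -
  let ?m = "LEAST m. m > 0 \<and> \<xi> ^ m = 1"
  have "?m > 0 \<and> \<xi> ^ ?m = 1" by (rule LeastI[of _ n]) (use assms in simp)
  moreover have "\<xi> ^ j \<noteq> 1" if "0 < j" "j < ?m" for j
    using not_less_Least[OF that(2)] that(1) by blast
  ultimately show ?thesis by (auto simp: primitive_root_def)
qed

text \<open>
  The eigenvalue condition \<open>1, 1, \<xi>\<close> with \<open>\<xi> \<noteq> 1\<close> is stated by the coefficients of the characteristic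
  polynomial, as these are what a trace series determines; necessarily \<open>\<xi> = det M\<close>.
\<close>

definition finite_order_reflection :: "'k::field^3^3 \<Rightarrow> bool" where
  "finite_order_reflection M \<longleftrightarrow> (\<exists>m>0. mat_power M m = mat 1) \<and>
     trace M = 2 + det M \<and> second_trace M = 1 + 2 * det M \<and> det M \<noteq> 1"

definition poly_comp :: "int \<Rightarrow> 'k::field pol3 set" where
  "poly_comp n = {p. \<forall>m\<in>Poly_Mapping.keys p. int (\<Sum>i\<in>UNIV. Poly_Mapping.lookup m i) = n}"

lemma poly_comp_add: "p \<in> poly_comp n \<Longrightarrow> q \<in> poly_comp n \<Longrightarrow> p + q \<in> poly_comp n"
  using keys_add[of p q] by (auto simp: poly_comp_def)

lemma poly_comp_mult: "p \<in> poly_comp m \<Longrightarrow> q \<in> poly_comp n \<Longrightarrow> p * q \<in> poly_comp (m + n)"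
  unfolding poly_comp_def
proof (intro CollectI ballI)
  fix w assume a: "p \<in> {p. \<forall>k\<in>Poly_Mapping.keys p. int (\<Sum>i\<in>UNIV. Poly_Mapping.lookup k i) = m}"
    "q \<in> {p. \<forall>k\<in>Poly_Mapping.keys p. int (\<Sum>i\<in>UNIV. Poly_Mapping.lookup k i) = n}"
    and "w \<in> Poly_Mapping.keys (p * q)"
  then obtain u v where "w = u + v" "u \<in> Poly_Mapping.keys p" "v \<in> Poly_Mapping.keys q"
    using keys_mult[of p q] by blast
  then show "int (\<Sum>i\<in>UNIV. Poly_Mapping.lookup w i) = m + n" using a by (auto simp: lookup_add sum.distrib)
qed

lemma poly_comp_Const: "Const c \<in> poly_comp 0"
  by (auto simp: poly_comp_def Const_def split: if_splits)

lemma poly_comp_0: "0 \<in> poly_comp n"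
  by (simp add: poly_comp_def)

lemma poly_comp_sum: "(\<And>x. x \<in> A \<Longrightarrow> f x \<in> poly_comp n) \<Longrightarrow> sum f A \<in> poly_comp n"
  by (induction A rule: infinite_finite_induct) (auto intro: poly_comp_add poly_comp_0)

lemma poly_comp_X: "X i \<in> poly_comp 1"
proof -
  have "(\<Sum>j\<in>UNIV. Poly_Mapping.lookup (Poly_Mapping.single i (1::nat)) j) = 1"
    by (simp add: lookup_single when_def)
  then show ?thesis by (simp add: poly_comp_def X_def del: of_nat_sum)
qed

lemma poly_comp_power: "p \<in> poly_comp 1 \<Longrightarrow> p ^ k \<in> poly_comp (int k)"
proof (induction k)
  case 0 then show ?case using poly_comp_Const[of 1] by simp
next
  case (Suc k)
  then show ?case using poly_comp_mult[of p 1 "p ^ k" "int k"] by simp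
qed

lemma poly_comp_monomial:
  fixes g :: "3 \<Rightarrow> 'k::field pol3"
  assumes g: "\<And>i. g i \<in> poly_comp 1"
  shows "(\<Prod>i\<in>UNIV. g i ^ Poly_Mapping.lookup m i) \<in> poly_comp (int (\<Sum>i\<in>UNIV. Poly_Mapping.lookup m i))"
proof -
  have "(\<Prod>i\<in>A. g i ^ Poly_Mapping.lookup m i) \<in> poly_comp (int (\<Sum>i\<in>A. Poly_Mapping.lookup m i))"
    if "finite A" for A
    using that
  proof (induction A rule: finite_induct)
    case empty
    show ?case using poly_comp_Const[of 1] by simp
  next
    case (insert i A)
    show ?case
      unfolding prod.insert[OF insert(1,2)] sum.insert[OF insert(1,2)] of_nat_add
      by (rule poly_comp_mult[OF poly_comp_power[OF g] insert(3)])
  qed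
  from this[OF finite_class.finite_UNIV] show ?thesis .
qed

lemma poly_matrix_subst_poly_comp:
  assumes "p \<in> poly_comp n"
  shows "poly_matrix_subst M p \<in> poly_comp n"
proof -
  define g where "g i = (\<Sum>j\<in>UNIV. Const (M $ i $ j) * X j)" for i
  have g: "g i \<in> poly_comp 1" for i
    unfolding g_def using poly_comp_mult[OF poly_comp_Const poly_comp_X]
    by (intro poly_comp_sum) (simp only: add_0)
  have "Const c * (\<Prod>i\<in>UNIV. g i ^ Poly_Mapping.lookup m i) \<in> poly_comp n" if "m \<in> Poly_Mapping.keys p" for c m
  proof -
    have "int (\<Sum>i\<in>UNIV. Poly_Mapping.lookup m i) = n"
      using assms that unfolding poly_comp_def by blast
    then show ?thesis
      using poly_comp_mult[OF poly_comp_Const poly_comp_monomial[of g m, OF g], of c] by (simp only: add_0)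
  qed
  then show ?thesis
    unfolding poly_matrix_subst_def monoid_lift_def g_def[symmetric] by (rule poly_comp_sum)
qed

lemma poly_algebra_simps [simp]:
  "carrier poly_algebra = UNIV" "mult poly_algebra = (*)" "one poly_algebra = 1"
  "zero poly_algebra = 0" "add poly_algebra = (+)" "smult poly_algebra = (\<lambda>c p. Const c * p)"
  "comp poly_algebra = poly_comp"
  by (simp_all add: poly_algebra_def poly_comp_def fun_eq_iff)

lemma finsum_poly_algebra: "finite A \<Longrightarrow> finsum (poly_algebra :: ('k::field, 'k pol3) graded) f A = sum f A"
proof -
  interpret abelian_monoid "poly_algebra :: ('k, 'k pol3) graded"
    by (rule abelian_monoidI) (simp_all add: add_ac)
  show "finite A \<Longrightarrow> finsum (poly_algebra :: ('k::field, 'k pol3) graded) f A = sum f A"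
    by (induction A rule: finite_induct) simp_all
qed

lemma represents_poly_algebra:
  "represents poly_algebra X M \<phi> \<longleftrightarrow> (\<forall>i. \<phi> (X i) = (\<Sum>j\<in>UNIV. Const (M $ i $ j) * X j))"
  by (simp add: represents_def finsum_poly_algebra)

lemma alg_endo_graded_automorphism:
  assumes "\<phi> \<in> graded_automorphisms poly_algebra"
  shows "alg_endo \<phi>"
proof -
  have hom: "\<phi> (p + q) = \<phi> p + \<phi> q" "\<phi> (p * q) = \<phi> p * \<phi> q" "\<phi> 1 = 1" "\<phi> (Const c * p) = Const c * \<phi> p" for p q c
    using assms by (auto simp: graded_automorphisms_def ring_iso_def ring_hom_def)
  moreover have "\<phi> (Const c) = Const c" for c using hom(4)[of c 1] hom(3) by simp
  ultimately show ?thesis by (simp add: alg_endo_def)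
qed

lemma poly_matrix_subst_graded_automorphism:
  assumes m: "m > 0" "mat_power M m = mat 1"
  shows "poly_matrix_subst M \<in> graded_automorphisms poly_algebra"
proof -
  note f = alg_endo_poly_matrix_subst[of M]
  obtain N where NM: "N ** M = mat 1" "M ** N = mat 1" using mat_power_eq_1_inverse[OF m] .
  have inv: "poly_matrix_subst M (poly_matrix_subst N p) = p" "poly_matrix_subst N (poly_matrix_subst M p) = p" for p
    by (simp_all add: poly_matrix_subst_mult NM poly_matrix_subst_1)
  have "bij (poly_matrix_subst M)" by (rule o_bij[of "poly_matrix_subst N"]) (simp_all add: fun_eq_iff inv)
  moreover have "poly_matrix_subst M ` poly_comp n = poly_comp n" for n
  proof
    show "poly_comp n \<subseteq> poly_matrix_subst M ` poly_comp n"
      by (metis image_eqI inv(1) poly_matrix_subst_poly_comp subsetI)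
  qed (auto intro: poly_matrix_subst_poly_comp)
  ultimately show ?thesis
    unfolding graded_automorphisms_def ring_iso_def ring_hom_def
    by (simp add: alg_endoD(1-3,5)[OF f])
qed

section \<open>Poisson reflections\<close>

context symmetric_tensor
begin

definition cubic :: "'k pol3" where
  "cubic = Const (1 / 6) * (\<Sum>i\<in>UNIV. \<Sum>j\<in>UNIV. \<Sum>k\<in>UNIV. Const (T i j k) * (X i * X j * X k))"

lemma pdiff_cubic: "pdiff a cubic = Const (1 / 2) * quad_form X (T a)"
proof -
  have "pdiff a (\<Sum>i\<in>UNIV. \<Sum>j\<in>UNIV. \<Sum>k\<in>UNIV. Const (T i j k) * (X i * X j * X k)) =
      (\<Sum>i\<in>UNIV. \<Sum>j\<in>UNIV. \<Sum>k\<in>UNIV. (if a = i then Const (T i j k) * (X j * X k) else 0)) +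
      (\<Sum>i\<in>UNIV. \<Sum>j\<in>UNIV. \<Sum>k\<in>UNIV. (if a = j then Const (T i j k) * (X i * X k) else 0)) +
      (\<Sum>i\<in>UNIV. \<Sum>j\<in>UNIV. \<Sum>k\<in>UNIV. (if a = k then Const (T i j k) * (X i * X j) else 0))"
  proof -
    have "pdiff a (Const t * (X i * X j * X k)) =
        (if a = i then Const t * (X j * X k) else 0) + (if a = j then Const t * (X i * X k) else 0) +
        (if a = k then Const t * (X i * X j) else 0)" for t :: 'k and i j k
      by (cases "a = i"; cases "a = j"; cases "a = k") (simp_all add: pdiff_mult distrib_left mult_ac)
    then show ?thesis by (simp only: pdiff_sum sum.distrib)
  qed
  also have "(\<Sum>i\<in>UNIV. \<Sum>j\<in>UNIV. \<Sum>k\<in>UNIV. (if a = i then Const (T i j k) * (X j * X k) else 0)) = quad_form X (T a)"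
    using exhaust_3[of a] by (auto simp: sum_3 quad_form_def)
  also have "(\<Sum>i\<in>UNIV. \<Sum>j\<in>UNIV. \<Sum>k\<in>UNIV. (if a = j then Const (T i j k) * (X i * X k) else 0)) = quad_form X (T a)"
  proof -
    have "T i a k = T a i k" for i k by (rule T_sym(1))
    then show ?thesis using exhaust_3[of a] by (auto simp: sum_3 quad_form_def)
  qed
  also have "(\<Sum>i\<in>UNIV. \<Sum>j\<in>UNIV. \<Sum>k\<in>UNIV. (if a = k then Const (T i j k) * (X i * X j) else 0)) = quad_form X (T a)"
  proof -
    have "T i j a = T a i j" for i j by (metis T_sym)
    then show ?thesis using exhaust_3[of a] by (auto simp: sum_3 quad_form_def)
  qed
  finally have "pdiff a cubic = Const (1 / 6) * (quad_form X (T a) + quad_form X (T a) + quad_form X (T a))"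
    by (simp add: cubic_def)
  also have "\<dots> = Const (1 / 6 * 3) * quad_form X (T a)"
    unfolding Const_mult by (simp add: algebra_simps)
  finally show ?thesis by simp
qed

text \<open>
  Both sides are quadratic forms with symmetric coefficients, so that equality of polynomials is
  equality of coefficients.
\<close>

lemma pdiff_cubic_transform_iff:
  "(\<forall>i. poly_matrix_subst M (pdiff i cubic) = (\<Sum>a\<in>UNIV. Const (cofactor M i a) * pdiff a cubic)) \<longleftrightarrow>
     gradient_equivariant M"
proof -
  note f = alg_endo_poly_matrix_subst[of M]
  have "(\<Sum>a\<in>UNIV. Const (cofactor M i a) * pdiff a cubic) =
      Const (1 / 2) * quad_form X (\<lambda>k l. \<Sum>a\<in>UNIV. cofactor M i a * T a k l)" for i
    unfolding pdiff_cubic quad_form_sum[symmetric] sum_distrib_left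
    by (rule sum.cong) (simp_all add: mult.left_commute)
  moreover have "poly_matrix_subst M (pdiff i cubic) =
      Const (1 / 2) * quad_form X (\<lambda>a b. \<Sum>k\<in>UNIV. \<Sum>l\<in>UNIV. T i k l * M $ k $ a * M $ l $ b)" for i
    unfolding pdiff_cubic alg_endoD(2,3)[OF f]
      alg_endo_quad_form[OF f, of X, OF poly_matrix_subst_X] ..
  moreover have "Const (1 / 2) * quad_form X B = Const (1 / 2) * quad_form X B' \<longleftrightarrow> B = B'"
    if "\<And>a b. B a b = B b a" "\<And>a b. B' a b = B' b a" for B B' :: "3 \<Rightarrow> 3 \<Rightarrow> 'k"
    using quad_form_X_symmetric[OF Const_inverse_cancel that, of "1/2"] by auto
  moreover have "(\<Sum>k\<in>UNIV. \<Sum>l\<in>UNIV. T i k l * M $ k $ a * M $ l $ b) =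
      (\<Sum>k\<in>UNIV. \<Sum>l\<in>UNIV. T i k l * M $ k $ b * M $ l $ a)" for i a b
    by (subst sum.swap) (simp add: T_sym(2)[of i] mult_ac)
  moreover have "(\<Sum>j\<in>UNIV. cofactor M i j * T j a b) = (\<Sum>j\<in>UNIV. cofactor M i j * T j b a)" for i a b
    by (simp add: T_sym(2)[of _ a b])
  ultimately show ?thesis unfolding gradient_equivariant_def by (simp add: fun_eq_iff)
qed

text \<open>
  Since \<open>{x\<^sub>i\<^sub>+\<^sub>1, x\<^sub>i\<^sub>+\<^sub>2} = \<partial>\<^sub>i \<Omega>\<close>, compatibility with the bracket on generators is exactly equivariance
  of the gradient; for a matrix of finite order, \<open>det M\<close> is a root of unity and hence primitive of
  some order.
\<close>

theorem matrices_poisson_reflections: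
  "matrices poly_algebra X (poisson_reflections cubic) = {M. gradient_equivariant M \<and> finite_order_reflection M}"
proof (rule Set.set_eqI, rule iffI)
  fix M assume "M \<in> matrices poly_algebra X (poisson_reflections cubic)"
  then obtain \<phi> where \<phi>: "\<phi> \<in> poisson_reflections cubic" and M: "\<And>i. \<phi> (X i) = (\<Sum>j\<in>UNIV. Const (M $ i $ j) * X j)"
    by (auto simp: matrices_def represents_poly_algebra)
  have aut: "\<phi> \<in> graded_automorphisms poly_algebra" and br: "\<And>p q. \<phi> (pbracket cubic p q) = pbracket cubic (\<phi> p) (\<phi> q)"
    and fin: "finite_order poly_algebra \<phi>"
    using \<phi> by (auto simp: poisson_reflections_def)
  obtain M' m \<xi> where M': "\<And>i. \<phi> (X i) = (\<Sum>j\<in>UNIV. Const (M' $ i $ j) * X j)" and \<xi>: "\<xi> \<noteq> 1"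
    and cp: "charpoly M' = [:-1, 1:] * [:-1, 1:] * [:-\<xi>, 1:]"
    using \<phi> by (auto simp: poisson_reflections_def represents_poly_algebra)
  have "M' $ i = M $ i" for i
    using linear_form_X_inj[of "\<lambda>j. M' $ i $ j" "\<lambda>j. M $ i $ j"] M[of i] M'[of i]
    by (simp add: vec_eq_iff fun_eq_iff)
  then have "M' = M" by (simp add: vec_eq_iff)
  have eq: "\<phi> = poly_matrix_subst M"
    by (rule pol3_alg_endo_eqI[OF alg_endo_graded_automorphism[OF aut] alg_endo_poly_matrix_subst])
      (simp add: M poly_matrix_subst_X)
  have "poly_matrix_subst M (pdiff i cubic) = (\<Sum>a\<in>UNIV. Const (cofactor M i a) * pdiff a cubic)" for i
  proof -
    have "pbracket \<Omega> (X (i + 1)) (X (i + 2)) = pdiff i \<Omega>" for \<Omega> :: "'k pol3"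
      using exhaust_3[of i] by (auto simp: pbracket_X sum_3 skew_def)
    then have "poly_matrix_subst M (pdiff i cubic) = pbracket cubic (\<phi> (X (i + 1))) (\<phi> (X (i + 2)))"
      using br[of "X (i + 1)" "X (i + 2)"] eq by metis
    also have "\<dots> = (\<Sum>c\<in>UNIV. pdiff c cubic *
        ((\<Sum>j\<in>UNIV. Const (M $ j $ (c + 1)) * (if j = i + 1 then 1 else 0)) *
         (\<Sum>j\<in>UNIV. Const (M $ j $ (c + 2)) * (if j = i + 2 then 1 else 0)) -
         (\<Sum>j\<in>UNIV. Const (M $ j $ (c + 2)) * (if j = i + 1 then 1 else 0)) *
         (\<Sum>j\<in>UNIV. Const (M $ j $ (c + 1)) * (if j = i + 2 then 1 else 0))))"
      unfolding eq pbracket_cyclic pdiff_poly_matrix_subst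
      by (simp add: alg_endoD(4,5)[OF alg_endo_poly_matrix_subst] if_distrib[of "poly_matrix_subst M"] cong: if_cong)
    also have "\<dots> = (\<Sum>a\<in>UNIV. Const (cofactor M i a) * pdiff a cubic)"
      by (rule sum.cong[OF refl])
        (simp add: cofactor_def Const_diff Const_mult if_distrib cong: if_cong; simp add: algebra_simps)
    finally show ?thesis .
  qed
  then have "gradient_equivariant M" using pdiff_cubic_transform_iff by blast
  moreover obtain n where n: "n > 0" "\<And>p. (\<phi> ^^ n) p = p" using fin by (auto simp: finite_order_def)
  have "mat_power M n = mat 1"
  proof -
    have "poly_matrix_subst (mat_power M n) (X i) = poly_matrix_subst (mat 1) (X i)" for i
      using n(2)[of "X i"] unfolding eq poly_matrix_subst_funpow by (simp add: poly_matrix_subst_1)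
    then have "(\<lambda>j. mat_power M n $ i $ j) = (\<lambda>j. mat 1 $ i $ j)" for i
      by (intro linear_form_X_inj) (simp add: poly_matrix_subst_X)
    then show ?thesis by (simp add: vec_eq_iff fun_eq_iff)
  qed
  moreover have "det M = \<xi> \<and> trace M = 2 + \<xi> \<and> second_trace M = 1 + 2 * \<xi>"
    using cp unfolding \<open>M' = M\<close> charpoly_reflection_iff .
  ultimately show "M \<in> {M. gradient_equivariant M \<and> finite_order_reflection M}"
    using n(1) \<xi> by (auto simp: finite_order_reflection_def)
next
  fix M assume "M \<in> {M. gradient_equivariant M \<and> finite_order_reflection M}"
  then have M: "gradient_equivariant M" "finite_order_reflection M" by auto
  then obtain m where m: "m > 0" "mat_power M m = mat 1" by (auto simp: finite_order_reflection_def)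
  have "det M ^ m = 1" using det_mat_power[of M m] m by (simp add: det_I)
  then obtain l where l: "primitive_root l (det M)" using ex_primitive_root_order m by blast
  have rep: "represents poly_algebra X M (poly_matrix_subst M)"
    by (simp add: represents_poly_algebra poly_matrix_subst_X)
  have "charpoly M = [:-1, 1:] * [:-1, 1:] * [:- det M, 1:]"
    unfolding charpoly_reflection_iff using M(2) by (simp add: finite_order_reflection_def)
  then have "\<exists>M' m \<xi>. represents poly_algebra X M' (poly_matrix_subst M) \<and> primitive_root m \<xi> \<and> \<xi> \<noteq> 1 \<and>
        charpoly M' = [:-1, 1:] * [:-1, 1:] * [:-\<xi>, 1:]"
    using rep l M(2) unfolding finite_order_reflection_def by blast
  moreover have "finite_order poly_algebra (poly_matrix_subst M)"
    using m by (auto simp: finite_order_def poly_matrix_subst_funpow poly_matrix_subst_1)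
  moreover have "poly_matrix_subst M (pbracket cubic p q) =
      pbracket cubic (poly_matrix_subst M p) (poly_matrix_subst M q)" for p q
    using pdiff_cubic_transform_iff[of M] M(1) by (intro pbracket_poly_matrix_subst) blast
  ultimately have "poly_matrix_subst M \<in> poisson_reflections cubic"
    unfolding poisson_reflections_def using poly_matrix_subst_graded_automorphism[OF m] by blast
  then show "M \<in> matrices poly_algebra X (poisson_reflections cubic)"
    using rep by (auto simp: matrices_def)
qed

end

section \<open>The quantization as a quotient of the free algebra\<close>

lemma free_algebra_simps [simp]:
  "carrier free_algebra = UNIV" "mult free_algebra = (*)" "one free_algebra = 1"
  "zero free_algebra = 0" "add free_algebra = (+)"
  by (simp_all add: free_algebra_def)

lemma ring_free_algebra: "ring (free_algebra :: 'k::field free3 ring)"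
proof (rule ringI)
  show "abelian_group (free_algebra :: 'k free3 ring)"
  proof (rule abelian_groupI)
    show "\<exists>y\<in>carrier free_algebra. y \<oplus>\<^bsub>free_algebra\<^esub> x = \<zero>\<^bsub>free_algebra\<^esub>" for x :: "'k free3"
      by (rule bexI[of _ "- x"]) simp_all
  qed (simp_all add: add_ac)
  show "monoid (free_algebra :: 'k free3 ring)"
    by (rule monoidI) (simp_all add: mult.assoc)
qed (simp_all add: distrib_left distrib_right)

lemma a_inv_free_algebra: "\<ominus>\<^bsub>free_algebra\<^esub> x = - x"
proof -
  interpret ring "free_algebra :: 'a free3 ring" by (rule ring_free_algebra)
  show ?thesis by (rule minus_equality) simp_all
qed

lemma skew_contraction:
  "(\<Sum>m\<in>UNIV. skew m i j * skew m a b) =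
     (if a = i \<and> b = j then 1 else 0) - (if a = j \<and> b = i then 1 else (0::'k::field))"
proof -
  have "\<forall>i j a b. (\<Sum>m\<in>UNIV. skew m i j * skew m a b) =
     (if a = i \<and> b = j then 1 else 0) - (if a = j \<and> b = i then 1 else (0::'k))"
    unfolding forall_3 sum_3 skew_def by simp
  then show ?thesis by blast
qed

context quantized_cubic
begin

text \<open>
  The coefficients \<open>c k l\<close> of a bracket of generators are not unique, but multiplied with
  anticommutators only the sums \<open>c k l + c l k\<close> matter, and these are determined.
\<close>

lemma quantization_relation_eq:
  assumes c: "pbracket cubic (X i) (X j) = (\<Sum>k\<in>UNIV. \<Sum>l\<in>UNIV. Const (c k l) * (X k * X l))"
  shows "Y i * Y j - Y j * Y i - Const (h / 2) * (\<Sum>k\<in>UNIV. \<Sum>l\<in>UNIV. Const (c k l) * (Y k * Y l + Y l * Y k)) =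
    (\<Sum>m\<in>UNIV. Const (skew m i j) * rel m)"
proof -
  have "quad_form X c = (\<Sum>m\<in>UNIV. Const (skew m i j * (1 / 2)) * quad_form X (T m))"
    using c unfolding quad_form_def[of X c, symmetric] pbracket_X pdiff_cubic
    by (simp only: Const_mult mult.assoc)
  also have "\<dots> = quad_form X (\<lambda>a b. \<Sum>m\<in>UNIV. skew m i j * (1 / 2) * T m a b)"
    by (rule quad_form_sum)
  finally have "c a b + c b a = (\<Sum>m\<in>UNIV. skew m i j * (1 / 2) * T m a b) + (\<Sum>m\<in>UNIV. skew m i j * (1 / 2) * T m b a)" for a b
    by (rule quad_form_X_eq)
  then have cc: "c a b + c b a = (\<Sum>m\<in>UNIV. skew m i j * T m a b)" for a b
    unfolding sum.distrib[symmetric] using T_sym(2)[of _ b a] by (simp add: field_simps)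
  define E where "E i j a b = (if a = i \<and> b = j then 1 else (0::'k))" for i j a b :: 3
  have E: "quad_form Y (E i j) = Y i * Y j" for i j
  proof -
    have "\<forall>i j. quad_form Y (E i j) = Y i * Y j"
      unfolding forall_3 quad_form_def sum_3 E_def by simp
    then show ?thesis by blast
  qed
  have "(\<Sum>k\<in>UNIV. \<Sum>l\<in>UNIV. Const (c k l) * (Y k * Y l + Y l * Y k)) = quad_form Y c + quad_form Y (\<lambda>a b. c b a)"
  proof -
    have "(\<Sum>k\<in>UNIV. \<Sum>l\<in>UNIV. Const (c k l) * (Y l * Y k)) = quad_form Y (\<lambda>a b. c b a)"
      unfolding quad_form_def by (rule sum.swap)
    then show ?thesis by (simp only: distrib_left sum.distrib quad_form_def)
  qed
  also have "\<dots> = quad_form Y (\<lambda>a b. c a b + c b a)"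
    by (simp only: quad_form_def Const_add distrib_right sum.distrib)
  also have "\<dots> = quad_form Y (\<lambda>a b. \<Sum>m\<in>UNIV. skew m i j * T m a b)"
    by (simp only: cc)
  finally have "Y i * Y j - Y j * Y i - Const (h / 2) * (\<Sum>k\<in>UNIV. \<Sum>l\<in>UNIV. Const (c k l) * (Y k * Y l + Y l * Y k)) =
      quad_form Y (E i j) - quad_form Y (E j i) - Const (h / 2) * quad_form Y (\<lambda>a b. \<Sum>m\<in>UNIV. skew m i j * T m a b)"
    by (simp only: E)
  also have "\<dots> = quad_form Y (\<lambda>a b. E i j a b - E j i a b - h / 2 * (\<Sum>m\<in>UNIV. skew m i j * T m a b))"
  proof -
    have "quad_form Y B - quad_form Y B' - Const k * quad_form Y S = quad_form Y (\<lambda>a b. B a b - B' a b - k * S a b)"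
      for B B' S :: "3 \<Rightarrow> 3 \<Rightarrow> 'k" and k
      by (simp only: quad_form_def Const_diff Const_mult left_diff_distrib sum_subtractf sum_distrib_left mult.assoc)
    then show ?thesis .
  qed
  also have "(\<lambda>a b. E i j a b - E j i a b - h / 2 * (\<Sum>m\<in>UNIV. skew m i j * T m a b)) =
      (\<lambda>a b. \<Sum>m\<in>UNIV. skew m i j * (skew m a b - h / 2 * T m a b))"
    unfolding E_def skew_contraction[symmetric]
    by (simp only: right_diff_distrib sum_subtractf sum_distrib_left mult.left_commute)
  also have "quad_form Y \<dots> = (\<Sum>m\<in>UNIV. Const (skew m i j) * rel m)"
    unfolding rel_def by (rule quad_form_sum[symmetric])
  finally show ?thesis .
qed

lemma quantization_relations_eq:
  "quantization_relations cubic h = {\<Sum>m\<in>UNIV. Const (skew m i j) * rel m | i j. True}"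
proof -
  have "\<exists>c. pbracket cubic (X i) (X j) = (\<Sum>k\<in>UNIV. \<Sum>l\<in>UNIV. Const (c k l) * (X k * X l))" for i j
  proof -
    have "pbracket cubic (X i) (X j) = (\<Sum>m\<in>UNIV. Const (skew m i j * (1 / 2)) * quad_form X (T m))"
      unfolding pbracket_X pdiff_cubic by (simp only: Const_mult mult.assoc)
    also have "\<dots> = quad_form X (\<lambda>a b. \<Sum>m\<in>UNIV. skew m i j * (1 / 2) * T m a b)"
      by (rule quad_form_sum)
    finally show ?thesis
      unfolding quad_form_def by (rule exI[of _ "\<lambda>a b. \<Sum>m\<in>UNIV. skew m i j * (1 / 2) * T m a b"])
  qed
  note ex = this
  show ?thesis
  proof (rule equalityI; rule subsetI)
    fix r assume "r \<in> quantization_relations cubic h"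
    then obtain i j c where r: "r = Y i * Y j - Y j * Y i -
        Const (h / 2) * (\<Sum>k\<in>UNIV. \<Sum>l\<in>UNIV. Const (c k l) * (Y k * Y l + Y l * Y k))"
      and c: "pbracket cubic (X i) (X j) = (\<Sum>k\<in>UNIV. \<Sum>l\<in>UNIV. Const (c k l) * (X k * X l))"
      unfolding quantization_relations_def by blast
    show "r \<in> {\<Sum>m\<in>UNIV. Const (skew m i j) * rel m | i j. True}"
      unfolding r quantization_relation_eq[OF c] by blast
  next
    fix r assume "r \<in> {\<Sum>m\<in>UNIV. Const (skew m i j) * rel m | i j. True}"
    then obtain i j where r: "r = (\<Sum>m\<in>UNIV. Const (skew m i j) * rel m)" by blast
    obtain c where c: "pbracket cubic (X i) (X j) = (\<Sum>k\<in>UNIV. \<Sum>l\<in>UNIV. Const (c k l) * (X k * X l))"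
      using ex by blast
    show "r \<in> quantization_relations cubic h"
      unfolding r quantization_relation_eq[OF c, symmetric] quantization_relations_def using c by blast
  qed
qed

lemma rel_in_quantization_relations: "rel i \<in> quantization_relations cubic h"
proof -
  have "rel i = (\<Sum>m\<in>UNIV. Const (skew m (i + 1) (i + 2)) * rel m)"
    using exhaust_3[of i] by (auto simp: sum_3 skew_def)
  then show ?thesis unfolding quantization_relations_eq by blast
qed

text \<open>
  The defining ideal is described by its homogeneous components, which makes membership of
  homogeneous elements a matter of \<open>ideal_comp\<close>.
\<close>

definition graded_ideal :: "'k free3 set" where
  "graded_ideal = {p. \<forall>n. free_part n p \<in> ideal_comp n}"

lemma subspace_graded_ideal: "fa.subspace graded_ideal"
  by (rule fa.subspaceI)
    (auto simp: graded_ideal_def intro: fa.subspace_0 fa.subspace_add fa.subspace_scale subspace_ideal_comp)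

lemma ideal_comp_subset_graded_ideal: "ideal_comp n \<subseteq> graded_ideal"
proof
  fix p assume p: "p \<in> ideal_comp n"
  then have "p \<in> free_comp n" using ideal_comp_subset by blast
  then show "p \<in> graded_ideal"
    using p fa.subspace_0[OF subspace_ideal_comp] by (simp add: graded_ideal_def free_part_free_comp)
qed

lemma graded_ideal_free_comp: "p \<in> graded_ideal \<Longrightarrow> p \<in> free_comp n \<Longrightarrow> p \<in> ideal_comp n"
  by (auto simp: graded_ideal_def free_part_free_comp split: if_splits dest!: spec[of _ n])

lemma graded_ideal_Y_mult: "p \<in> graded_ideal \<Longrightarrow> Y i * p \<in> graded_ideal"
  unfolding graded_ideal_def
proof (intro CollectI allI)
  fix n assume "p \<in> {p. \<forall>n. free_part n p \<in> ideal_comp n}"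
  then show "free_part n (Y i * p) \<in> ideal_comp n"
    by (cases n) (auto simp: free_part_Y_mult ideal_comp_left_Y)
qed

lemma graded_ideal_mult_Y: "p \<in> graded_ideal \<Longrightarrow> p * Y i \<in> graded_ideal"
  unfolding graded_ideal_def
proof (intro CollectI allI)
  fix n assume "p \<in> {p. \<forall>n. free_part n p \<in> ideal_comp n}"
  then show "free_part n (p * Y i) \<in> ideal_comp n"
    by (cases n) (auto simp: free_part_mult_Y ideal_comp_right_Y)
qed

lemma graded_ideal_mult_left: "p \<in> graded_ideal \<Longrightarrow> q * p \<in> graded_ideal"
proof (induction q rule: poly_mapping_single_induct)
  case (single w c)
  have "Poly_Mapping.single (Word v) c * p \<in> graded_ideal" for v
    by (induction v)
      (simp_all add: single_Nil single_Cons mult.assoc fa.subspace_scale[OF subspace_graded_ideal] single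
        graded_ideal_Y_mult)
  then show ?case by (cases w) simp
qed (simp add: distrib_right fa.subspace_add[OF subspace_graded_ideal])

lemma graded_ideal_mult_right: "p \<in> graded_ideal \<Longrightarrow> p * q \<in> graded_ideal"
proof (induction q rule: poly_mapping_single_induct)
  case (single w c)
  have "p * Poly_Mapping.single (Word v) c \<in> graded_ideal" for v
    by (induction v rule: rev_induct)
      (simp_all add: single_Nil single_snoc mult.assoc[symmetric] Const_commute
        fa.subspace_scale[OF subspace_graded_ideal] single graded_ideal_mult_Y)
  then show ?case by (cases w) simp
qed (simp add: distrib_left fa.subspace_add[OF subspace_graded_ideal])

lemma ideal_graded_ideal: "ideal graded_ideal free_algebra"
proof (rule idealI[OF ring_free_algebra])
  show "subgroup graded_ideal (add_monoid free_algebra)"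
  proof (rule subgroup.intro)
    fix x assume "x \<in> graded_ideal"
    then have "- x \<in> graded_ideal" using fa.subspace_neg[OF subspace_graded_ideal] by blast
    then show "inv\<^bsub>add_monoid free_algebra\<^esub> x \<in> graded_ideal"
      using a_inv_free_algebra[of x] by (simp add: a_inv_def)
  qed (simp_all add: fa.subspace_0[OF subspace_graded_ideal] fa.subspace_add[OF subspace_graded_ideal])
qed (simp_all add: graded_ideal_mult_left graded_ideal_mult_right)

lemma rel_in_ideal_comp: "rel i \<in> ideal_comp (Suc (Suc 0))"
proof -
  have "1 * rel i \<in> right_span (free_comp 0) rel"
    using mult_in_right_span[OF subspace_free_comp, of "1" 0 rel i] Const_in[of 1] by simp
  then show ?thesis using right_span_rel_subset[of 0] by auto
qed

lemma quantization_ideal_eq: "quantization_ideal cubic h = graded_ideal"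
proof
  interpret ring "free_algebra :: 'k free3 ring" by (rule ring_free_algebra)
  have rels: "quantization_relations cubic h \<subseteq> graded_ideal"
  proof -
    have "(\<Sum>m\<in>UNIV. Const (skew m i j) * rel m) \<in> graded_ideal" for i j
      using rel_in_ideal_comp ideal_comp_subset_graded_ideal
      by (intro fa.subspace_sum fa.subspace_scale subspace_graded_ideal) blast
    then show ?thesis unfolding quantization_relations_eq by blast
  qed
  show "quantization_ideal cubic h \<subseteq> graded_ideal"
    unfolding quantization_ideal_def by (rule genideal_minimal[OF ideal_graded_ideal rels])
  have id: "ideal (quantization_ideal cubic h) free_algebra"
    unfolding quantization_ideal_def by (rule genideal_ideal) simp
  have rel: "rel i \<in> quantization_ideal cubic h" for i
    using genideal_self[of "quantization_relations cubic h"] rel_in_quantization_relations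
    unfolding quantization_ideal_def by auto
  have add: "x + y \<in> quantization_ideal cubic h"
    if "x \<in> quantization_ideal cubic h" "y \<in> quantization_ideal cubic h" for x y
    using additive_subgroup.a_closed[OF ideal.axioms(1)[OF id] that] by simp
  have zero: "0 \<in> quantization_ideal cubic h"
    using additive_subgroup.zero_closed[OF ideal.axioms(1)[OF id]] by simp
  have sum: "sum f A \<in> quantization_ideal cubic h" if "\<And>x. x \<in> A \<Longrightarrow> f x \<in> quantization_ideal cubic h"
    for f and A :: "'b set"
    using that by (induction A rule: infinite_finite_induct) (auto intro: add zero)
  have l: "q * x \<in> quantization_ideal cubic h" and r: "x * q \<in> quantization_ideal cubic h"
    if "x \<in> quantization_ideal cubic h" for x q
    using ideal.I_l_closed[OF id that] ideal.I_r_closed[OF id that] by simp_all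
  have comp: "ideal_comp n \<subseteq> quantization_ideal cubic h" for n
  proof (induction n rule: ideal_comp.induct)
    case (3 n)
    have "x \<in> quantization_ideal cubic h" if x: "x \<in> right_span (ideal_comp (Suc n)) Y" for x
    proof -
      obtain u where u: "\<And>k. u k \<in> ideal_comp (Suc n)" "x = (\<Sum>k\<in>UNIV. u k * Y k)"
        using right_spanE[OF x] by blast
      then show ?thesis using 3 by (auto intro!: sum r)
    qed
    moreover have "y \<in> quantization_ideal cubic h" if y: "y \<in> right_span (free_comp n) rel" for y
    proof -
      obtain u where u: "\<And>k. u k \<in> free_comp n" "y = (\<Sum>k\<in>UNIV. u k * rel k)"
        using right_spanE[OF y] by blast
      then show ?thesis by (auto intro!: sum l rel)
    qed
    ultimately show ?case by (auto intro: add)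
  qed (simp_all add: zero)
  show "graded_ideal \<subseteq> quantization_ideal cubic h"
  proof
    fix p assume p: "p \<in> graded_ideal"
    obtain N where "p = (\<Sum>n<N. free_part n p)" using sum_free_parts by blast
    moreover have "(\<Sum>n<N. free_part n p) \<in> quantization_ideal cubic h"
      using p comp unfolding graded_ideal_def by (intro sum) blast
    ultimately show "p \<in> quantization_ideal cubic h" by simp
  qed
qed

abbreviation A :: "('k, 'k free3 set) graded" where
  "A \<equiv> quantization cubic h"

abbreviation proj :: "'k free3 \<Rightarrow> 'k free3 set" where
  "proj \<equiv> to_quantization cubic h"

lemma proj_eq_iff: "proj p = proj q \<longleftrightarrow> p - q \<in> graded_ideal"
proof -
  have eq: "proj p = (\<lambda>i. i + p) ` graded_ideal" for p
    by (auto simp: to_quantization_def quantization_ideal_eq a_r_coset_def')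
  show ?thesis
  proof
    assume "proj p = proj q"
    moreover have "p \<in> proj p" unfolding eq using fa.subspace_0[OF subspace_graded_ideal] by (metis add_0 image_eqI)
    ultimately obtain i where "i \<in> graded_ideal" "p = i + q" unfolding eq by auto
    then show "p - q \<in> graded_ideal" by simp
  next
    assume pq: "p - q \<in> graded_ideal"
    have "(\<lambda>i. i + p) ` graded_ideal \<subseteq> (\<lambda>i. i + q) ` graded_ideal" if "p - q \<in> graded_ideal" for p q
    proof
      fix x assume "x \<in> (\<lambda>i. i + p) ` graded_ideal"
      then obtain i where "i \<in> graded_ideal" "x = i + p" by auto
      then have "x = (i + (p - q)) + q" "i + (p - q) \<in> graded_ideal"
        using fa.subspace_add[OF subspace_graded_ideal _ that] by auto
      then show "x \<in> (\<lambda>i. i + q) ` graded_ideal" by blast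
    qed
    from this[OF pq] this[of q p] fa.subspace_neg[OF subspace_graded_ideal pq]
    show "proj p = proj q" unfolding eq by auto
  qed
qed

lemma quantization_simps:
  "carrier A = range proj" "mult A (proj p) (proj q) = proj (p * q)" "one A = proj 1"
  "zero A = proj 0" "add A (proj p) (proj q) = proj (p + q)" "smult A c (proj p) = proj (Const c * p)"
  "comp A (int n) = proj ` free_comp n"
proof -
  interpret ideal "quantization_ideal cubic h" "free_algebra :: 'k free3 ring"
    unfolding quantization_ideal_eq by (rule ideal_graded_ideal)
  show "carrier A = range proj"
    by (auto simp: quantization_def Let_def FactRing_def A_RCOSETS_def' to_quantization_def)
  show mult: "mult A (proj p) (proj q) = proj (p * q)" for p q
    using ring_hom_mult[OF rcos_ring_hom, of p q]
    by (simp add: quantization_def Let_def to_quantization_def)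
  show "add A (proj p) (proj q) = proj (p + q)"
    using ring_hom_add[OF rcos_ring_hom, of p q]
    by (simp add: quantization_def Let_def to_quantization_def)
  show "one A = proj 1"
    by (simp add: quantization_def Let_def FactRing_def to_quantization_def)
  have "proj 0 = quantization_ideal cubic h"
    by (auto simp: to_quantization_def a_r_coset_def')
  then show "zero A = proj 0"
    by (simp add: quantization_def Let_def FactRing_def)
  show "smult A c (proj p) = proj (Const c * p)"
    using mult[of "Const c" p] by (simp add: quantization_def Let_def)
  show "comp A (int n) = proj ` free_comp n"
    by (simp add: quantization_def Let_def free_comp_def)
qed

lemma comp_negative: "n < 0 \<Longrightarrow> comp A n = {proj 0}"
proof -
  assume "n < 0"
  then have "{p :: 'k free3. \<forall>w\<in>Poly_Mapping.keys p. int (length (letters w)) = n} = {0}"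
    by (auto simp flip: keys_eq_empty)
  then show ?thesis by (simp add: quantization_def Let_def)
qed

lemma proj_eq_0_iff: "proj p = proj 0 \<longleftrightarrow> p \<in> graded_ideal"
  by (simp add: proj_eq_iff)

lemma abelian_group_quantization: "abelian_group A"
proof (rule abelian_groupI)
  fix x assume "x \<in> carrier A"
  then obtain p where p: "x = proj p" by (auto simp: quantization_simps)
  show "\<exists>y\<in>carrier A. y \<oplus>\<^bsub>A\<^esub> x = \<zero>\<^bsub>A\<^esub>"
    by (rule bexI[of _ "proj (- p)"]) (simp_all add: quantization_simps p)
qed (auto simp: quantization_simps add_ac)

lemma finsum_quantization:
  assumes "finite S" "\<And>x. x \<in> S \<Longrightarrow> f x = proj (g x)"
  shows "finsum A f S = proj (sum g S)"
proof -
  interpret abelian_group A by (rule abelian_group_quantization)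
  show ?thesis using assms
    by (induction S rule: finite_induct) (simp_all add: Pi_def quantization_simps)
qed

lemma lin_comb_quantization:
  assumes "finite B" "\<And>b. b \<in> B \<Longrightarrow> proj (\<rho> b) = b"
  shows "lin_comb A B c = proj (\<Sum>b\<in>B. Const (c b) * \<rho> b)"
  unfolding lin_comb_def
  by (rule finsum_quantization[OF assms(1)]) (metis assms(2) quantization_simps(6))

end

section \<open>Traces on the quantization\<close>

lemma Abs_fps_third_order:
  fixes a :: "nat \<Rightarrow> 'k::field"
  assumes "a 0 = 1" "a 1 = t" "a 2 = t * a 1 - s"
    and "\<And>n. a (n + 3) = t * a (n + 2) - s * a (n + 1) + d * a n"
  shows "Abs_fps a = inverse (fps_of_poly [:1, - t, s, - d:])"
proof (rule fps_inverse_unique[symmetric])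
  have D: "fps_of_poly [:1, - t, s, - d:] =
      1 - fps_const t * fps_X + fps_const s * (fps_X * fps_X) - fps_const d * (fps_X * (fps_X * fps_X))"
    by (simp add: fps_of_poly_pCons algebra_simps)
  show "fps_of_poly [:1, - t, s, - d:] * Abs_fps a = 1"
  proof (rule fps_ext)
    fix n :: nat
    consider "n = 0" | "n = 1" | "n = 2" | m where "n = m + 3"
    proof -
      have "n = 0 \<or> n = 1 \<or> n = 2 \<or> n = (n - 3) + 3" by linarith
      then show ?thesis using that by blast
    qed
    then show "fps_nth (fps_of_poly [:1, - t, s, - d:] * Abs_fps a) n = fps_nth 1 n"
      by cases
        (use assms in \<open>simp_all add: D left_diff_distrib distrib_right mult.assoc numeral_2_eq_2 numeral_3_eq_3\<close>)
  qed
qed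

lemma inverse_one_minus_X_cubed:
  "inverse ((1 - fps_X) ^ 3) = Abs_fps (\<lambda>n. of_nat (n + 2 choose 2) :: rat)"
proof -
  define c where "c n = (of_nat (n + 2 choose 2) :: rat)" for n
  have c: "c n = (of_nat n + 2) * (of_nat n + 1) / 2" for n
  proof -
    have "2 * (n + 2 choose 2) = (n + 2) * (n + 1)" by (simp add: choose_two)
    then have "of_nat (2 * (n + 2 choose 2)) = (of_nat ((n + 2) * (n + 1)) :: rat)" by (simp only:)
    then show ?thesis by (simp only: of_nat_mult of_nat_add of_nat_numeral of_nat_1 c_def)
  qed
  have "Abs_fps c = inverse (fps_of_poly [:1, - 3, 3, - 1:])"
    by (rule Abs_fps_third_order) (simp_all add: c field_simps)
  also have "fps_of_poly [:1, - 3, 3, - 1:] = (1 - fps_X :: rat fps) ^ 3"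
    by (simp add: fps_of_poly_pCons power3_eq_cube algebra_simps)
  finally show ?thesis by (simp add: c_def)
qed

lemma lin_basis_SOME: "\<exists>B. lin_basis A E B \<Longrightarrow> lin_basis A E (SOME B. lin_basis A E B)"
  by (rule someI_ex)

context quantized_cubic
begin

text \<open>
  Elements of the quotient are residue classes, in a space without ambient vector space type.
  Replacing a basis of \<open>F\<^sub>n / J\<^sub>n\<close> by representatives relates its dimension and traces to those of
  subspaces of the free algebra.
\<close>

lemma lift_lin_basis:
  assumes B: "lin_basis A (comp A (int n)) B" and C: "fa.finite_basis (ideal_comp n) C"
  shows "\<exists>\<rho>. (\<forall>b\<in>B. \<rho> b \<in> free_comp n \<and> proj (\<rho> b) = b) \<and>
    inj_on (case_sum \<rho> (\<lambda>c. c)) (B <+> C) \<and>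
    fa.finite_basis (free_comp n) (case_sum \<rho> (\<lambda>c. c) ` (B <+> C))"
proof -
  note B' = B[unfolded lin_basis_def quantization_simps(7)]
  have finB: "finite B" and BE: "B \<subseteq> proj ` free_comp n" using B' by simp_all
  have uniq: "\<exists>!c. c \<in> B \<rightarrow>\<^sub>E UNIV \<and> v = lin_comb A B c" if "v \<in> proj ` free_comp n" for v
    using B'[THEN conjunct2, THEN conjunct2] that by (rule bspec)
  note c = fa.finite_basisD[OF C]
  have "\<forall>b\<in>B. \<exists>p. p \<in> free_comp n \<and> proj p = b" using BE by blast
  then obtain \<rho> where \<rho>: "\<And>b. b \<in> B \<Longrightarrow> \<rho> b \<in> free_comp n" "\<And>b. b \<in> B \<Longrightarrow> proj (\<rho> b) = b"
    by metis
  have lc: "lin_comb A B f = proj (\<Sum>b\<in>B. Const (f b) * \<rho> b)" for f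
    by (rule lin_comb_quantization[OF finB]) (rule \<rho>(2))
  let ?v = "case_sum \<rho> (\<lambda>c. c)"
  have sum: "(\<Sum>x\<in>B <+> C. Const (a x) * ?v x) =
      (\<Sum>b\<in>B. Const (a (Inl b)) * \<rho> b) + (\<Sum>c\<in>C. Const (a (Inr c)) * c)" for a
    using finB c(1) by (simp add: sum.Plus comp_def)
  have inC: "(\<Sum>c\<in>C. Const (f c) * c) \<in> ideal_comp n" for f
    using c(5) by (intro fa.subspace_sum fa.subspace_scale c(4)) blast
  have ind: "\<forall>x\<in>B <+> C. a x = 0" if 0: "(\<Sum>x\<in>B <+> C. Const (a x) * ?v x) = 0" for a
  proof -
    let ?p = "\<Sum>b\<in>B. Const (a (Inl b)) * \<rho> b"
    have "?p = - (\<Sum>c\<in>C. Const (a (Inr c)) * c)" using 0 unfolding sum by (simp add: eq_neg_iff_add_eq_0)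
    then have "?p \<in> ideal_comp n" using fa.subspace_neg[OF c(4) inC] by simp
    then have "proj ?p = proj 0" using ideal_comp_subset_graded_ideal proj_eq_0_iff by blast
    then have a0: "proj 0 = lin_comb A B (restrict (\<lambda>b. a (Inl b)) B)"
      unfolding lc by (simp cong: sum.cong)
    have "proj 0 \<in> proj ` free_comp n" using fa.subspace_0[OF subspace_free_comp] by blast
    moreover have "proj 0 = lin_comb A B (restrict (\<lambda>b. 0) B)" unfolding lc by (simp cong: sum.cong)
    moreover have "restrict f B \<in> B \<rightarrow>\<^sub>E UNIV" for f :: "'k free3 set \<Rightarrow> 'k" by simp
    ultimately have "restrict (\<lambda>b. a (Inl b)) B = restrict (\<lambda>b. 0) B"
      using uniq[of "proj 0"] a0 by blast
    then have aB: "a (Inl b) = 0" if "b \<in> B" for b using that by (metis restrict_apply')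
    then have "(\<Sum>c\<in>C. Const (a (Inr c)) * c) = 0" using 0 unfolding sum by simp
    then have "a (Inr x) = 0" if "x \<in> C" for x
      using fa.independentD[OF c(2) c(1) subset_refl _ that, of "\<lambda>c. a (Inr c)"] by simp
    with aB show ?thesis by auto
  qed
  have sp: "\<exists>a. p = (\<Sum>x\<in>B <+> C. Const (a x) * ?v x)" if p: "p \<in> free_comp n" for p
  proof -
    obtain f where f: "proj p = lin_comb A B f" using uniq[of "proj p"] p by blast
    let ?q = "\<Sum>b\<in>B. Const (f b) * \<rho> b"
    have "p - ?q \<in> graded_ideal" using f unfolding lc proj_eq_iff .
    moreover have "?q \<in> free_comp n" by (intro fa.subspace_sum fa.subspace_scale subspace_free_comp \<rho>)
    ultimately have "p - ?q \<in> ideal_comp n"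
      using p by (auto intro!: graded_ideal_free_comp fa.subspace_diff[OF subspace_free_comp])
    then have "p - ?q = (\<Sum>c\<in>C. Const (fa.representation C (p - ?q) c) * c)"
      using fa.sum_representation_eq[of C "p - ?q" C] c by simp
    then have "p = (\<Sum>x\<in>B <+> C. Const (case_sum f (fa.representation C (p - ?q)) x) * ?v x)"
      unfolding sum by (simp add: algebra_simps)
    then show ?thesis by (rule exI[of _ "case_sum f (fa.representation C (p - ?q))"])
  qed
  have "?v ` (B <+> C) \<subseteq> free_comp n"
    using \<rho>(1) c(5) ideal_comp_subset[of n] by auto
  from fa.finite_basis_family[of "B <+> C" ?v "free_comp n", OF _ _ subspace_free_comp this]
  have "inj_on ?v (B <+> C)" "fa.finite_basis (free_comp n) (?v ` (B <+> C))"
    using finB c(1) ind sp by auto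
  with \<rho> show ?thesis by (intro exI[of _ \<rho>]) simp
qed

lemma card_lin_basis:
  assumes B: "lin_basis A (comp A (int n)) B" and C: "fa.finite_basis (ideal_comp n) C"
  shows "card C + card B = 3 ^ n"
proof -
  obtain \<rho> where \<rho>': "(\<forall>b\<in>B. \<rho> b \<in> free_comp n \<and> proj (\<rho> b) = b) \<and>
      inj_on (case_sum \<rho> (\<lambda>c. c)) (B <+> C) \<and>
      fa.finite_basis (free_comp n) (case_sum \<rho> (\<lambda>c. c) ` (B <+> C))"
    by (rule exE[OF lift_lin_basis[OF B C]])
  have \<rho>: "inj_on (case_sum \<rho> (\<lambda>c. c)) (B <+> C)"
    "fa.finite_basis (free_comp n) (case_sum \<rho> (\<lambda>c. c) ` (B <+> C))"
    using \<rho>' by simp_all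
  have "finite B" using B by (simp add: lin_basis_def)
  have "of_nat (card (B <+> C)) = (3 ^ n :: 'k)"
  proof -
    have "of_nat (card (case_sum \<rho> (\<lambda>c. c) ` (B <+> C))) = free_trace (mat 1 :: 'k^3^3) n"
      unfolding trace_on_free_matrix_subst_1 by (rule fa.trace_on_id[OF \<rho>(2), symmetric])
    then show ?thesis unfolding free_trace_1 card_image[OF \<rho>(1)] .
  qed
  then have "of_nat (card (B <+> C)) = (of_nat (3 ^ n) :: 'k)" by simp
  then have "card (B <+> C) = 3 ^ n" by (simp only: of_nat_eq_iff)
  then show ?thesis using \<open>finite B\<close> fa.finite_basisD(1)[OF C] by (simp add: card_Plus)
qed

text \<open>
  In a basis as in \<open>lift_lin_basis\<close> the substitution is block triangular, because it preserves \<open>J\<^sub>n\<close>;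
  its diagonal blocks are its actions on \<open>F\<^sub>n / J\<^sub>n\<close> and on \<open>J\<^sub>n\<close>.
\<close>

lemma lin_trace_quantization:
  assumes basis: "\<exists>B. lin_basis A (comp A (int n)) B"
    and M: "gradient_equivariant M" and \<phi>: "\<And>p. \<phi> (proj p) = proj (free_matrix_subst M p)"
  shows "lin_trace A (comp A (int n)) \<phi> =
    fa.trace_on (free_comp n) (free_matrix_subst M) - fa.trace_on (ideal_comp n) (free_matrix_subst M)"
proof -
  let ?f = "free_matrix_subst M"
  define B where "B = (SOME B. lin_basis A (comp A (int n)) B)"
  have B: "lin_basis A (comp A (int n)) B" unfolding B_def by (rule lin_basis_SOME[OF basis])
  obtain C where C: "fa.finite_basis (ideal_comp n) C" using fin_dim_ideal_comp by (auto simp: fa.fin_dim_def)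
  note c = fa.finite_basisD[OF C]
  note B' = B[unfolded lin_basis_def quantization_simps(7)]
  have finB: "finite B" using B' by simp
  have uniq: "\<exists>!c. c \<in> B \<rightarrow>\<^sub>E UNIV \<and> v = lin_comb A B c" if "v \<in> proj ` free_comp n" for v
    using B'[THEN conjunct2, THEN conjunct2] that by (rule bspec)
  obtain \<rho> where \<rho>': "(\<forall>b\<in>B. \<rho> b \<in> free_comp n \<and> proj (\<rho> b) = b) \<and>
      inj_on (case_sum \<rho> (\<lambda>c. c)) (B <+> C) \<and>
      fa.finite_basis (free_comp n) (case_sum \<rho> (\<lambda>c. c) ` (B <+> C))"
    by (rule exE[OF lift_lin_basis[OF B C]])
  have \<rho>: "\<And>b. b \<in> B \<Longrightarrow> \<rho> b \<in> free_comp n" "\<And>b. b \<in> B \<Longrightarrow> proj (\<rho> b) = b"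
    "inj_on (case_sum \<rho> (\<lambda>c. c)) (B <+> C)"
    "fa.finite_basis (free_comp n) (case_sum \<rho> (\<lambda>c. c) ` (B <+> C))"
    using \<rho>' by simp_all
  let ?v = "case_sum \<rho> (\<lambda>c. c)"
  have lc: "lin_comb A B f = proj (\<Sum>b\<in>B. Const (f b) * \<rho> b)" for f
    by (rule lin_comb_quantization[OF finB]) (rule \<rho>(2))
  define g where "g b = (THE c. c \<in> B \<rightarrow>\<^sub>E UNIV \<and> \<phi> b = lin_comb A B c)" for b
  define r where "r b = ?f (\<rho> b) - (\<Sum>x\<in>B. Const (g b x) * \<rho> x)" for b
  have r: "r b \<in> ideal_comp n" if b: "b \<in> B" for b
  proof -
    have fb: "?f (\<rho> b) \<in> free_comp n" using image_free_comp \<rho>(1)[OF b] by blast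
    have \<phi>b: "\<phi> b = proj (?f (\<rho> b))" using \<phi>[of "\<rho> b"] \<rho>(2)[OF b] by simp
    then have "\<exists>!c. c \<in> B \<rightarrow>\<^sub>E UNIV \<and> \<phi> b = lin_comb A B c" using uniq fb by simp
    from theI'[OF this] have "\<phi> b = lin_comb A B (g b)" unfolding g_def by blast
    then have "r b \<in> graded_ideal" unfolding \<phi>b lc proj_eq_iff r_def .
    moreover have "(\<Sum>x\<in>B. Const (g b x) * \<rho> x) \<in> free_comp n"
      by (intro fa.subspace_sum fa.subspace_scale subspace_free_comp \<rho>)
    ultimately show ?thesis
      using fb unfolding r_def by (auto intro!: graded_ideal_free_comp fa.subspace_diff[OF subspace_free_comp])
  qed
  let ?rep = "fa.representation C"
  have expand: "(\<Sum>c\<in>C. Const (?rep p c) * c) = p" if "p \<in> ideal_comp n" for p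
    using fa.sum_representation_eq[of C p C] c that by simp
  \<comment> \<open>The block triangular matrix of the substitution in the combined basis.\<close>
  define K where "K x y = (case x of
      Inl b \<Rightarrow> (case y of Inl b' \<Rightarrow> g b b' | Inr c' \<Rightarrow> ?rep (r b) c')
    | Inr c \<Rightarrow> (case y of Inl b' \<Rightarrow> 0 | Inr c' \<Rightarrow> ?rep (?f c) c'))" for x y
  have "fa.trace_on (free_comp n) ?f = (\<Sum>x\<in>B <+> C. K x x)"
  proof (rule fa.trace_on_family[OF _ \<rho>(3,4) linear_alg_endo[OF alg_endo_free_matrix_subst], where C = K])
    show "finite (B <+> C)" using finB c(1) by simp
    fix x assume "x \<in> B <+> C"
    then show "?f (?v x) = (\<Sum>y\<in>B <+> C. Const (K x y) * ?v y)"
    proof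
      fix b assume b: "x = Inl b" "b \<in> B"
      have "?f (\<rho> b) = (\<Sum>y\<in>B. Const (g b y) * \<rho> y) + r b" by (simp add: r_def)
      then show ?thesis using finB c(1) by (simp add: b sum.Plus comp_def K_def expand[OF r[OF b(2)]])
    next
      fix d assume d: "x = Inr d" "d \<in> C"
      have "?f d \<in> ideal_comp n" using image_ideal_comp[OF M] c(5) d(2) by blast
      then show ?thesis using finB c(1) by (simp add: d sum.Plus comp_def K_def expand)
    qed
  qed
  also have "\<dots> = (\<Sum>b\<in>B. g b b) + (\<Sum>c\<in>C. ?rep (?f c) c)"
    using finB c(1) by (simp add: sum.Plus comp_def K_def)
  also have "(\<Sum>c\<in>C. ?rep (?f c) c) = fa.trace_on (ideal_comp n) ?f"
    by (rule fa.trace_on_basis[OF C linear_alg_endo[OF alg_endo_free_matrix_subst] image_ideal_comp[OF M], symmetric])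
  also have "(\<Sum>b\<in>B. g b b) = lin_trace A (comp A (int n)) \<phi>"
    by (simp add: lin_trace_def B_def[symmetric] Let_def g_def)
  finally show ?thesis by simp
qed

text \<open>
  The ideal starts in degree two, so a letter is nonzero in the quotient and there, in a domain,
  it can be cancelled.
\<close>

lemma quantized_cubic_domain_if_quantum_polynomial_ring:
  assumes q: "quantum_polynomial_ring A"
  shows "quantized_cubic_domain T h"
proof
  have hs: "has_hilbert_series A (inverse ((1 - fps_X) ^ 3))"
    using q unfolding quantum_polynomial_ring_def by (elim conjE)
  fix n
  have ex: "\<exists>B. lin_basis A (comp A (int n)) B" using hs by (simp add: has_hilbert_series_def)
  obtain C where C: "fa.finite_basis (ideal_comp n) C" using fin_dim_ideal_comp by (auto simp: fa.fin_dim_def)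
  have "of_nat (lin_dim A (comp A (int n))) = (of_nat (n + 2 choose 2) :: rat)"
  proof -
    have "Abs_fps (\<lambda>n. of_nat (lin_dim A (comp A (int n)))) = Abs_fps (\<lambda>n. of_nat (n + 2 choose 2) :: rat)"
      using hs unfolding has_hilbert_series_def inverse_one_minus_X_cubed by (rule conjunct2)
    from arg_cong[OF this, of "\<lambda>f. fps_nth f n"] show ?thesis by simp
  qed
  then have "lin_dim A (comp A (int n)) = (n + 2 choose 2)" by (simp only: of_nat_eq_iff)
  then have "card C + (n + 2 choose 2) = 3 ^ n"
    using card_lin_basis[OF lin_basis_SOME[OF ex] C] by (simp add: lin_dim_def)
  then show "\<exists>B. fa.finite_basis (ideal_comp n) B \<and> card B + (n + 2 choose 2) = 3 ^ n" using C by blast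
next
  fix p n i assume p: "p \<in> free_comp n" and "p * Y i \<in> ideal_comp (Suc n)"
  then have "proj (p * Y i) = proj 0" using ideal_comp_subset_graded_ideal proj_eq_0_iff by blast
  then have "proj p \<otimes>\<^bsub>A\<^esub> proj (Y i) = \<zero>\<^bsub>A\<^esub>" by (simp only: quantization_simps)
  moreover have "\<forall>a\<in>carrier A. \<forall>b\<in>carrier A. a \<otimes>\<^bsub>A\<^esub> b = \<zero>\<^bsub>A\<^esub> \<longrightarrow> a = \<zero>\<^bsub>A\<^esub> \<or> b = \<zero>\<^bsub>A\<^esub>"
    using q unfolding quantum_polynomial_ring_def nc_domain_def by (elim conjE)
  ultimately have "proj p = \<zero>\<^bsub>A\<^esub> \<or> proj (Y i) = \<zero>\<^bsub>A\<^esub>"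
    by (simp add: quantization_simps(1))
  moreover have "proj (Y i) \<noteq> \<zero>\<^bsub>A\<^esub>"
  proof
    assume "proj (Y i) = \<zero>\<^bsub>A\<^esub>"
    then have "Y i \<in> ideal_comp 1"
      unfolding quantization_simps(4) proj_eq_0_iff by (rule graded_ideal_free_comp) (rule Y_in)
    moreover have "Poly_Mapping.keys (Y i :: 'k free3) = {Word [i]}" by (simp add: Y_def)
    ultimately show False by auto
  qed
  ultimately have "p \<in> graded_ideal" by (simp only: quantization_simps(4) proj_eq_0_iff) blast
  then show "p \<in> ideal_comp n" by (rule graded_ideal_free_comp[OF _ p])
qed

lemma graded_automorphism_represented:
  assumes \<phi>: "\<phi> \<in> graded_automorphisms A" and M: "represents A (quantization_gen cubic h) M \<phi>"
  shows "\<phi> (proj p) = proj (free_matrix_subst M p)"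
proof -
  note f = alg_endo_free_matrix_subst[of M]
  have hom: "\<phi> \<in> ring_hom A A"
    and linear: "\<forall>c. \<forall>a\<in>carrier A. \<phi> (c \<odot>\<^bsub>A\<^esub> a) = c \<odot>\<^bsub>A\<^esub> \<phi> a"
    using \<phi> by (simp_all add: graded_automorphisms_def ring_iso_def)
  have carrier: "proj p \<in> carrier A" for p by (simp add: quantization_simps(1))
  have mult: "\<phi> (proj (p * q)) = \<phi> (proj p) \<otimes>\<^bsub>A\<^esub> \<phi> (proj q)" for p q
    unfolding quantization_simps(2)[symmetric] by (rule ring_hom_mult[OF hom carrier carrier])
  have \<phi>_add: "\<phi> (proj (p + q)) = \<phi> (proj p) \<oplus>\<^bsub>A\<^esub> \<phi> (proj q)" for p q
    unfolding quantization_simps(5)[symmetric] by (rule ring_hom_add[OF hom carrier carrier])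
  have smult: "\<phi> (proj (Const c * p)) = c \<odot>\<^bsub>A\<^esub> \<phi> (proj p)" for c p
    unfolding quantization_simps(6)[symmetric] using linear carrier by blast
  have one: "\<phi> (proj 1) = proj 1"
    using ring_hom_one[OF hom] by (simp only: quantization_simps(3))
  have Y: "\<phi> (proj (Y i)) = proj (free_matrix_subst M (Y i))" for i
  proof -
    have "\<phi> (proj (Y i)) = (\<Oplus>\<^bsub>A\<^esub>j\<in>UNIV. (M $ i $ j) \<odot>\<^bsub>A\<^esub> proj (Y j))"
      using M by (simp add: represents_def quantization_gen_def)
    also have "\<dots> = proj (\<Sum>j\<in>UNIV. Const (M $ i $ j) * Y j)"
      by (rule finsum_quantization) (simp_all add: quantization_simps(6))
    finally show ?thesis by (simp only: free_matrix_subst_Y)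
  qed
  show ?thesis
  proof (induction p rule: poly_mapping_single_induct)
    case (single w c)
    have "\<phi> (proj (Poly_Mapping.single (Word v) c)) = proj (free_matrix_subst M (Poly_Mapping.single (Word v) c))" for v
    proof (induction v)
      case Nil
      show ?case using smult[of c 1] unfolding single_Nil one
        by (simp add: quantization_simps(6) alg_endoD(3)[OF f])
    next
      case (Cons i v)
      then show ?case unfolding single_Cons mult Y alg_endoD(2)[OF f] by (simp only: quantization_simps(2))
    qed
    then show ?case by (cases w) simp
  next
    case (add p q)
    then show ?case by (simp only: \<phi>_add alg_endoD(1)[OF f] quantization_simps(5))
  qed
qed

end

section \<open>Quasi-reflections\<close>

lemma free_matrix_subst_funpow: "(free_matrix_subst M ^^ n) p = free_matrix_subst (mat_power M n) p"
  by (induction n) (simp_all add: free_matrix_subst_1 free_matrix_subst_mult)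

lemma linear_form_Y_inj:
  assumes "(\<Sum>j\<in>UNIV. Const (c j) * Y j) = (\<Sum>j\<in>UNIV. Const (d j) * Y j)"
  shows "c = d"
  using left_independent_eq[OF left_independent_Y assms] by (auto simp: fun_eq_iff dest: fun_cong)

text \<open>
  Both denominators are polynomials, so the equation says that \<open>(1 - X)\<^sup>2\<close> divides the cubic one with
  quotient \<open>g\<close>. Its value and derivative at 1 determine \<open>t\<close> and \<open>s\<close>; then \<open>g = 1 - d X\<close>, and
  \<open>g(1) \<noteq> 0\<close> means \<open>d \<noteq> 1\<close>.
\<close>

lemma trace_series_reflection_iff:
  fixes t s d :: "'k::field_char_0"
  shows "(\<exists>g. poly g 1 \<noteq> 0 \<and>
      inverse (fps_of_poly [:1, - t, s, - d:]) = inverse ((1 - fps_X) ^ 2 * fps_of_poly g)) \<longleftrightarrow>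
    t = 2 + d \<and> s = 1 + 2 * d \<and> d \<noteq> 1" (is "?L \<longleftrightarrow> ?R")
proof
  assume ?L
  then obtain g where g: "poly g 1 \<noteq> 0"
    and eq: "inverse (fps_of_poly [:1, - t, s, - d:]) = inverse ((1 - fps_X) ^ 2 * fps_of_poly g)" by blast
  let ?D = "[:1, - t, s, - d:]" and ?G = "[:1, -1:] ^ 2 * g"
  have G: "(1 - fps_X) ^ 2 * fps_of_poly g = fps_of_poly ?G"
    by (simp add: fps_of_poly_mult fps_of_poly_power fps_of_poly_pCons)
  have D0: "fps_nth (fps_of_poly ?D) 0 \<noteq> 0" by simp
  then have "inverse (fps_of_poly ?D) \<noteq> 0" by (simp only: fps_inverse_eq_0_iff not_False_eq_True)
  then have "fps_nth (fps_of_poly ?G) 0 \<noteq> 0" using eq G by (metis fps_inverse_eq_0_iff)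
  then have "fps_of_poly ?D = fps_of_poly ?G" using eq D0 G by (metis fps_inverse_idempotent)
  then have DG: "?D = ?G" by (simp only: fps_of_poly_eq_iff)
  have "poly ?D 1 = 0" unfolding DG by simp
  then have 1: "1 - t + s - d = 0" by (simp add: algebra_simps)
  have "poly (pderiv ?D) 1 = 0" unfolding DG by (simp add: pderiv_mult pderiv_power pderiv_pCons)
  then have 2: "- t + 2 * s - 3 * d = 0" by (simp add: pderiv_pCons algebra_simps)
  have "s - (1 + 2 * d) = (- t + 2 * s - 3 * d) - (1 - t + s - d)" by (simp add: algebra_simps)
  then have s: "s = 1 + 2 * d" unfolding 1 2 by simp
  have t: "t = 2 + d" using 1 s by (simp add: algebra_simps)
  have "d \<noteq> 1"
  proof
    assume "d = 1"
    then have "?D = [:1, -1:] ^ 2 * [:1, -1:]" by (simp add: s t power2_eq_square)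
    then have "g = [:1, -1:]" using DG by (metis mult_left_cancel pCons_eq_0_iff power_not_zero zero_neq_one)
    then show False using g by simp
  qed
  then show ?R using s t by simp
next
  assume R: ?R
  then have "poly [:1, - d:] 1 \<noteq> 0" by simp
  moreover have "fps_of_poly [:1, - t, s, - d:] = (1 - fps_X) ^ 2 * fps_of_poly [:1, - d:]"
    using R by (simp add: fps_of_poly_pCons power2_eq_square algebra_simps)
  ultimately show ?L by (intro exI[of _ "[:1, - d:]"] conjI arg_cong[of _ _ inverse])
qed

context quantized_cubic
begin

text \<open>
  In degree two the ideal is the span of the relations, which an automorphism must preserve.
\<close>

lemma gradient_equivariant_if_automorphism:
  assumes "h \<noteq> 0" and \<phi>: "\<phi> \<in> graded_automorphisms A"
    and \<phi>p: "\<And>p. \<phi> (proj p) = proj (free_matrix_subst M p)"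
  shows "gradient_equivariant M"
proof (rule gradient_equivariant_if_rel[OF assms(1)])
  fix i
  have "proj (rel i) = proj 0"
    using rel_in_ideal_comp ideal_comp_subset_graded_ideal proj_eq_0_iff by blast
  then have "proj (free_matrix_subst M (rel i)) = proj (free_matrix_subst M 0)" by (simp only: \<phi>p[symmetric])
  then have "free_matrix_subst M (rel i) \<in> graded_ideal"
    by (simp add: alg_endoD(4)[OF alg_endo_free_matrix_subst] proj_eq_0_iff)
  moreover have "free_matrix_subst M (rel i) \<in> free_comp (Suc (Suc 0))"
    using image_free_comp rel_in_free_comp by blast
  ultimately have "free_matrix_subst M (rel i) \<in> ideal_comp (Suc (Suc 0))" by (rule graded_ideal_free_comp)
  then have "free_matrix_subst M (rel i) \<in> right_span (free_comp 0) rel" by (auto simp: right_span_zero)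
  then obtain u where u: "\<And>k. u k \<in> free_comp 0" "free_matrix_subst M (rel i) = (\<Sum>k\<in>UNIV. u k * rel k)"
    using right_spanE by blast
  have "\<forall>k. \<exists>c. u k = Const c" using u(1) by (auto simp: free_comp_0)
  then obtain c where "\<And>k. u k = Const (c k)" by metis
  then show "\<exists>C. free_matrix_subst M (rel i) = (\<Sum>j\<in>UNIV. Const (C j) * rel j)" using u(2) by auto
qed

lemma automorphism_funpow:
  assumes "\<And>p. \<phi> (proj p) = proj (free_matrix_subst M p)"
  shows "(\<phi> ^^ n) (proj p) = proj (free_matrix_subst (mat_power M n) p)"
  unfolding free_matrix_subst_funpow[symmetric] by (induction n) (simp_all add: assms)

lemma mat_power_eq_1_iff:
  assumes \<phi>p: "\<And>p. \<phi> (proj p) = proj (free_matrix_subst M p)"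
  shows "(\<forall>a\<in>carrier A. (\<phi> ^^ n) a = a) \<longleftrightarrow> mat_power M n = mat 1"
proof
  assume "\<forall>a\<in>carrier A. (\<phi> ^^ n) a = a"
  then have "proj (free_matrix_subst (mat_power M n) (Y i)) = proj (Y i)" for i
    by (simp add: automorphism_funpow[of \<phi> M, OF \<phi>p, symmetric] quantization_simps(1))
  then have "free_matrix_subst (mat_power M n) (Y i) - Y i \<in> graded_ideal" for i
    by (simp only: proj_eq_iff)
  moreover have "free_matrix_subst (mat_power M n) (Y i) - Y i \<in> free_comp 1" for i
    using image_free_comp Y_in by (intro fa.subspace_diff subspace_free_comp) blast+
  ultimately have "free_matrix_subst (mat_power M n) (Y i) - Y i \<in> ideal_comp 1" for i
    by (rule graded_ideal_free_comp)
  then have "free_matrix_subst (mat_power M n) (Y i) = free_matrix_subst (mat 1) (Y i)" for i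
    by (simp add: free_matrix_subst_1)
  then have "(\<lambda>j. mat_power M n $ i $ j) = (\<lambda>j. mat 1 $ i $ j)" for i
    by (intro linear_form_Y_inj) (simp only: free_matrix_subst_Y)
  then show "mat_power M n = mat 1" by (simp add: vec_eq_iff fun_eq_iff)
next
  assume "mat_power M n = mat 1"
  then show "\<forall>a\<in>carrier A. (\<phi> ^^ n) a = a"
    by (auto simp: quantization_simps(1) automorphism_funpow[of \<phi> M, OF \<phi>p] free_matrix_subst_1)
qed

lemma graded_ideal_transform:
  assumes M: "gradient_equivariant M" and p: "p \<in> graded_ideal"
  shows "free_matrix_subst M p \<in> graded_ideal"
proof -
  note f = alg_endo_free_matrix_subst[of M]
  obtain N where N: "p = (\<Sum>n<N. free_part n p)" using sum_free_parts by blast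
  have "free_matrix_subst M (free_part n p) \<in> graded_ideal" for n
    using p image_ideal_comp[OF M, of n] ideal_comp_subset_graded_ideal[of n] unfolding graded_ideal_def by blast
  then have "(\<Sum>n<N. free_matrix_subst M (free_part n p)) \<in> graded_ideal"
    by (intro fa.subspace_sum subspace_graded_ideal)
  then show ?thesis using alg_endoD(8)[OF f, of "\<lambda>n. free_part n p" "{..<N}"] N by simp
qed

text \<open>
  The map on residue classes computed by representatives. It is restricted to the carrier because
  automorphisms are taken to be extensional functions.
\<close>

definition induced_map :: "'k^3^3 \<Rightarrow> 'k free3 set \<Rightarrow> 'k free3 set" where
  "induced_map M = restrict (\<lambda>a. proj (free_matrix_subst M (SOME p. proj p = a))) (carrier A)"

lemma induced_map_proj:
  assumes "gradient_equivariant M"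
  shows "induced_map M (proj p) = proj (free_matrix_subst M p)"
proof -
  define q where "q = (SOME q. proj q = proj p)"
  have "proj q = proj p" unfolding q_def by (rule someI[of _ p]) simp
  then have "free_matrix_subst M (q - p) \<in> graded_ideal"
    by (intro graded_ideal_transform[OF assms]) (simp only: proj_eq_iff)
  then have "proj (free_matrix_subst M q) = proj (free_matrix_subst M p)"
    by (simp only: proj_eq_iff alg_endoD(7)[OF alg_endo_free_matrix_subst])
  then show ?thesis by (simp add: induced_map_def quantization_simps(1) q_def)
qed

lemma induced_map_automorphism:
  assumes M: "gradient_equivariant M" and m: "m > 0" "mat_power M m = mat 1"
  shows "induced_map M \<in> graded_automorphisms A"
proof -
  let ?f = "free_matrix_subst M"
  note f = alg_endo_free_matrix_subst[of M] and ind = induced_map_proj[OF M]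
  obtain N where NM: "N ** M = mat 1" "M ** N = mat 1" using mat_power_eq_1_inverse[OF m] .
  have inv: "?f (free_matrix_subst N p) = p" for p
    by (simp add: free_matrix_subst_mult NM free_matrix_subst_1)
  \<comment> \<open>Injectivity comes from the finite order, surjectivity from the inverse matrix.\<close>
  have pow: "(induced_map M ^^ m) a = a" if "a \<in> carrier A" for a
    using mat_power_eq_1_iff[of "induced_map M" M m, OF ind] m(2) that by blast
  have inj: "inj_on (induced_map M) (carrier A)"
  proof (rule inj_onI)
    fix x y assume xy: "x \<in> carrier A" "y \<in> carrier A" "induced_map M x = induced_map M y"
    obtain k where k: "m = Suc k" using m(1) by (cases m) auto
    have "(induced_map M ^^ m) x = (induced_map M ^^ m) y" unfolding k funpow_Suc_right by (simp add: xy(3))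
    then show "x = y" using pow xy by simp
  qed
  have surj: "induced_map M ` proj ` S = proj ` S" if S: "?f ` S \<subseteq> S" "free_matrix_subst N ` S \<subseteq> S" for S
  proof
    show "induced_map M ` proj ` S \<subseteq> proj ` S" using S(1) by (auto simp: ind)
    show "proj ` S \<subseteq> induced_map M ` proj ` S"
    proof
      fix a assume "a \<in> proj ` S"
      then obtain p where p: "p \<in> S" "a = proj p" by auto
      then have "a = induced_map M (proj (free_matrix_subst N p))" by (simp add: ind inv)
      moreover have "free_matrix_subst N p \<in> S" using S(2) p by auto
      ultimately show "a \<in> induced_map M ` proj ` S" by auto
    qed
  qed
  have "induced_map M ` carrier A = carrier A" unfolding quantization_simps(1) by (rule surj) auto
  then have "bij_betw (induced_map M) (carrier A) (carrier A)" using inj by (simp add: bij_betw_def)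
  moreover have "induced_map M ` comp A n = comp A n" for n
  proof (cases "n < 0")
    case True
    then show ?thesis by (simp add: comp_negative ind alg_endoD(4)[OF f])
  next
    case False
    then obtain k where "n = int k" by (metis not_less zero_le_imp_eq_int)
    then show ?thesis by (simp add: quantization_simps(7) surj image_free_comp)
  qed
  moreover have "induced_map M \<in> extensional (carrier A)" by (simp add: induced_map_def)
  ultimately show ?thesis
    unfolding graded_automorphisms_def ring_iso_def ring_hom_def quantization_simps(1)
    by (auto simp: quantization_simps(2-6) ind alg_endoD(1-3,5)[OF f])
qed

text \<open>
  An automorphism has the same matrix on generators as its lift to the free algebra, which
  preserves the relations; so equivariance of the gradient holds and the trace series is known.
  Conversely an equivariant matrix of finite order induces an automorphism.
\<close>

theorem matrices_quasi_reflections: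
  assumes "h \<noteq> 0" and q: "quantum_polynomial_ring A"
  shows "matrices A (quantization_gen cubic h) (quasi_reflections A) =
    {M. gradient_equivariant M \<and> finite_order_reflection M}"
proof -
  interpret quantized_cubic_domain T h by (rule quantized_cubic_domain_if_quantum_polynomial_ring[OF q])
  have basis: "\<exists>B. lin_basis A (comp A (int n)) B" for n
    using q by (simp add: quantum_polynomial_ring_def has_hilbert_series_def)
  have series: "trace_series A \<phi> = inverse (fps_of_poly [:1, - trace M, second_trace M, - det M:])"
    if M: "gradient_equivariant M" and \<phi>: "\<And>p. \<phi> (proj p) = proj (free_matrix_subst M p)" for M \<phi>
  proof -
    have "trace_series A \<phi> = Abs_fps (quotient_trace M)"
      unfolding trace_series_def quotient_trace_def lin_trace_quantization[OF basis M \<phi>] ..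
    then show ?thesis using Abs_fps_third_order[OF quotient_trace_recurrence[OF M]] by simp
  qed
  show ?thesis
  proof (rule Set.set_eqI, rule iffI)
    fix M assume "M \<in> matrices A (quantization_gen cubic h) (quasi_reflections A)"
    then obtain \<phi> where \<phi>: "\<phi> \<in> quasi_reflections A" and rep: "represents A (quantization_gen cubic h) M \<phi>"
      by (auto simp: matrices_def)
    have aut: "\<phi> \<in> graded_automorphisms A" using \<phi> by (simp add: quasi_reflections_def)
    note \<phi>p = graded_automorphism_represented[OF aut rep]
    have M: "gradient_equivariant M" by (rule gradient_equivariant_if_automorphism[OF assms(1) aut \<phi>p])
    have "\<exists>m>0. mat_power M m = mat 1"
      using \<phi> mat_power_eq_1_iff[of \<phi> M, OF \<phi>p] by (auto simp: quasi_reflections_def finite_order_def)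
    moreover have "trace M = 2 + det M \<and> second_trace M = 1 + 2 * det M \<and> det M \<noteq> 1"
    proof -
      have "\<exists>g. poly g 1 \<noteq> 0 \<and> trace_series A \<phi> = inverse ((1 - fps_X) ^ 2 * fps_of_poly g)"
        using \<phi> by (simp add: quasi_reflections_def)
      then show ?thesis unfolding series[OF M \<phi>p] trace_series_reflection_iff .
    qed
    ultimately show "M \<in> {M. gradient_equivariant M \<and> finite_order_reflection M}"
      using M by (simp add: finite_order_reflection_def)
  next
    fix M assume "M \<in> {M. gradient_equivariant M \<and> finite_order_reflection M}"
    then have M: "gradient_equivariant M" and R: "finite_order_reflection M" by auto
    obtain m where m: "m > 0" "mat_power M m = mat 1" using R by (auto simp: finite_order_reflection_def)
    note ind = induced_map_proj[OF M]
    have "\<exists>g. poly g 1 \<noteq> 0 \<and> trace_series A (induced_map M) = inverse ((1 - fps_X) ^ 2 * fps_of_poly g)"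
      unfolding series[OF M ind] trace_series_reflection_iff using R by (simp add: finite_order_reflection_def)
    moreover have "finite_order A (induced_map M)"
      unfolding finite_order_def using m mat_power_eq_1_iff[of "induced_map M" M, OF ind] by blast
    ultimately have "induced_map M \<in> quasi_reflections A"
      using induced_map_automorphism[OF M m] by (simp add: quasi_reflections_def)
    moreover have "represents A (quantization_gen cubic h) M (induced_map M)"
    proof -
      have "(\<Oplus>\<^bsub>A\<^esub>j\<in>UNIV. (M $ i $ j) \<odot>\<^bsub>A\<^esub> proj (Y j)) = proj (\<Sum>j\<in>UNIV. Const (M $ i $ j) * Y j)" for i
        by (rule finsum_quantization) (simp_all add: quantization_simps(6))
      then show ?thesis
        by (simp add: represents_def quantization_gen_def ind free_matrix_subst_Y)
    qed
    ultimately show "M \<in> matrices A (quantization_gen cubic h) (quasi_reflections A)"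
      by (auto simp: matrices_def)
  qed
qed

end

section \<open>Cubic forms and semi-invariance\<close>

context symmetric_tensor
begin

definition trilinear :: "'k^3 \<Rightarrow> 'k^3 \<Rightarrow> 'k^3 \<Rightarrow> 'k" where
  "trilinear x y z = (\<Sum>i\<in>UNIV. \<Sum>j\<in>UNIV. \<Sum>k\<in>UNIV. T i j k * x $ i * y $ j * z $ k)"

definition cubic_fun :: "'k^3 \<Rightarrow> 'k" where
  "cubic_fun v = trilinear v v v / 6"

lemma trilinear_commute: "trilinear x y z = trilinear y x z" "trilinear x y z = trilinear x z y"
proof -
  show "trilinear x y z = trilinear y x z"
    unfolding trilinear_def by (subst sum.swap) (simp only: T_sym(1) mult_ac)
  show "trilinear x y z = trilinear x z y"
    unfolding trilinear_def
    by (rule sum.cong[OF refl], subst sum.swap) (simp only: T_sym(2) mult_ac)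
qed

lemma trilinear_add: "trilinear (x + y) z w = trilinear x z w + trilinear y z w"
  unfolding trilinear_def
  by (simp only: vector_add_component distrib_left distrib_right sum.distrib)

lemma trilinear_add2: "trilinear z (x + y) w = trilinear z x w + trilinear z y w"
  by (simp only: trilinear_commute(1)[of z] trilinear_add)

lemma trilinear_add3: "trilinear z w (x + y) = trilinear z w x + trilinear z w y"
  by (simp only: trilinear_commute(2)[of z w] trilinear_add2)

lemma polarization:
  "6 * trilinear x y z = trilinear (x + y + z) (x + y + z) (x + y + z) - trilinear (x + y) (x + y) (x + y) -
     trilinear (y + z) (y + z) (y + z) - trilinear (x + z) (x + z) (x + z) +
     trilinear x x x + trilinear y y y + trilinear z z z"
  by (simp add: trilinear_add trilinear_add2 trilinear_add3 trilinear_commute)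

text \<open>
  Contracting the gradient equations with \<open>v\<close>, \<open>v\<close> and \<open>M v\<close> and using Euler's identity gives
  \<open>F(M v) = det M F(v)\<close> for the cubic function \<open>F\<close>. In the other direction polarization gives
  \<open>T(M x, M y, M z) = det M T(x, y, z)\<close>, and multiplication with the adjugate matrix removes \<open>M\<close>
  from one argument.
\<close>

lemma gradient_equivariant_iff_semi_invariant:
  assumes det: "det M \<noteq> 0"
  shows "gradient_equivariant M \<longleftrightarrow> (\<forall>v. cubic_fun (M *v v) = det M * cubic_fun v)"
proof
  assume M: "gradient_equivariant M"
  show "\<forall>v. cubic_fun (M *v v) = det M * cubic_fun v"
  proof
    fix v
    define q where "q B = (\<Sum>a\<in>UNIV. \<Sum>b\<in>UNIV. B a b * (v $ a * v $ b))" for B :: "3 \<Rightarrow> 3 \<Rightarrow> 'k"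
    have tri: "trilinear w w w = (\<Sum>i\<in>UNIV. w $ i * (\<Sum>k\<in>UNIV. \<Sum>l\<in>UNIV. T i k l * (w $ k * w $ l)))" for w
      unfolding trilinear_def by (simp only: sum_distrib_left mult_ac)
    have pull: "(\<Sum>k\<in>UNIV. \<Sum>l\<in>UNIV. B k l * ((M *v v) $ k * (M *v v) $ l)) =
        q (\<lambda>a b. \<Sum>k\<in>UNIV. \<Sum>l\<in>UNIV. B k l * M $ k $ a * M $ l $ b)" for B
    proof -
      have "(\<Sum>k\<in>UNIV. \<Sum>l\<in>UNIV. B k l * ((M *v v) $ k * (M *v v) $ l)) =
          (\<Sum>k\<in>UNIV. \<Sum>l\<in>UNIV. \<Sum>a\<in>UNIV. \<Sum>b\<in>UNIV. B k l * M $ k $ a * M $ l $ b * (v $ a * v $ b))"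
        unfolding matrix_vector_mult_def vec_lambda_beta sum_product
        unfolding sum_distrib_left by (simp only: mult_ac)
      also have "\<dots> = (\<Sum>k\<in>UNIV. \<Sum>a\<in>UNIV. \<Sum>b\<in>UNIV. \<Sum>l\<in>UNIV. B k l * M $ k $ a * M $ l $ b * (v $ a * v $ b))"
        by (rule sum.cong[OF refl], subst sum.swap, rule sum.cong[OF refl], rule sum.swap)
      also have "\<dots> = (\<Sum>a\<in>UNIV. \<Sum>b\<in>UNIV. \<Sum>k\<in>UNIV. \<Sum>l\<in>UNIV. B k l * M $ k $ a * M $ l $ b * (v $ a * v $ b))"
        by (subst sum.swap, rule sum.cong[OF refl], rule sum.swap)
      finally show ?thesis unfolding q_def sum_distrib_right .
    qed
    have "q (\<lambda>a b. \<Sum>j\<in>UNIV. C j * T j a b) = (\<Sum>j\<in>UNIV. C j * q (T j))" for C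
      unfolding q_def by (simp add: sum_3 algebra_simps)
    then have "trilinear (M *v v) (M *v v) (M *v v) =
        (\<Sum>i\<in>UNIV. (M *v v) $ i * (\<Sum>j\<in>UNIV. cofactor M i j * q (T j)))"
      using M unfolding tri pull gradient_equivariant_def by simp
    also have "\<dots> = (\<Sum>c\<in>UNIV. \<Sum>j\<in>UNIV. (\<Sum>i\<in>UNIV. M $ i $ c * cofactor M i j) * (v $ c * q (T j)))"
      by (simp add: matrix_vector_mult_def sum_3 algebra_simps)
    also have "\<dots> = det M * (\<Sum>c\<in>UNIV. v $ c * q (T c))"
      unfolding cofactor_expand_columns by (simp add: sum_3 algebra_simps)
    also have "\<dots> = det M * trilinear v v v" unfolding tri q_def ..
    finally show "cubic_fun (M *v v) = det M * cubic_fun v" by (simp add: cubic_fun_def)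
  qed
next
  assume inv: "\<forall>v. cubic_fun (M *v v) = det M * cubic_fun v"
  then have diag: "trilinear (M *v v) (M *v v) (M *v v) = det M * trilinear v v v" for v
    by (simp add: cubic_fun_def)
  have "6 * trilinear (M *v x) (M *v y) (M *v z) = 6 * (det M * trilinear x y z)" for x y z
    unfolding polarization[of "M *v x"] mult.left_commute[of 6] polarization[of x]
    unfolding matrix_vector_right_distrib[symmetric] diag by (simp add: algebra_simps)
  then have tri: "trilinear (M *v x) (M *v y) (M *v z) = det M * trilinear x y z" for x y z by simp
  have T: "trilinear (axis a 1) (axis b 1) (axis c 1) = T a b c" for a b c
    using exhaust_3[of a] exhaust_3[of b] exhaust_3[of c] by (auto simp: trilinear_def sum_3 axis_def)
  let ?S = "\<lambda>i a b. \<Sum>k\<in>UNIV. \<Sum>l\<in>UNIV. T i k l * M $ k $ a * M $ l $ b"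
  have col: "(M *v axis a 1) $ i = M $ i $ a" for a i
    using exhaust_3[of a] by (auto simp: matrix_vector_mult_def sum_3 axis_def)
  have S: "(\<Sum>i\<in>UNIV. M $ i $ c * ?S i a b) = det M * T c a b" for a b c
    using tri[of "axis c 1" "axis a 1" "axis b 1"] unfolding T
    unfolding trilinear_def col by (simp add: sum_distrib_left mult_ac)
  show "gradient_equivariant M" unfolding gradient_equivariant_def
  proof (intro allI)
    fix m a b
    have "det M * ?S m a b = (\<Sum>i\<in>UNIV. (\<Sum>c\<in>UNIV. cofactor M m c * M $ i $ c) * ?S i a b)"
    proof -
      have "(\<Sum>i\<in>UNIV. (if m = i then d else 0) * g i) = d * g m" for d :: 'k and g
        using exhaust_3[of m] by (auto simp: sum_3)
      then show ?thesis unfolding cofactor_expand_rows by simp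
    qed
    also have "\<dots> = (\<Sum>c\<in>UNIV. cofactor M m c * (\<Sum>i\<in>UNIV. M $ i $ c * ?S i a b))"
    proof -
      have "(\<Sum>i\<in>UNIV. (\<Sum>c\<in>UNIV. C c * N i c) * g i) = (\<Sum>c\<in>UNIV. C c * (\<Sum>i\<in>UNIV. N i c * g i))"
        for C g :: "3 \<Rightarrow> 'k" and N :: "3 \<Rightarrow> 3 \<Rightarrow> 'k"
        by (simp add: sum_3 algebra_simps)
      then show ?thesis .
    qed
    also have "\<dots> = det M * (\<Sum>c\<in>UNIV. cofactor M m c * T c a b)"
      unfolding S by (simp add: sum_distrib_left mult.left_commute)
    finally show "?S m a b = (\<Sum>j\<in>UNIV. cofactor M m j * T j a b)"
      using det by simp
  qed
qed

end

text \<open>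
  The symmetric tensor is hidden, so that concrete cubics can be composed from monomials and from
  then on be treated as functions of three scalars.
\<close>

definition represents_cubic :: "'k::field_char_0 pol3 \<Rightarrow> ('k \<Rightarrow> 'k \<Rightarrow> 'k \<Rightarrow> 'k) \<Rightarrow> bool" where
  "represents_cubic \<Omega> f \<longleftrightarrow> (\<exists>T. symmetric_tensor T \<and> symmetric_tensor.cubic T = \<Omega> \<and>
     (\<forall>v. symmetric_tensor.cubic_fun T v = f (v $ 1) (v $ 2) (v $ 3)))"

lemma represents_cubic_add:
  assumes "represents_cubic \<Omega> f" "represents_cubic \<Omega>' g"
  shows "represents_cubic (\<Omega> + \<Omega>') (\<lambda>x y z. f x y z + g x y z)"
proof -
  obtain T U where T: "symmetric_tensor T" "symmetric_tensor.cubic T = \<Omega>"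
      "\<And>v. symmetric_tensor.cubic_fun T v = f (v $ 1) (v $ 2) (v $ 3)"
    and U: "symmetric_tensor U" "symmetric_tensor.cubic U = \<Omega>'"
      "\<And>v. symmetric_tensor.cubic_fun U v = g (v $ 1) (v $ 2) (v $ 3)"
    using assms unfolding represents_cubic_def by blast
  interpret T: symmetric_tensor T by (fact T)
  interpret U: symmetric_tensor U by (fact U)
  interpret S: symmetric_tensor "\<lambda>i j k. T i j k + U i j k"
    by standard (metis T.T_sym U.T_sym)+
  have "S.cubic = \<Omega> + \<Omega>'"
    unfolding T(2)[symmetric] U(2)[symmetric] S.cubic_def T.cubic_def U.cubic_def
    by (simp only: Const_add distrib_left distrib_right sum.distrib)
  moreover have "S.cubic_fun v = f (v $ 1) (v $ 2) (v $ 3) + g (v $ 1) (v $ 2) (v $ 3)" for v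
    unfolding T(3)[symmetric] U(3)[symmetric] S.cubic_fun_def T.cubic_fun_def U.cubic_fun_def
      S.trilinear_def T.trilinear_def U.trilinear_def
    by (simp only: distrib_left distrib_right sum.distrib add_divide_distrib)
  ultimately show ?thesis
    unfolding represents_cubic_def using S.symmetric_tensor_axioms by blast
qed

lemma represents_cubic_scale:
  assumes "represents_cubic \<Omega> f"
  shows "represents_cubic (Const c * \<Omega>) (\<lambda>x y z. c * f x y z)"
proof -
  obtain T where T: "symmetric_tensor T" "symmetric_tensor.cubic T = \<Omega>"
      "\<And>v. symmetric_tensor.cubic_fun T v = f (v $ 1) (v $ 2) (v $ 3)"
    using assms unfolding represents_cubic_def by blast
  interpret T: symmetric_tensor T by (fact T)
  interpret S: symmetric_tensor "\<lambda>i j k. c * T i j k"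
    by standard (metis T.T_sym)+
  have "S.cubic = Const c * \<Omega>"
    unfolding T(2)[symmetric] S.cubic_def T.cubic_def
    by (simp only: Const_mult sum_distrib_left mult_ac)
  moreover have "S.cubic_fun v = c * f (v $ 1) (v $ 2) (v $ 3)" for v
    unfolding T(3)[symmetric] S.cubic_fun_def T.cubic_fun_def S.trilinear_def T.trilinear_def
    by (simp only: sum_distrib_left mult.assoc times_divide_eq_right)
  ultimately show ?thesis
    unfolding represents_cubic_def using S.symmetric_tensor_axioms by blast
qed

definition coordinate :: "'k \<Rightarrow> 'k \<Rightarrow> 'k \<Rightarrow> 3 \<Rightarrow> 'k" where
  "coordinate x y z i = (if i = 1 then x else if i = 2 then y else z)"

lemma sum_triple_product:
  fixes f g h :: "3 \<Rightarrow> 'r::comm_ring_1"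
  shows "sum f UNIV * sum g UNIV * sum h UNIV = (\<Sum>i\<in>UNIV. \<Sum>j\<in>UNIV. \<Sum>k\<in>UNIV. f i * g j * h k)"
  by (simp add: sum_3 algebra_simps)

lemma represents_cubic_monomial:
  fixes a b c :: 3
  shows "represents_cubic (X a * X b * X c :: 'k::field_char_0 pol3)
    (\<lambda>x y z. coordinate x y z a * coordinate x y z b * coordinate x y z c)"
proof -
  \<comment> \<open>The tensor sums over the six orders of the factors, which cancels the 6 in \<open>cubic\<close> and \<open>cubic_fun\<close>.\<close>
  define e :: "3 \<Rightarrow> 3 \<Rightarrow> 'k" where "e a i = (if i = a then 1 else 0)" for a i
  define m where "m a b c i j k = e a i * e b j * e c k" for a b c i j k
  define T where "T i j k = m a b c i j k + m a c b i j k + m b a c i j k + m b c a i j k + m c a b i j k + m c b a i j k"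
    for i j k
  interpret symmetric_tensor T
    by standard (simp_all add: T_def m_def)
  have "(\<Sum>i\<in>UNIV. \<Sum>j\<in>UNIV. \<Sum>k\<in>UNIV. Const (m a b c i j k) * (X i * X j * X k)) = (X a * X b * X c :: 'k pol3)" for a b c
  proof -
    have "(\<Sum>i\<in>UNIV. Const (e a i) * X i) = (X a :: 'k pol3)" for a
      using exhaust_3[of a] by (auto simp: e_def sum_3)
    then have "X a * X b * X c = (\<Sum>i\<in>UNIV. Const (e a i) * X i) * (\<Sum>j\<in>UNIV. Const (e b j) * X j) * (\<Sum>k\<in>UNIV. Const (e c k) * (X k :: 'k pol3))"
      by simp
    then show ?thesis
      unfolding sum_triple_product by (simp only: m_def Const_mult mult_ac)
  qed
  then have "cubic = Const (1 / 6) * (X a * X b * X c + X a * X c * X b + X b * X a * X c + X b * X c * X a + X c * X a * X b + X c * X b * X a)"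
    unfolding cubic_def T_def by (simp only: Const_add distrib_right sum.distrib)
  also have "\<dots> = Const (1 / 6 * 6) * (X a * X b * X c)"
    unfolding Const_mult by (simp add: algebra_simps)
  finally have "cubic = X a * X b * X c" by simp
  moreover have "cubic_fun v = v $ a * v $ b * v $ c" for v
  proof -
    have "(\<Sum>i\<in>UNIV. \<Sum>j\<in>UNIV. \<Sum>k\<in>UNIV. m a b c i j k * v $ i * v $ j * v $ k) = v $ a * v $ b * v $ c" for a b c
    proof -
      have "(\<Sum>i\<in>UNIV. e a i * v $ i) = v $ a" for a
        using exhaust_3[of a] by (auto simp: e_def sum_3)
      then have "v $ a * v $ b * v $ c = (\<Sum>i\<in>UNIV. e a i * v $ i) * (\<Sum>j\<in>UNIV. e b j * v $ j) * (\<Sum>k\<in>UNIV. e c k * v $ k)"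
        by simp
      then show ?thesis unfolding sum_triple_product by (simp only: m_def mult_ac)
    qed
    then have "trilinear v v v = v $ a * v $ b * v $ c + v $ a * v $ c * v $ b + v $ b * v $ a * v $ c +
        v $ b * v $ c * v $ a + v $ c * v $ a * v $ b + v $ c * v $ b * v $ a"
      unfolding trilinear_def T_def by (simp only: distrib_right sum.distrib)
    then show ?thesis by (simp add: cubic_fun_def algebra_simps)
  qed
  moreover have "coordinate (v $ 1) (v $ 2) (v $ 3) i = v $ i" for v :: "'k^3" and i
    using exhaust_3[of i] by (auto simp: coordinate_def)
  ultimately show ?thesis
    unfolding represents_cubic_def using symmetric_tensor_axioms by auto
qed

section \<open>Reflections of a cubic form\<close>

text \<open>
  The adjugate as a polynomial in the matrix, which is the theorem of Cayley and Hamilton for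
  matrices of size three.
\<close>

lemma cofactor_Cayley_Hamilton:
  "cofactor N j i = (N ** N) $ i $ j - trace N * N $ i $ j + (if i = j then second_trace N else 0)"
proof -
  have "\<forall>i j. cofactor N j i = (N ** N) $ i $ j - trace N * N $ i $ j + (if i = j then second_trace N else 0)"
    unfolding forall_3 trace_def second_trace_def cofactor_def matrix_matrix_mult_def vec_lambda_beta sum_3
    by (simp add: algebra_simps)
  then show ?thesis by blast
qed

lemma shifted_invariants:
  "trace (M - mat 1 :: 'k::comm_ring_1^3^3) = trace M - 3"
  "second_trace (M - mat 1 :: 'k^3^3) = second_trace M - 2 * trace M + 3"
  "det (M - mat 1 :: 'k^3^3) = det M - second_trace M + trace M - 1"
  by (simp_all add: trace_def second_trace_def cofactor_def det_3 sum_3 mat_def algebra_simps)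

text \<open>
  Let \<open>N = M - 1\<close> and \<open>s = det M - 1 \<noteq> 0\<close>. The characteristic polynomial of \<open>N\<close> is \<open>x\<^sup>2 (x - s)\<close>, so
  \<open>N\<^sup>3 = s N\<^sup>2\<close> and every power of \<open>M\<close> has the form \<open>1 + n N + c N\<^sup>2\<close>. From \<open>M\<^sup>m = 1\<close> one gets
  \<open>m N + c N\<^sup>2 = 0\<close>; multiplication with \<open>N\<close> gives \<open>(m + c s) N\<^sup>2 = 0\<close>. Here \<open>N\<^sup>2 = 0\<close> is impossible, as
  \<open>N\<close> has trace \<open>s\<close>; hence \<open>m = - c s\<close> and \<open>N\<^sup>2 = s N\<close>. The adjugate \<open>N\<^sup>2 - s N\<close> of \<open>N\<close> then vanishes,
  that is, \<open>N\<close> has rank one.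
\<close>

lemma finite_order_reflection_rank_one:
  fixes M :: "'k::field_char_0^3^3"
  assumes "finite_order_reflection M"
  shows "\<exists>\<alpha> u. \<forall>i j. M $ i $ j = (if i = j then 1 else 0) + \<alpha> i * u j"
proof -
  define d s N where "d = det M" and "s = d - 1" and "N = M - mat 1"
  obtain m where m: "m > 0" "mat_power M m = mat 1" using assms by (auto simp: finite_order_reflection_def)
  have tr: "trace M = 2 + d" "second_trace M = 1 + 2 * d" and s: "s \<noteq> 0"
    using assms by (auto simp: finite_order_reflection_def d_def s_def)
  have N: "M $ i $ j = (if i = j then 1 else 0) + N $ i $ j" for i j by (simp add: N_def mat_def)
  have cof: "cofactor N j i = (N ** N) $ i $ j - s * N $ i $ j" for i j
  proof -
    have "trace N = s" "second_trace N = 0"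
      unfolding N_def shifted_invariants tr s_def by simp_all
    then show ?thesis using cofactor_Cayley_Hamilton[of N j i] by simp
  qed
  have detN: "det N = 0" unfolding N_def shifted_invariants tr d_def[symmetric] by simp
  have cube: "(\<Sum>k\<in>UNIV. (N ** N) $ i $ k * N $ k $ j) = s * (N ** N) $ i $ j" for i j
  proof -
    have "0 = (\<Sum>k\<in>UNIV. N $ k $ j * cofactor N k i)"
      using cofactor_expand_columns[of N j i] detN by simp
    also have "\<dots> = (\<Sum>k\<in>UNIV. (N ** N) $ i $ k * N $ k $ j) - s * (\<Sum>k\<in>UNIV. N $ i $ k * N $ k $ j)"
      unfolding cof by (simp add: sum_3 algebra_simps)
    finally show ?thesis by (simp add: matrix_matrix_mult_def)
  qed
  have "\<exists>c. \<forall>i j. mat_power M n $ i $ j = (if i = j then 1 else 0) + of_nat n * N $ i $ j + c * (N ** N) $ i $ j" for n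
  proof (induction n)
    case 0
    then show ?case by (auto simp: mat_def)
  next
    case (Suc n)
    then obtain c where c: "\<And>i j. mat_power M n $ i $ j = (if i = j then 1 else 0) + of_nat n * N $ i $ j + c * (N ** N) $ i $ j"
      by blast
    have "mat_power M (Suc n) $ i $ j =
        (if i = j then 1 else 0) + of_nat (Suc n) * N $ i $ j + (of_nat n + c + c * s) * (N ** N) $ i $ j" for i j
    proof -
      have "mat_power M (Suc n) $ i $ j = (\<Sum>k\<in>UNIV. mat_power M n $ i $ k * ((if k = j then 1 else 0) + N $ k $ j))"
        by (simp add: matrix_matrix_mult_def N)
      also have "\<dots> = mat_power M n $ i $ j + (\<Sum>k\<in>UNIV. mat_power M n $ i $ k * N $ k $ j)"
        using exhaust_3[of j] by (auto simp: sum_3 algebra_simps)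
      also have "(\<Sum>k\<in>UNIV. mat_power M n $ i $ k * N $ k $ j) =
          N $ i $ j + of_nat n * (\<Sum>k\<in>UNIV. N $ i $ k * N $ k $ j) + c * (\<Sum>k\<in>UNIV. (N ** N) $ i $ k * N $ k $ j)"
        unfolding c using exhaust_3[of i] by (auto simp: sum_3 algebra_simps)
      finally show ?thesis unfolding cube c by (simp add: matrix_matrix_mult_def algebra_simps)
    qed
    then show ?case by blast
  qed
  then obtain c where "\<And>i j. mat_power M m $ i $ j = (if i = j then 1 else 0) + of_nat m * N $ i $ j + c * (N ** N) $ i $ j"
    by blast
  then have lin: "of_nat m * N $ i $ j + c * (N ** N) $ i $ j = 0" for i j
    unfolding m(2) by (simp add: mat_def add.assoc split: if_splits)
  have square: "(of_nat m + c * s) * (N ** N) $ i $ j = 0" for i j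
  proof -
    have "0 = (\<Sum>k\<in>UNIV. (of_nat m * N $ i $ k + c * (N ** N) $ i $ k) * N $ k $ j)" by (simp add: lin)
    also have "\<dots> = of_nat m * (\<Sum>k\<in>UNIV. N $ i $ k * N $ k $ j) + c * (\<Sum>k\<in>UNIV. (N ** N) $ i $ k * N $ k $ j)"
      by (simp add: sum_3 algebra_simps)
    finally show ?thesis unfolding cube by (simp add: matrix_matrix_mult_def algebra_simps)
  qed
  have trN: "N $ 1 $ 1 + N $ 2 $ 2 + N $ 3 $ 3 = s"
    using tr(1) by (simp add: N_def mat_def trace_def sum_3 s_def algebra_simps)
  have mc: "of_nat m + c * s = 0"
  proof (rule ccontr)
    assume "of_nat m + c * s \<noteq> 0"
    then have "(N ** N) $ i $ j = 0" for i j using square by simp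
    then have "N $ i $ j = 0" for i j using lin[of i j] m(1) by simp
    then show False using trN s by simp
  qed
  have "c * ((N ** N) $ i $ j - s * N $ i $ j) = 0" for i j
  proof -
    have "c * ((N ** N) $ i $ j - s * N $ i $ j) =
        (of_nat m * N $ i $ j + c * (N ** N) $ i $ j) - (of_nat m + c * s) * N $ i $ j"
      by (simp add: algebra_simps)
    then show ?thesis unfolding lin mc by simp
  qed
  moreover have "c \<noteq> 0" using mc m(1) by auto
  \<comment> \<open>From \<open>c (N\<^sup>2 - s N) = 0\<close>: the adjugate of \<open>N\<close> vanishes.\<close>
  ultimately have minors: "cofactor N j i = 0" for i j unfolding cof by simp
  have "\<exists>p. N $ p $ p \<noteq> 0"
  proof (rule ccontr)
    assume "\<not> (\<exists>p. N $ p $ p \<noteq> 0)"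
    then show False using trN s by simp
  qed
  then obtain p where p: "N $ p $ p \<noteq> 0" by blast
  have "N $ i $ j * N $ p $ p = N $ i $ p * N $ p $ j" for i j
  proof -
    have mm: "N $ (k + 1) $ (l + 1) * N $ (k + 2) $ (l + 2) = N $ (k + 1) $ (l + 2) * N $ (k + 2) $ (l + 1)" for k l
      using minors[of k l] unfolding cofactor_def by (simp only: right_minus_eq)
    \<comment> \<open>The minors avoiding a row and a column different from \<open>p\<close> are those through the entry \<open>(p, p)\<close>.\<close>
    have cyc: "p + 1 + 1 = p + 2" "p + 1 + 2 = p" "p + 2 + 1 = p" "p + 2 + 2 = p + 1"
      using exhaust_3[of p] by auto
    have cases: "k = p \<or> k = p + 1 \<or> k = p + 2" for k
      using exhaust_3[of p] exhaust_3[of k] by auto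
    have "N $ (p + 2) $ (p + 2) * N $ p $ p = N $ (p + 2) $ p * N $ p $ (p + 2)"
      "N $ (p + 2) $ p * N $ p $ (p + 1) = N $ (p + 2) $ (p + 1) * N $ p $ p"
      "N $ p $ (p + 2) * N $ (p + 1) $ p = N $ p $ p * N $ (p + 1) $ (p + 2)"
      "N $ p $ p * N $ (p + 1) $ (p + 1) = N $ p $ (p + 1) * N $ (p + 1) $ p"
      using mm[of "p + 1" "p + 1"] mm[of "p + 1" "p + 2"] mm[of "p + 2" "p + 1"] mm[of "p + 2" "p + 2"]
      unfolding cyc by simp_all
    note minors_at_p = this
    from cases[of i] cases[of j] show ?thesis
      by (elim disjE; metis minors_at_p mult.commute)
  qed
  note rank_one = this
  have "N $ i $ j = N $ i $ p / N $ p $ p * N $ p $ j" for i j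
    unfolding times_divide_eq_left rank_one[of i j, symmetric] using p by simp
  from arg_cong[OF this] show ?thesis
    unfolding N by (intro exI[of _ "\<lambda>i. N $ i $ p / N $ p $ p"] exI[of _ "\<lambda>j. N $ p $ j"] allI)
qed

text \<open>
  The matrix \<open>1 + \<alpha> u\<^sup>T\<close> for the column \<open>\<alpha> = (a, b, c)\<close> and the row \<open>u = (p, q, r)\<close>. It fixes the plane
  \<open>u = 0\<close> pointwise, and its determinant is \<open>1 + u(\<alpha>)\<close>.
\<close>

definition reflection_matrix :: "'k::field \<Rightarrow> 'k \<Rightarrow> 'k \<Rightarrow> 'k \<Rightarrow> 'k \<Rightarrow> 'k \<Rightarrow> 'k^3^3" where
  "reflection_matrix a b c p q r =
     vector [vector [1 + a * p, a * q, a * r], vector [b * p, 1 + b * q, b * r], vector [c * p, c * q, 1 + c * r]]"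

lemma reflection_matrix_invariants:
  "det (reflection_matrix a b c p q r) = 1 + (a * p + b * q + c * r)"
  "trace (reflection_matrix a b c p q r) = 2 + (1 + (a * p + b * q + c * r))"
  "second_trace (reflection_matrix a b c p q r) = 1 + 2 * (1 + (a * p + b * q + c * r))"
  by (simp_all add: reflection_matrix_def det_3 trace_def second_trace_def cofactor_def sum_3 algebra_simps)

text \<open>
  As \<open>(\<alpha> u\<^sup>T)\<^sup>2 = s \<alpha> u\<^sup>T\<close>, the powers of \<open>1 + \<alpha> u\<^sup>T\<close> are \<open>1 + e \<alpha> u\<^sup>T\<close> with \<open>s e = (1 + s)\<^sup>n - 1\<close>.
\<close>

lemma finite_order_reflection_matrix_iff:
  fixes a b c p q r :: "'k::field_char_0"
  defines "s \<equiv> a * p + b * q + c * r"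
  shows "finite_order_reflection (reflection_matrix a b c p q r) \<longleftrightarrow> s \<noteq> 0 \<and> root_of_unity (1 + s)"
proof -
  let ?M = "reflection_matrix a b c p q r"
  have "\<exists>e. s * e = (1 + s) ^ n - 1 \<and> mat_power ?M n = reflection_matrix (e * a) (e * b) (e * c) p q r" for n
  proof (induction n)
    case 0
    have "mat 1 = reflection_matrix 0 0 0 p q r"
      by (simp add: reflection_matrix_def vec_eq_iff forall_3 mat_def)
    then show ?case by (intro exI[of _ 0]) simp
  next
    case (Suc n)
    then obtain e where e: "s * e = (1 + s) ^ n - 1" "mat_power ?M n = reflection_matrix (e * a) (e * b) (e * c) p q r"
      by blast
    have "mat_power ?M (Suc n) = reflection_matrix ((e + 1 + e * s) * a) ((e + 1 + e * s) * b) ((e + 1 + e * s) * c) p q r"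
      unfolding mat_power.simps e(2)
      by (simp add: reflection_matrix_def vec_eq_iff forall_3 matrix_matrix_mult_def sum_3 s_def algebra_simps)
    moreover have "s * (e + 1 + e * s) = (1 + s) ^ Suc n - 1"
    proof -
      have "s * (e + 1 + e * s) = (s * e) * (1 + s) + s" by (simp add: algebra_simps)
      then show ?thesis unfolding e(1) by (simp add: algebra_simps)
    qed
    ultimately show ?case by blast
  qed
  note powers = this
  have "mat_power ?M n = mat 1 \<longleftrightarrow> (1 + s) ^ n = 1" if "s \<noteq> 0" for n
  proof
    assume "mat_power ?M n = mat 1"
    then have "det ?M ^ n = 1" using det_mat_power[of ?M n] by (simp add: det_I)
    then show "(1 + s) ^ n = 1" unfolding reflection_matrix_invariants s_def .
  next
    assume "(1 + s) ^ n = 1"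
    moreover obtain e where "s * e = (1 + s) ^ n - 1" "mat_power ?M n = reflection_matrix (e * a) (e * b) (e * c) p q r"
      using powers by blast
    ultimately have "mat_power ?M n = reflection_matrix 0 0 0 p q r" using that by simp
    then show "mat_power ?M n = mat 1"
      by (simp add: reflection_matrix_def vec_eq_iff forall_3 mat_def)
  qed
  then show ?thesis
    unfolding finite_order_reflection_def root_of_unity_def reflection_matrix_invariants s_def[symmetric] by auto
qed

text \<open>
  Finite order and \<open>f(M v) = det M f(v)\<close> for \<open>M = reflection_matrix a b c p q r\<close>, in coordinates. The
  parameters are determined by \<open>M\<close> only up to rescaling \<open>\<alpha>\<close> and \<open>u\<close> by inverse factors.
\<close>

definition cubic_reflection :: "('k \<Rightarrow> 'k \<Rightarrow> 'k \<Rightarrow> 'k) \<Rightarrow> 'k \<Rightarrow> 'k \<Rightarrow> 'k \<Rightarrow> 'k \<Rightarrow> 'k \<Rightarrow> 'k::field \<Rightarrow> bool" where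
  "cubic_reflection f a b c p q r \<longleftrightarrow>
     a * p + b * q + c * r \<noteq> 0 \<and> root_of_unity (1 + (a * p + b * q + c * r)) \<and>
     (\<forall>x y z. f (x + a * (p * x + q * y + r * z)) (y + b * (p * x + q * y + r * z)) (z + c * (p * x + q * y + r * z)) =
        (1 + (a * p + b * q + c * r)) * f x y z)"

definition reflections_of :: "('k::field \<Rightarrow> 'k \<Rightarrow> 'k \<Rightarrow> 'k) \<Rightarrow> ('k^3^3) set" where
  "reflections_of f = {reflection_matrix a b c p q r | a b c p q r. cubic_reflection f a b c p q r}"

lemma root_of_unity_nonzero: "root_of_unity x \<Longrightarrow> x \<noteq> 0"
  by (auto simp: root_of_unity_def zero_power)

lemma (in symmetric_tensor) reflections_of_eq:
  assumes f: "\<And>v. cubic_fun v = f (v $ 1) (v $ 2) (v $ 3)"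
  shows "{M. gradient_equivariant M \<and> finite_order_reflection M} = reflections_of f"
proof -
  have key: "gradient_equivariant (reflection_matrix a b c p q r) \<and> finite_order_reflection (reflection_matrix a b c p q r) \<longleftrightarrow>
      cubic_reflection f a b c p q r" for a b c p q r
  proof (cases "a * p + b * q + c * r \<noteq> 0 \<and> root_of_unity (1 + (a * p + b * q + c * r))")
    case True
    let ?M = "reflection_matrix a b c p q r"
    have d: "det ?M \<noteq> 0" unfolding reflection_matrix_invariants using root_of_unity_nonzero True by blast
    have "(?M *v v) $ 1 = v $ 1 + a * (p * v $ 1 + q * v $ 2 + r * v $ 3)"
      "(?M *v v) $ 2 = v $ 2 + b * (p * v $ 1 + q * v $ 2 + r * v $ 3)"
      "(?M *v v) $ 3 = v $ 3 + c * (p * v $ 1 + q * v $ 2 + r * v $ 3)" for v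
      by (simp_all add: reflection_matrix_def matrix_vector_mult_def sum_3 algebra_simps)
    then have "gradient_equivariant ?M \<longleftrightarrow> (\<forall>v::'k^3.
        f (v $ 1 + a * (p * v $ 1 + q * v $ 2 + r * v $ 3)) (v $ 2 + b * (p * v $ 1 + q * v $ 2 + r * v $ 3)) (v $ 3 + c * (p * v $ 1 + q * v $ 2 + r * v $ 3)) =
        (1 + (a * p + b * q + c * r)) * f (v $ 1) (v $ 2) (v $ 3))"
      unfolding gradient_equivariant_iff_semi_invariant[OF d] f reflection_matrix_invariants by simp
    also have "\<dots> \<longleftrightarrow> (\<forall>x y z. f (x + a * (p * x + q * y + r * z)) (y + b * (p * x + q * y + r * z)) (z + c * (p * x + q * y + r * z)) =
        (1 + (a * p + b * q + c * r)) * f x y z)"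
      unfolding forall_vector_3 by simp
    finally show ?thesis using True unfolding finite_order_reflection_matrix_iff cubic_reflection_def by blast
  next
    case False
    then show ?thesis unfolding finite_order_reflection_matrix_iff cubic_reflection_def by blast
  qed
  have "\<exists>a b c p q r. M = reflection_matrix a b c p q r" if M: "finite_order_reflection M" for M :: "'k^3^3"
  proof -
    obtain \<alpha> u where "\<And>i j. M $ i $ j = (if i = j then 1 else 0) + \<alpha> i * u j"
      using finite_order_reflection_rank_one[OF M] by blast
    then have "M = reflection_matrix (\<alpha> 1) (\<alpha> 2) (\<alpha> 3) (u 1) (u 2) (u 3)"
      by (simp add: reflection_matrix_def vec_eq_iff forall_3)
    then show ?thesis by blast
  qed
  then show ?thesis unfolding reflections_of_def using key by blast
qed

text \<open>
  From here on only the semi-invariance of a function under matrices \<open>1 + \<alpha> u\<^sup>T\<close> is left.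
\<close>

theorem reflections_of_cubic:
  assumes "represents_cubic \<Omega> f" "h \<noteq> 0" "quantum_polynomial_ring (quantization \<Omega> h)"
  shows "matrices poly_algebra X (poisson_reflections \<Omega>) = reflections_of f"
    "matrices (quantization \<Omega> h) (quantization_gen \<Omega> h) (quasi_reflections (quantization \<Omega> h)) = reflections_of f"
proof -
  obtain T where T: "symmetric_tensor T" "symmetric_tensor.cubic T = \<Omega>"
      "\<And>v. symmetric_tensor.cubic_fun T v = f (v $ 1) (v $ 2) (v $ 3)"
    using assms(1) unfolding represents_cubic_def by blast
  interpret quantized_cubic T h using T(1) by (simp add: quantized_cubic_def)
  note eq = reflections_of_eq[of f, OF T(3)]
  show "matrices poly_algebra X (poisson_reflections \<Omega>) = reflections_of f"
    using matrices_poisson_reflections unfolding eq T(2) .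
  show "matrices (quantization \<Omega> h) (quantization_gen \<Omega> h) (quasi_reflections (quantization \<Omega> h)) = reflections_of f"
    using matrices_quasi_reflections[OF assms(2)] assms(3) unfolding eq T(2) .
qed

section \<open>The nine cubics\<close>

text \<open>
  A reflection fixes the points of the plane \<open>u = 0\<close>, so semi-invariance reads \<open>f = det M f\<close> there,
  and \<open>det M \<noteq> 1\<close>. Thus \<open>u\<close> is a linear factor of the cubic. In the following lemmas points of that
  plane exclude all \<open>u\<close> but the linear factors, and then few values of the semi-invariance
  equation restrict \<open>\<alpha>\<close>.
\<close>

lemma cubic_reflection_vanishes:
  assumes "cubic_reflection f a b c p q r" "p * x + q * y + r * z = 0"
  shows "f x y z = 0"
proof -
  have "f x y z = (1 + (a * p + b * q + c * r)) * f x y z"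
    using assms(1)[unfolded cubic_reflection_def, THEN conjunct2, THEN conjunct2, rule_format, of x y z]
    unfolding assms(2) by simp
  then have "(a * p + b * q + c * r) * f x y z = 0" by (simp add: algebra_simps)
  then show ?thesis using assms(1) by (simp add: cubic_reflection_def)
qed

lemma root_of_unity_minus_one: "root_of_unity (- 1 :: 'k::field)"
  unfolding root_of_unity_def by (rule exI[of _ 2]) simp

lemma reflections_of_eqI:
  assumes "\<And>a b c p q r. cubic_reflection f a b c p q r \<Longrightarrow> reflection_matrix a b c p q r \<in> S"
    and "\<And>M. M \<in> S \<Longrightarrow> \<exists>a b c p q r. cubic_reflection f a b c p q r \<and> M = reflection_matrix a b c p q r"
  shows "reflections_of f = S"
  unfolding reflections_of_def using assms by blast

lemma reflections_of_empty:
  assumes "\<And>a b c p q r. \<not> cubic_reflection f a b c p q r"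
  shows "reflections_of f = {}"
  unfolding reflections_of_def using assms by blast

context
  fixes f :: "'k::field_char_0 \<Rightarrow> 'k \<Rightarrow> 'k \<Rightarrow> 'k" and a b c p q r :: 'k
  assumes R: "cubic_reflection f a b c p q r"
begin

lemma nonzero: "a * p + b * q + c * r \<noteq> 0" "1 + (a * p + b * q + c * r) \<noteq> 0"
  and root: "root_of_unity (1 + (a * p + b * q + c * r))"
  and semi_invariant: "f (x + a * (p * x + q * y + r * z)) (y + b * (p * x + q * y + r * z)) (z + c * (p * x + q * y + r * z)) =
        (1 + (a * p + b * q + c * r)) * f x y z"
  using R root_of_unity_nonzero by (auto simp: cubic_reflection_def)

lemmas vanishes = cubic_reflection_vanishes[OF R]

end

lemma reflections_of_cube:
  "reflections_of (\<lambda>x y z. x ^ 3) =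
     {vector [vector [-1, 0, 0], vector [a, 1, 0], vector [d, 0, 1]] | a d :: 'k::field_char_0. True}"
proof (rule reflections_of_eqI)
  fix a b c p q r :: 'k
  assume R: "cubic_reflection (\<lambda>x y z. x ^ 3) a b c p q r"
  have q: "q = 0" using vanishes[OF R, of q "- p" 0] by (simp add: mult.commute)
  have r: "r = 0" using vanishes[OF R, of r 0 "- p"] by (simp add: mult.commute)
  have "(1 + a * p) ^ 3 = 1 + a * p" using semi_invariant[OF R, of 1 0 0] q r by simp
  moreover have "(1 + a * p) * (a * p) * (2 + a * p) = (1 + a * p) ^ 3 - (1 + a * p)"
    by (simp add: power3_eq_cube algebra_simps)
  \<comment> \<open>So \<open>\<xi> = 1 + a p\<close> satisfies \<open>\<xi>\<^sup>3 = \<xi>\<close>, and \<open>\<xi> = -1\<close> as it is neither 0 nor 1.\<close>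
  ultimately have "(1 + a * p) * (a * p) * (2 + a * p) = 0" by simp
  then have "2 + a * p = 0" using nonzero[OF R] q r by simp
  moreover have "1 + a * p = (2 + a * p) - 1" by simp
  ultimately have "1 + a * p = - 1" by simp
  then have "reflection_matrix a b c p q r = vector [vector [-1, 0, 0], vector [b * p, 1, 0], vector [c * p, 0, 1]]"
    unfolding reflection_matrix_def q r by (simp only: mult_zero_right add_0_right)
  then show "reflection_matrix a b c p q r \<in>
      {vector [vector [-1, 0, 0], vector [a, 1, 0], vector [d, 0, 1]] | a d. True}"
    by blast
next
  fix M :: "'k^3^3" assume "M \<in> {vector [vector [-1, 0, 0], vector [a, 1, 0], vector [d, 0, 1]] | a d :: 'k. True}"
  then obtain a d where M: "M = vector [vector [-1, 0, 0], vector [a, 1, 0], vector [d, 0, 1]]" by blast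
  have "cubic_reflection (\<lambda>x y z. x ^ 3) (- 2) a d 1 0 (0 :: 'k)"
    by (simp add: cubic_reflection_def root_of_unity_minus_one)
  moreover have "M = reflection_matrix (- 2) a d 1 0 0" by (simp add: M reflection_matrix_def)
  ultimately show "\<exists>a b c p q r. cubic_reflection (\<lambda>x y z. x ^ 3) a b c p q r \<and> M = reflection_matrix a b c p q r"
    by blast
qed

lemma reflections_of_square_times_line:
  "reflections_of (\<lambda>x y z. x ^ 2 * y) =
     {vector [vector [1, 0, 0], vector [0, \<xi>, 0], vector [0, d, 1]] | \<xi> d :: 'k::field_char_0.
        root_of_unity \<xi> \<and> \<xi> \<noteq> 1}"
proof (rule reflections_of_eqI)
  fix a b c p q r :: 'k
  assume R: "cubic_reflection (\<lambda>x y z. x ^ 2 * y) a b c p q r"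
  have r: "r = 0"
  proof (rule ccontr)
    assume "r \<noteq> 0"
    then show False using vanishes[OF R, of 1 1 "- (p + q) / r"] by simp
  qed
  have pq: "p = 0 \<or> q = 0" using vanishes[OF R, of q "- p" 0] by (auto simp: mult.commute)
  have "q \<noteq> 0"
  proof
    assume q: "q = 0"
    have 1: "(1 + a * p) ^ 2 * (1 + b * p) = 1 + a * p" and 2: "(1 + a * p) ^ 2 * (b * p) = 0"
      using semi_invariant[OF R, of 1 1 0] semi_invariant[OF R, of 1 0 0] q r by simp_all
    have "(1 + a * p) * (a * p) = (1 + a * p) ^ 2 * (1 + b * p) - (1 + a * p) ^ 2 * (b * p) - (1 + a * p)"
      by (simp add: power2_eq_square algebra_simps)
    then have "(1 + a * p) * (a * p) = 0" unfolding 1 2 by simp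
    then show False using nonzero[OF R] q r by simp
  qed
  then have p: "p = 0" using pq by blast
  have aq: "a * q = 0"
    using semi_invariant[OF R, of 0 1 0] nonzero(2)[OF R] p r by simp
  show "reflection_matrix a b c p q r \<in> {vector [vector [1, 0, 0], vector [0, \<xi>, 0], vector [0, d, 1]] | \<xi> d.
        root_of_unity \<xi> \<and> \<xi> \<noteq> 1}"
    using root[OF R] nonzero(1)[OF R] by (auto simp: reflection_matrix_def p r aq)
next
  fix M :: "'k^3^3" assume "M \<in> {vector [vector [1, 0, 0], vector [0, \<xi>, 0], vector [0, d, 1]] | \<xi> d :: 'k.
        root_of_unity \<xi> \<and> \<xi> \<noteq> 1}"
  then obtain \<xi> d where M: "M = vector [vector [1, 0, 0], vector [0, \<xi>, 0], vector [0, d, 1]]"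
    and \<xi>: "root_of_unity \<xi>" "\<xi> \<noteq> 1" by blast
  have "cubic_reflection (\<lambda>x y z. x ^ 2 * y) 0 (\<xi> - 1) d 0 1 0"
    using \<xi> by (simp add: cubic_reflection_def algebra_simps)
  moreover have "M = reflection_matrix 0 (\<xi> - 1) d 0 1 0" by (simp add: M reflection_matrix_def)
  ultimately show "\<exists>a b c p q r. cubic_reflection (\<lambda>x y z. x ^ 2 * y) a b c p q r \<and> M = reflection_matrix a b c p q r"
    by blast
qed

lemma reflections_of_triangle:
  "reflections_of (\<lambda>x y z. 2 * (x * y * z)) =
     {vector [vector [1, 0, 0], vector [0, 1, 0], vector [0, 0, \<xi>]] | \<xi> :: 'k::field_char_0. root_of_unity \<xi> \<and> \<xi> \<noteq> 1} \<union>
     {vector [vector [1, 0, 0], vector [0, \<xi>, 0], vector [0, 0, 1]] | \<xi>. root_of_unity \<xi> \<and> \<xi> \<noteq> 1} \<union>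
     {vector [vector [\<xi>, 0, 0], vector [0, 1, 0], vector [0, 0, 1]] | \<xi>. root_of_unity \<xi> \<and> \<xi> \<noteq> 1}"
    (is "_ = ?S3 \<union> ?S2 \<union> ?S1")
proof (rule reflections_of_eqI)
  fix a b c p q r :: 'k
  assume R: "cubic_reflection (\<lambda>x y z. 2 * (x * y * z)) a b c p q r"
  \<comment> \<open>If two coordinates of \<open>u\<close> were nonzero, then one of two points of the plane \<open>u = 0\<close> would have no zero coordinate.\<close>
  have zero: "x = 0 \<or> y = 0 \<or> z = 0" if "p * x + q * y + r * z = 0" for x y z
    using vanishes[OF R that] by simp
  have pq: "p = 0 \<or> q = 0"
  proof (rule ccontr)
    assume n: "\<not> (p = 0 \<or> q = 0)"
    have "q + r = 0" "q * 2 + r = 0"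
      using zero[of "(q + r) / p" "- 1" "- 1"] zero[of "(q * 2 + r) / p" "- 2" "- 1"] n by simp_all
    moreover have "q = (q * 2 + r) - (q + r)" by simp
    ultimately show False using n by simp
  qed
  have pr: "p = 0 \<or> r = 0"
  proof (rule ccontr)
    assume n: "\<not> (p = 0 \<or> r = 0)"
    have "q + r = 0" "q + r * 2 = 0"
      using zero[of "(q + r) / p" "- 1" "- 1"] zero[of "(q + r * 2) / p" "- 1" "- 2"] n by simp_all
    moreover have "r = (q + r * 2) - (q + r)" by simp
    ultimately show False using n by simp
  qed
  have qr: "q = 0 \<or> r = 0"
  proof (rule ccontr)
    assume n: "\<not> (q = 0 \<or> r = 0)"
    have "p + r = 0" "p + r * 2 = 0"
      using zero[of "- 1" "(p + r) / q" "- 1"] zero[of "- 1" "(p + r * 2) / q" "- 2"] n by simp_all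
    moreover have "r = (p + r * 2) - (p + r)" by simp
    ultimately show False using n by simp
  qed
  have both_zero: "B = 0 \<and> C = 0" if "B * C = 0" "B * (1 + C) = 0" "(1 + B) * C = 0" for B C :: 'k
  proof -
    have "B = B * (1 + C) - B * C" "C = (1 + B) * C - B * C" by (simp_all add: algebra_simps)
    then show ?thesis using that by simp
  qed
  note si = semi_invariant[OF R] and nz = nonzero[OF R] and root = root[OF R]
  consider "q = 0" "r = 0" | "p = 0" "r = 0" | "p = 0" "q = 0" using pq pr qr by blast
  then show "reflection_matrix a b c p q r \<in> ?S3 \<union> ?S2 \<union> ?S1"
  proof cases
    case 1
    have "b * p = 0 \<and> c * p = 0"
      by (rule both_zero) (use si[of 1 0 0] si[of 1 0 1] si[of 1 1 0] nz(2) 1 in simp_all)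
    then have "b * p = 0" "c * p = 0" by blast+
    then show ?thesis using root nz(1) 1 by (auto simp: reflection_matrix_def)
  next
    case 2
    have "a * q = 0 \<and> c * q = 0"
      by (rule both_zero) (use si[of 0 1 0] si[of 0 1 1] si[of 1 1 0] nz(2) 2 in simp_all)
    then have "a * q = 0" "c * q = 0" by blast+
    then show ?thesis using root nz(1) 2 by (auto simp: reflection_matrix_def)
  next
    case 3
    have "a * r = 0 \<and> b * r = 0"
      by (rule both_zero) (use si[of 0 0 1] si[of 0 1 1] si[of 1 0 1] nz(2) 3 in simp_all)
    then have "a * r = 0" "b * r = 0" by blast+
    then show ?thesis using root nz(1) 3 by (auto simp: reflection_matrix_def)
  qed
next
  fix M :: "'k^3^3" assume "M \<in> ?S3 \<union> ?S2 \<union> ?S1"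
  then obtain \<xi> where \<xi>: "root_of_unity \<xi>" "\<xi> \<noteq> 1" and
    M: "M = reflection_matrix 0 0 (\<xi> - 1) 0 0 1 \<or> M = reflection_matrix 0 (\<xi> - 1) 0 0 1 0 \<or> M = reflection_matrix (\<xi> - 1) 0 0 1 0 0"
    by (auto simp: reflection_matrix_def)
  have "cubic_reflection (\<lambda>x y z. 2 * (x * y * z)) 0 0 (\<xi> - 1) 0 0 1"
    "cubic_reflection (\<lambda>x y z. 2 * (x * y * z)) 0 (\<xi> - 1) 0 0 1 0"
    "cubic_reflection (\<lambda>x y z. 2 * (x * y * z)) (\<xi> - 1) 0 0 1 0 0"
    using \<xi> by (simp_all add: cubic_reflection_def algebra_simps)
  then show "\<exists>a b c p q r. cubic_reflection (\<lambda>x y z. 2 * (x * y * z)) a b c p q r \<and> M = reflection_matrix a b c p q r"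
    using M by blast
qed

text \<open>
  The form is \<open>x y (x + y)\<close>; its zero set consists of three planes through a line. A reflection in one of the
  planes has to interchange the other two and therefore has \<open>\<xi> = -1\<close>.
\<close>

lemma reflections_of_three_concurrent_lines:
  "reflections_of (\<lambda>x y z. x ^ 2 * y + x * y ^ 2) =
     {vector [vector [0, -1, 0], vector [-1, 0, 0], vector [b, b, 1]] | b :: 'k::field_char_0. True} \<union>
     {vector [vector [-1, 0, 0], vector [1, 1, 0], vector [b, 0, 1]] | b. True} \<union>
     {vector [vector [1, 1, 0], vector [0, -1, 0], vector [0, c, 1]] | c. True}"
    (is "reflections_of ?f = ?S3 \<union> ?S1 \<union> ?S2")
proof (rule reflections_of_eqI)
  fix a b c p q r :: 'k
  assume R: "cubic_reflection ?f a b c p q r"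
  have r: "r = 0"
  proof (rule ccontr)
    assume "r \<noteq> 0"
    then show False using vanishes[OF R, of 1 1 "- (p + q) / r"] by simp
  qed
  note si = semi_invariant[OF R] and nz = nonzero[OF R]
  have "q ^ 2 * (- p) + q * (- p) ^ 2 = 0" using vanishes[OF R, of q "- p" 0] by (simp add: mult.commute)
  moreover have "p * q * (p - q) = q ^ 2 * (- p) + q * (- p) ^ 2"
    by (simp add: power2_eq_square algebra_simps)
  ultimately have "p * q * (p - q) = 0" by simp
  \<comment> \<open>For \<open>u = x\<close> or \<open>u = y\<close> the values at two points give the same equations in \<open>A = u(\<alpha>)\<close> and the other coefficient \<open>B\<close>.\<close>
  have reflection_swapping_lines: "A = - 2 \<and> B = 1"
    if nz': "A \<noteq> 0" "1 + A \<noteq> 0" and e: "(1 + A) ^ 2 * B + (1 + A) * B ^ 2 = 0"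
      "(1 + A) ^ 2 * (1 + B) + (1 + A) * (1 + B) ^ 2 = (1 + A) * 2" for A B :: 'k
  proof -
    have "(1 + A) * ((1 + A) * B + B ^ 2) = 0" "(1 + A) * ((1 + A) * (1 + B) + (1 + B) ^ 2 - 2) = 0"
      using e by (simp_all add: power2_eq_square algebra_simps)
    then have f1: "(1 + A) * B + B ^ 2 = 0" and f2: "(1 + A) * (1 + B) + (1 + B) ^ 2 - 2 = 0"
      using nz'(2) by simp_all
    have "A + 2 * B = ((1 + A) * (1 + B) + (1 + B) ^ 2 - 2) - ((1 + A) * B + B ^ 2)"
      by (simp add: power2_eq_square algebra_simps)
    then have A: "A = - (2 * B)" unfolding f1 f2 by (simp add: eq_neg_iff_add_eq_0)
    have "B * (1 - B) = (1 + A) * B + B ^ 2" unfolding A by (simp add: power2_eq_square algebra_simps)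
    then have "B * (1 - B) = 0" unfolding f1 .
    then show ?thesis using A nz'(1) by auto
  qed
  from \<open>p * q * (p - q) = 0\<close> consider "q = 0" | "p = 0" | "p = q" "p \<noteq> 0" by auto
  then show "reflection_matrix a b c p q r \<in> ?S3 \<union> ?S1 \<union> ?S2"
  proof cases
    case 1
    have "a * p = - 2 \<and> b * p = 1"
      by (rule reflection_swapping_lines) (use nz si[of 1 0 0] si[of 1 1 0] 1 r in simp_all)
    then show ?thesis using 1 r by (auto simp: reflection_matrix_def)
  next
    case 2
    have "b * q = - 2 \<and> a * q = 1"
      by (rule reflection_swapping_lines) (use nz si[of 0 1 0] si[of 1 1 0] 2 r in \<open>simp_all add: mult_ac add_ac\<close>)
    then show ?thesis using 2 r by (auto simp: reflection_matrix_def)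
  next
    case 3
    define A B where "A = a * p" and "B = b * p"
    have nz': "A + B \<noteq> 0" "1 + (A + B) \<noteq> 0" using nz 3 r by (simp_all add: A_def B_def)
    have "(1 + A) ^ 2 * B + (1 + A) * B ^ 2 = 0" "A ^ 2 * (1 + B) + A * (1 + B) ^ 2 = 0"
      using si[of 1 0 0] si[of 0 1 0] 3 r by (simp_all add: A_def B_def)
    then have "(1 + (A + B)) * ((1 + A) * B) = 0" "(1 + (A + B)) * (A * (1 + B)) = 0"
      by (simp_all add: power2_eq_square algebra_simps)
    then have "(1 + A) * B = 0" "A * (1 + B) = 0" using nz'(2) by simp_all
    then have "A = - 1" "B = - 1" using nz'(1) by (auto simp: add_eq_0_iff)
    then have "a * p = - 1" "b * p = - 1" by (simp_all add: A_def B_def)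
    then show ?thesis using 3 r by (auto simp: reflection_matrix_def)
  qed
next
  fix M :: "'k^3^3" assume "M \<in> ?S3 \<union> ?S1 \<union> ?S2"
  then obtain c where
    M: "M = reflection_matrix (- 1) (- 1) c 1 1 0 \<or> M = reflection_matrix (- 2) 1 c 1 0 0 \<or> M = reflection_matrix 1 (- 2) c 0 1 0"
    by (auto simp: reflection_matrix_def)
  have "cubic_reflection ?f (- 1) (- 1) c 1 1 0" "cubic_reflection ?f (- 2) 1 c 1 0 0" "cubic_reflection ?f 1 (- 2) c 0 1 0"
    by (simp_all add: cubic_reflection_def root_of_unity_minus_one power2_eq_square algebra_simps)
  then show "\<exists>a b c p q r. cubic_reflection ?f a b c p q r \<and> M = reflection_matrix a b c p q r"
    using M by blast
qed

text \<open>
  The cuspidal cubic is irreducible, so no plane \<open>u = 0\<close> lies in its zero set: every choice of \<open>u\<close> is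
  refuted by a point of the plane at which the cubic is \<open>1\<close>.
\<close>

lemma reflections_of_cuspidal: "reflections_of (\<lambda>x y z :: 'k::field_char_0. x ^ 3 + y ^ 2 * z) = {}"
proof (rule reflections_of_empty, rule notI)
  fix a b c p q r :: 'k
  assume R: "cubic_reflection (\<lambda>x y z. x ^ 3 + y ^ 2 * z) a b c p q r"
  have r: "r = 0"
  proof (rule ccontr)
    assume "r \<noteq> 0"
    then show False using vanishes[OF R, of 1 0 "- p / r"] by simp
  qed
  have q: "q = 0"
  proof (rule ccontr)
    assume "q \<noteq> 0"
    then show False using vanishes[OF R, of 1 "- p / q" 0] r by simp
  qed
  show False using vanishes[OF R, of 0 1 1] q r by simp
qed

text \<open>
  The nodal cubic is irreducible as well.
\<close>

lemma reflections_of_nodal: "reflections_of (\<lambda>x y z :: 'k::field_char_0. x ^ 3 + x ^ 2 * z + y ^ 2 * z) = {}"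
proof (rule reflections_of_empty, rule notI)
  fix a b c p q r :: 'k
  assume R: "cubic_reflection (\<lambda>x y z. x ^ 3 + x ^ 2 * z + y ^ 2 * z) a b c p q r"
  have r: "r = 0"
  proof (rule ccontr)
    assume n: "r \<noteq> 0"
    have 1: "q = 0" using vanishes[OF R, of 0 1 "- q / r"] n by simp
    have 2: "p = r" using vanishes[OF R, of 1 0 "- p / r"] n by (simp add: field_simps)
    show False using vanishes[OF R, of 1 1 "- 1"] 1 2 by simp
  qed
  have q: "q = 0" using vanishes[OF R, of q "- p" 0] r by (simp add: mult.commute)
  show False using vanishes[OF R, of 0 1 1] q r by simp
qed

text \<open>
  If \<open>P x + Q y - z\<close> divides the cubic, its values on the plane at \<open>(1, 0)\<close> and \<open>(0, 1)\<close> give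
  \<open>P\<^sup>3 = Q\<^sup>3 = -1\<close>, and those at \<open>(1, 1)\<close> and \<open>(1, -1)\<close> give \<open>(P + Q)(P Q + l) = (P - Q)(P Q + l) = 0\<close>.
  So \<open>l = - P Q\<close>, which has cube \<open>-1\<close>.
\<close>

lemma Hesse_linear_factor:
  fixes l P Q :: "'k::field_char_0"
  assumes v: "\<And>x y. 1 / 3 * (x ^ 3 + y ^ 3 + (P * x + Q * y) ^ 3) + l * (x * y * (P * x + Q * y)) = 0"
  shows "l ^ 3 = - 1"
proof -
  have v': "x ^ 3 + y ^ 3 + (P * x + Q * y) ^ 3 + 3 * l * (x * y * (P * x + Q * y)) = 0" for x y
  proof -
    have "x ^ 3 + y ^ 3 + (P * x + Q * y) ^ 3 + 3 * l * (x * y * (P * x + Q * y)) =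
      3 * (1 / 3 * (x ^ 3 + y ^ 3 + (P * x + Q * y) ^ 3) + l * (x * y * (P * x + Q * y)))"
      by (simp add: algebra_simps)
    then show ?thesis unfolding v by simp
  qed
  have P: "P ^ 3 = - 1" using v'[of 1 0] by (simp add: add_eq_0_iff)
  have Q: "Q ^ 3 = - 1" using v'[of 0 1] by (simp add: add_eq_0_iff)
  have "3 * ((P + Q) * (P * Q + l)) =
      (1 ^ 3 + 1 ^ 3 + (P * 1 + Q * 1) ^ 3 + 3 * l * (1 * 1 * (P * 1 + Q * 1))) - (P ^ 3 + 1) - (Q ^ 3 + 1)"
    by (simp add: power3_eq_cube algebra_simps)
  then have 1: "3 * ((P + Q) * (P * Q + l)) = 0" unfolding v' P Q by simp
  have "3 * ((P - Q) * (P * Q + l)) =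
      P ^ 3 - Q ^ 3 - (1 ^ 3 + (- 1) ^ 3 + (P * 1 + Q * (- 1)) ^ 3 + 3 * l * (1 * (- 1) * (P * 1 + Q * (- 1))))"
    by (simp add: power3_eq_cube algebra_simps)
  then have 2: "3 * ((P - Q) * (P * Q + l)) = 0" unfolding v' P Q by simp
  have "P * Q + l = 0"
  proof (rule ccontr)
    assume n: "P * Q + l \<noteq> 0"
    then have "P + Q = 0" "P - Q = 0" using 1 2 by simp_all
    moreover have "2 * P = (P + Q) + (P - Q)" by simp
    ultimately have "2 * P = 0" by simp
    then have "P = 0" by simp
    then show False using P by simp
  qed
  then have "l = - (P * Q)" by (simp add: eq_neg_iff_add_eq_0 add.commute)
  then have "l ^ 3 = - (P ^ 3 * Q ^ 3)" by (simp add: power_mult_distrib)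
  then show ?thesis by (simp add: P Q)
qed

text \<open>
  The cubic is symmetric, so whichever coordinate of \<open>u\<close> is nonzero can be solved for and
  \<open>Hesse_linear_factor\<close> applies.
\<close>

lemma reflections_of_Hesse:
  fixes l :: "'k::field_char_0"
  assumes "l ^ 3 \<noteq> - 1"
  shows "reflections_of (\<lambda>x y z. 1 / 3 * (x ^ 3 + y ^ 3 + z ^ 3) + l * (x * y * z)) = {}"
proof (rule reflections_of_empty, rule notI)
  fix a b c p q r :: 'k
  assume R: "cubic_reflection (\<lambda>x y z. 1 / 3 * (x ^ 3 + y ^ 3 + z ^ 3) + l * (x * y * z)) a b c p q r"
  note v = vanishes[OF R]
  have r: "r = 0"
  proof (rule ccontr)
    assume n: "r \<noteq> 0"
    have "1 / 3 * (x ^ 3 + y ^ 3 + (- (p / r) * x + - (q / r) * y) ^ 3) + l * (x * y * (- (p / r) * x + - (q / r) * y)) = 0" for x y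
      by (rule v) (use n in \<open>simp add: field_simps\<close>)
    from Hesse_linear_factor[OF this] show False using assms by blast
  qed
  have q: "q = 0"
  proof (rule ccontr)
    assume n: "q \<noteq> 0"
    have "1 / 3 * (x ^ 3 + z ^ 3 + (- (p / q) * x + - (r / q) * z) ^ 3) + l * (x * z * (- (p / q) * x + - (r / q) * z)) = 0" for x z
    proof -
      have "p * x + q * (- (p / q) * x + - (r / q) * z) + r * z = 0" using n by (simp add: field_simps)
      from v[OF this] show ?thesis by (simp only: add_ac mult_ac)
    qed
    from Hesse_linear_factor[OF this] show False using assms by blast
  qed
  have "p \<noteq> 0" using nonzero[OF R] q r by auto
  have "1 / 3 * (y ^ 3 + z ^ 3 + (0 * y + 0 * z) ^ 3) + l * (y * z * (0 * y + 0 * z)) = 0" for y z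
    using v[of 0 y z] q r by simp
  from Hesse_linear_factor[OF this] show False using assms by blast
qed

text \<open>
  The form is \<open>x (x\<^sup>2 + x y + y z)\<close>, whose only linear factor is \<open>x\<close>.
\<close>

lemma reflections_of_conic_and_secant:
  "reflections_of (\<lambda>x y z :: 'k::field_char_0. x ^ 3 + x ^ 2 * y + x * y * z) =
     {vector [vector [-1, 0, 0], vector [0, 1, 0], vector [2, 0, 1]]}"
    (is "reflections_of ?f = _")
proof (rule reflections_of_eqI)
  fix a b c p q r :: 'k
  assume R: "cubic_reflection ?f a b c p q r"
  have r: "r = 0"
  proof (rule ccontr)
    assume "r \<noteq> 0"
    then show False using vanishes[OF R, of 1 0 "- p / r"] by simp
  qed
  have q: "q = 0"
  proof (rule ccontr)
    assume n: "q \<noteq> 0"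
    then show False using vanishes[OF R, of 1 "- p / q" 0] vanishes[OF R, of 1 "- p / q" 1] r by simp
  qed
  define A B C where "A = a * p" and "B = b * p" and "C = c * p"
  have nz: "A \<noteq> 0" "1 + A \<noteq> 0" using nonzero[OF R] q r by (simp_all add: A_def)
  have e: "(1 + A) ^ 3 + (1 + A) ^ 2 * B + (1 + A) * B * C = 1 + A"
    "(1 + A) ^ 3 + (1 + A) ^ 2 * B + (1 + A) * B * (1 + C) = 1 + A"
    "(1 + A) ^ 3 + (1 + A) ^ 2 * (1 + B) + (1 + A) * (1 + B) * C = (1 + A) * 2"
    using semi_invariant[OF R, of 1 0 0] semi_invariant[OF R, of 1 0 1] semi_invariant[OF R, of 1 1 0] q r
    by (simp_all add: A_def B_def C_def)
  have "(1 + A) * B = ((1 + A) ^ 3 + (1 + A) ^ 2 * B + (1 + A) * B * (1 + C)) -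
      ((1 + A) ^ 3 + (1 + A) ^ 2 * B + (1 + A) * B * C)"
    by (simp add: algebra_simps)
  then have "(1 + A) * B = 0" unfolding e by simp
  then have B: "B = 0" using nz by simp
  have "(1 + A) * A * (A + 2) = (1 + A) ^ 3 - (1 + A)" by (simp add: power3_eq_cube algebra_simps)
  then have "(1 + A) * A * (A + 2) = 0" using e(1) B by simp
  then have A: "A = - 2" using nz by (simp add: eq_neg_iff_add_eq_0)
  have "C = 2" using e(3) unfolding A B by (simp add: algebra_simps)
  then show "reflection_matrix a b c p q r \<in> {vector [vector [-1, 0, 0], vector [0, 1, 0], vector [2, 0, 1]]}"
    using A B by (auto simp: reflection_matrix_def q r A_def B_def C_def)
next
  fix M :: "'k^3^3" assume "M \<in> {vector [vector [-1, 0, 0], vector [0, 1, 0], vector [2, 0, 1]]}"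
  then have "M = reflection_matrix (- 2) 0 2 1 0 0" by (simp add: reflection_matrix_def)
  moreover have "cubic_reflection ?f (- 2) 0 2 1 0 0"
    by (simp add: cubic_reflection_def root_of_unity_minus_one power2_eq_square power3_eq_cube algebra_simps)
  ultimately show "\<exists>a b c p q r. cubic_reflection ?f a b c p q r \<and> M = reflection_matrix a b c p q r"
    by blast
qed

text \<open>
  The form is \<open>x (x z + y\<^sup>2)\<close>. Its only linear factor is \<open>x\<close>, and comparison of the values at
  \<open>(1, 0, 0)\<close> and \<open>(1, 0, 1)\<close> shows \<open>\<xi>\<^sup>2 = \<xi>\<close> for the candidate eigenvalue \<open>\<xi> = 1 + u(\<alpha>)\<close>.
\<close>

lemma reflections_of_conic_and_tangent:
  "reflections_of (\<lambda>x y z :: 'k::field_char_0. x ^ 2 * z + x * y ^ 2) = {}"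
proof (rule reflections_of_empty, rule notI)
  fix a b c p q r :: 'k
  assume R: "cubic_reflection (\<lambda>x y z. x ^ 2 * z + x * y ^ 2) a b c p q r"
  have r: "r = 0"
  proof (rule ccontr)
    assume n: "r \<noteq> 0"
    have p: "p = 0" using vanishes[OF R, of 1 0 "- p / r"] n by simp
    have "- q / r + 1 = 0" "q / r + 1 = 0"
      using vanishes[OF R, of 1 1 "- q / r"] vanishes[OF R, of 1 "- 1" "q / r"] n p by simp_all
    then show False by (simp add: add_eq_0_iff)
  qed
  have q: "q = 0"
  proof (rule ccontr)
    assume n: "q \<noteq> 0"
    then show False using vanishes[OF R, of 1 "- p / q" 0] vanishes[OF R, of 1 "- p / q" 1] r by simp
  qed
  define A B C where "A = a * p" and "B = b * p" and "C = c * p"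
  have nz: "A \<noteq> 0" "1 + A \<noteq> 0" using nonzero[OF R] q r by (simp_all add: A_def)
  have e: "(1 + A) ^ 2 * C + (1 + A) * B ^ 2 = 0" "(1 + A) ^ 2 * (1 + C) + (1 + A) * B ^ 2 = 1 + A"
    using semi_invariant[OF R, of 1 0 0] semi_invariant[OF R, of 1 0 1] q r
    by (simp_all add: A_def B_def C_def)
  have "(1 + A) * A = ((1 + A) ^ 2 * (1 + C) + (1 + A) * B ^ 2) - ((1 + A) ^ 2 * C + (1 + A) * B ^ 2) - (1 + A)"
    by (simp add: power2_eq_square algebra_simps)
  then have "(1 + A) * A = 0" unfolding e by simp
  then show False using nz by simp
qed

lemma coordinate_simps [simp]: "coordinate x y z 1 = x" "coordinate x y z 2 = y" "coordinate x y z 3 = z"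
  by (simp_all add: coordinate_def)

theorem proposition3p3:
  fixes \<Omega> :: "'k::{alg_closed_field, field_char_0} pol3" and S :: "('k^3^3) set" and h :: 'k
  assumes classification: "
      (\<Omega> = X 1 ^ 3 \<and>
       S = {vector [vector [-1, 0, 0], vector [a, 1, 0], vector [d, 0, 1]] | a d. True})
    \<or> (\<Omega> = X 1 ^ 2 * X 2 \<and>
       S = {vector [vector [1, 0, 0], vector [0, \<xi>, 0], vector [0, d, 1]] | \<xi> d.
              root_of_unity \<xi> \<and> \<xi> \<noteq> 1})
    \<or> (\<Omega> = 2 * X 1 * X 2 * X 3 \<and>
       S = {vector [vector [1, 0, 0], vector [0, 1, 0], vector [0, 0, \<xi>]] | \<xi>.
              root_of_unity \<xi> \<and> \<xi> \<noteq> 1} \<union>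
           {vector [vector [1, 0, 0], vector [0, \<xi>, 0], vector [0, 0, 1]] | \<xi>.
              root_of_unity \<xi> \<and> \<xi> \<noteq> 1} \<union>
           {vector [vector [\<xi>, 0, 0], vector [0, 1, 0], vector [0, 0, 1]] | \<xi>.
              root_of_unity \<xi> \<and> \<xi> \<noteq> 1})
    \<or> (\<Omega> = X 1 ^ 2 * X 2 + X 1 * X 2 ^ 2 \<and>
       S = {vector [vector [0, -1, 0], vector [-1, 0, 0], vector [b, b, 1]] | b. True} \<union>
           {vector [vector [-1, 0, 0], vector [1, 1, 0], vector [b, 0, 1]] | b. True} \<union>
           {vector [vector [1, 1, 0], vector [0, -1, 0], vector [0, c, 1]] | c. True})
    \<or> (\<Omega> = X 1 ^ 3 + X 2 ^ 2 * X 3 \<and> S = {})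
    \<or> (\<Omega> = X 1 ^ 3 + X 1 ^ 2 * X 3 + X 2 ^ 2 * X 3 \<and> S = {})
    \<or> (\<exists>lam. lam ^ 3 \<noteq> -1 \<and>
         \<Omega> = Const (1 / 3) * (X 1 ^ 3 + X 2 ^ 3 + X 3 ^ 3) + Const lam * X 1 * X 2 * X 3 \<and> S = {})
    \<or> (\<Omega> = X 1 ^ 3 + X 1 ^ 2 * X 2 + X 1 * X 2 * X 3 \<and>
       S = {vector [vector [-1, 0, 0], vector [0, 1, 0], vector [2, 0, 1]]})
    \<or> (\<Omega> = X 1 ^ 2 * X 3 + X 1 * X 2 ^ 2 \<and> S = {})"
    and "h \<noteq> 0"
    and "quantum_polynomial_ring (quantization \<Omega> h)"
  shows "matrices poly_algebra X (poisson_reflections \<Omega>) =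
           matrices (quantization \<Omega> h) (quantization_gen \<Omega> h) (quasi_reflections (quantization \<Omega> h))
       \<and> matrices poly_algebra X (poisson_reflections \<Omega>) = S"
proof -
  have "\<exists>f. represents_cubic \<Omega> f \<and> reflections_of f = S"
  proof -
    have cube: "represents_cubic (X i ^ 3 :: 'k pol3) (\<lambda>x y z. coordinate x y z i ^ 3)" for i
      using represents_cubic_monomial[of i i i] by (simp add: power3_eq_cube)
    have square: "represents_cubic (X i ^ 2 * X j :: 'k pol3) (\<lambda>x y z. coordinate x y z i ^ 2 * coordinate x y z j)" for i j
      using represents_cubic_monomial[of i i j] by (simp add: power2_eq_square)
    have square': "represents_cubic (X i * X j ^ 2 :: 'k pol3) (\<lambda>x y z. coordinate x y z i * coordinate x y z j ^ 2)" for i j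
      using represents_cubic_monomial[of i j j] by (simp add: power2_eq_square mult.assoc)
    have xyz: "represents_cubic (X 1 * X 2 * X 3 :: 'k pol3) (\<lambda>x y z. x * y * z)"
      using represents_cubic_monomial[of 1 2 3] by simp
    note add = represents_cubic_add and scale = represents_cubic_scale
    have c3: "represents_cubic (2 * X 1 * X 2 * X 3 :: 'k pol3) (\<lambda>x y z. 2 * (x * y * z))"
      using scale[OF xyz, of 2] by (simp add: mult.assoc)
    have c7: "represents_cubic (Const (1 / 3) * (X 1 ^ 3 + X 2 ^ 3 + X 3 ^ 3) + Const lam * X 1 * X 2 * X 3 :: 'k pol3)
        (\<lambda>x y z. 1 / 3 * (x ^ 3 + y ^ 3 + z ^ 3) + lam * (x * y * z))" for lam
      using add[OF scale[OF add[OF add[OF cube[of 1] cube[of 2]] cube[of 3]], of "1 / 3"] scale[OF xyz, of lam]]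
      by (simp add: mult.assoc)
    have c1: "represents_cubic (X 1 ^ 3 :: 'k pol3) (\<lambda>x y z. x ^ 3)"
      using cube[of 1] by simp
    have c2: "represents_cubic (X 1 ^ 2 * X 2 :: 'k pol3) (\<lambda>x y z. x ^ 2 * y)"
      using square[of 1 2] by simp
    have c4: "represents_cubic (X 1 ^ 2 * X 2 + X 1 * X 2 ^ 2 :: 'k pol3) (\<lambda>x y z. x ^ 2 * y + x * y ^ 2)"
      using add[OF square[of 1 2] square'[of 1 2]] by simp
    have c5: "represents_cubic (X 1 ^ 3 + X 2 ^ 2 * X 3 :: 'k pol3) (\<lambda>x y z. x ^ 3 + y ^ 2 * z)"
      using add[OF cube[of 1] square[of 2 3]] by simp
    have c6: "represents_cubic (X 1 ^ 3 + X 1 ^ 2 * X 3 + X 2 ^ 2 * X 3 :: 'k pol3)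
        (\<lambda>x y z. x ^ 3 + x ^ 2 * z + y ^ 2 * z)"
      using add[OF add[OF cube[of 1] square[of 1 3]] square[of 2 3]] by simp
    have c8: "represents_cubic (X 1 ^ 3 + X 1 ^ 2 * X 2 + X 1 * X 2 * X 3 :: 'k pol3)
        (\<lambda>x y z. x ^ 3 + x ^ 2 * y + x * y * z)"
      using add[OF add[OF cube[of 1] square[of 1 2]] xyz] by simp
    have c9: "represents_cubic (X 1 ^ 2 * X 3 + X 1 * X 2 ^ 2 :: 'k pol3) (\<lambda>x y z. x ^ 2 * z + x * y ^ 2)"
      using add[OF square[of 1 3] square'[of 1 2]] by simp
    show ?thesis
      using classification
    proof (elim disjE conjE exE, goal_cases)
      case 1
      show ?case unfolding 1 by (intro exI conjI, rule c1, rule reflections_of_cube)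
    next
      case 2
      show ?case unfolding 2 by (intro exI conjI, rule c2, rule reflections_of_square_times_line)
    next
      case 3
      show ?case unfolding 3 by (intro exI conjI, rule c3, rule reflections_of_triangle)
    next
      case 4
      show ?case unfolding 4 by (intro exI conjI, rule c4, rule reflections_of_three_concurrent_lines)
    next
      case 5
      show ?case unfolding 5 by (intro exI conjI, rule c5, rule reflections_of_cuspidal)
    next
      case 6
      show ?case unfolding 6 by (intro exI conjI, rule c6, rule reflections_of_nodal)
    next
      case (7 lam)
      show ?case unfolding 7(2,3) by (intro exI conjI, rule c7, rule reflections_of_Hesse, rule 7(1))
    next
      case 8
      show ?case unfolding 8 by (intro exI conjI, rule c8, rule reflections_of_conic_and_secant)
    next
      case 9
      show ?case unfolding 9 by (intro exI conjI, rule c9, rule reflections_of_conic_and_tangent)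
    qed
  qed
  then obtain f where "represents_cubic \<Omega> f" "reflections_of f = S" by blast
  from reflections_of_cubic[OF this(1) assms(2,3)] this(2) show ?thesis by simp
qed

end
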